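(* Let $A^0=(A^0(t))_{t\ge0}$ be a stochastic process with almost surely continuous paths $[0,\infty)\to\mathbb R$ and $A^0(0)=0$. Let $\{W^n\}_{n\ge1}$ be standard Brownian motions and $\{\mathcal E^n\}_{n\ge1}$ exponential random variables with common parameter $c>0$, with $A^0$, all $W^n$ and all $\mathcal E^n$ mutually independent. Define recursively $$A^n=\mathcal Q\Big(A^{n-1},\;W^n_\cdot+c\,\cdot-\sum_{i=1}^n\mathcal E^i\Big),\qquad n\ge1.$$ Then, as $n\to\infty$, the processes $A^n+\sum_{i=1}^n\mathcal E^i$ converge weakly (in the space of continuous functions on $[0,\infty)$ with the topology of uniform convergence on compact sets) to a standard Brownian motion.
   Context: For functions $f,g:[0,\infty)\to\mathbb R$ that are càdlàg with $f(0)\ge g(0)$, define $$L_f(g)(t):=g(t)+\inf_{0\le s\le t}\big\{(f(s)-g(s))\wedge 0\big\},$$ and the queueing operator $\mathcal Q(f,g):=L_f(g)$ ($f$ = arrival process, $g$ = service process, $\mathcal Q(f,g)$ = departure process). Note $A^{n-1}(0)=-\sum_{i=1}^{n-1}\mathcal E^i\ge -\sum_{i=1}^{n}\mathcal E^i$, so each $\mathcal Q$ above is well defined. *)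

theory Defs
  imports "HOL-Probability.Probability"
begin

definition refl_map :: "(real \<Rightarrow> real) \<Rightarrow> (real \<Rightarrow> real) \<Rightarrow> real \<Rightarrow> real" where
  "refl_map f g t = g t + Inf ((\<lambda>s. min (f s - g s) 0) ` {0..t})"

definition queue_op :: "(real \<Rightarrow> real) \<Rightarrow> (real \<Rightarrow> real) \<Rightarrow> real \<Rightarrow> real" where
  "queue_op f g = refl_map f g"

primrec tandem :: "(real \<Rightarrow> 'a \<Rightarrow> real) \<Rightarrow> (nat \<Rightarrow> real \<Rightarrow> 'a \<Rightarrow> real) \<Rightarrow> (nat \<Rightarrow> 'a \<Rightarrow> real)
    \<Rightarrow> real \<Rightarrow> nat \<Rightarrow> real \<Rightarrow> 'a \<Rightarrow> real" where
  "tandem A0 W E c 0 = A0"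
| "tandem A0 W E c (Suc n) = (\<lambda>t \<omega>.
     queue_op (\<lambda>s. tandem A0 W E c n s \<omega>)
              (\<lambda>s. W (Suc n) s \<omega> + c * s - (\<Sum>i\<in>{1..Suc n}. E i \<omega>)) t)"

definition std_BM :: "'a measure \<Rightarrow> (real \<Rightarrow> 'a \<Rightarrow> real) \<Rightarrow> bool" where
  "std_BM M B \<longleftrightarrow>
     (\<forall>t\<ge>0. B t \<in> borel_measurable M) \<and>
     (AE \<omega> in M. B 0 \<omega> = 0) \<and>
     (AE \<omega> in M. continuous_on {0..} (\<lambda>t. B t \<omega>)) \<and>
     (\<forall>s t. 0 \<le> s \<and> s < t \<longrightarrow>
        distributed M lborel (\<lambda>\<omega>. B t \<omega> - B s \<omega>) (normal_density 0 (sqrt (t - s)))) \<and>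
     (\<forall>(ts :: nat \<Rightarrow> real) k. 0 \<le> ts 0 \<and> (\<forall>i<k. ts i < ts (Suc i)) \<longrightarrow>
        prob_space.indep_vars M (\<lambda>_. borel) (\<lambda>i \<omega>. B (ts (Suc i)) \<omega> - B (ts i) \<omega>) {..<k})"

definition proc_sigma :: "'a measure \<Rightarrow> (real \<Rightarrow> 'a \<Rightarrow> real) \<Rightarrow> 'a set set" where
  "proc_sigma M X = sigma_sets (space M)
     (\<Union>t\<in>{0..}. {X t -` A \<inter> space M | A. A \<in> sets borel})"

definition rv_sigma :: "'a measure \<Rightarrow> ('a \<Rightarrow> real) \<Rightarrow> 'a set set" where
  "rv_sigma M X = sigma_sets (space M) {X -` A \<inter> space M | A. A \<in> sets borel}"

datatype src = Arr | Srv nat | Expo nat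

definition tandem_sigmas :: "'a measure \<Rightarrow> (real \<Rightarrow> 'a \<Rightarrow> real) \<Rightarrow> (nat \<Rightarrow> real \<Rightarrow> 'a \<Rightarrow> real)
    \<Rightarrow> (nat \<Rightarrow> 'a \<Rightarrow> real) \<Rightarrow> src \<Rightarrow> 'a set set" where
  "tandem_sigmas M A0 W E i = (case i of Arr \<Rightarrow> proc_sigma M A0
                                  | Srv n \<Rightarrow> proc_sigma M (W n)
                                  | Expo n \<Rightarrow> rv_sigma M (E n))"

definition tandem_index :: "src set" where
  "tandem_index = {Arr} \<union> Srv ` {1..} \<union> Expo ` {1..}"

text \<open>Test functionals for weak convergence in C[0,oo) with the topology of uniform
  convergence on compacts: bounded, depending only on the values on [0,oo), and
  (sequentially, the topology being metrizable) continuous on C[0,oo).\<close>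
definition lu_test :: "((real \<Rightarrow> real) \<Rightarrow> real) \<Rightarrow> bool" where
  "lu_test \<Phi> \<longleftrightarrow>
     (\<exists>K. \<forall>f. \<bar>\<Phi> f\<bar> \<le> K) \<and>
     (\<forall>f g. (\<forall>t\<ge>0. f t = g t) \<longrightarrow> \<Phi> f = \<Phi> g) \<and>
     (\<forall>fs f. continuous_on {0..} f \<and> (\<forall>m. continuous_on {0..} (fs m)) \<and>
        (\<forall>T. uniform_limit {0..T} fs f sequentially) \<longrightarrow>
        (\<lambda>m. \<Phi> (fs m)) \<longlonglongrightarrow> \<Phi> f)"

end

theory Submission
  imports Defs
begin

text \<open>After adding the partial sums of the exponentials, the departure process of a queue is
  \<open>w t + c * t + inf (min (x s + e - w s - c * s) 0)\<close>, where the infimum is over \<open>s \<le> t\<close> and \<open>x\<close> is the arrival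
  process, \<open>w\<close> the service process and \<open>e\<close> the initial queue length. This map is a contraction in
  \<open>x\<close> for the supremum norm on \<open>[0, T]\<close>, and its value does not depend on \<open>x\<close> when \<open>e\<close> is so large
  that the queue stays busy until \<open>T\<close>. By Burke's theorem a Brownian motion remains one, so the
  network started from \<open>W 1\<close> after the first station is stationary. Run with the same services, the
  two networks agree on \<open>[0, T]\<close> forever after the first station which is busy in both; since the
  stationary one is tight and the contraction keeps the other one within a bounded distance of it,
  such a station is eventually met.

  For Burke's theorem, the reflection principle for the Brownian motion \<open>W t + c * t - X t\<close> is
  proved on dyadic grids. It shows that the pair of \<open>X t + E\<close> and the queue length at \<open>t\<close> has the
  law of \<open>(X t + E, E)\<close>; thus departures and queue length at time \<open>t\<close> are independent with the
  laws of \<open>X t\<close> and \<open>E\<close>, and the claim follows by restarting the queue at each time.\<close>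

section \<open>The queueing map on paths\<close>

text \<open>The same \<open>c\<close> is the service drift and the exponential rate. Exchanging the
  Gaussian increments of arrivals and services changes their law by a factor exp(-c * v), where
  \<open>v\<close> is an increment of W s + c * s - X s, and this is the ratio of exponential
  densities at points \<open>v\<close> apart. The cancellation makes the exponential queue length
  stationary. Reflection at the first passage through a level calls for a stopping time. On a dyadic
  grid the passage time takes finitely many values, so reflection at fixed times suffices, and
  continuity removes the overshoot in the limit. \<open>W 1\<close> serves the first station of the
  given network and is the input of the stationary one. The two are compared only after that
  station; what matters then is that the later services are independent of both starting paths
  jointly. A test functional sees the whole half-line, whereas the coupling controls compact
  intervals, and it is continuous only on continuous paths. Hence the inf-convolutions, and the
  restriction to an event of probability one on which all paths are good.\<close>

definition dep :: "real \<Rightarrow> (real \<Rightarrow> real) \<Rightarrow> (real \<Rightarrow> real) \<Rightarrow> real \<Rightarrow> real \<Rightarrow> real" where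
  "dep c x w e t = w t + c * t + Inf ((\<lambda>s. min (x s + e - (w s + c * s)) 0) ` {0..t})"

text \<open>Subtracting one constant from arrivals and services subtracts it from the departures, so
  the partial sum \<open>a\<close> of the earlier exponentials drops out and only the newest one,
  \<open>e\<close>, remains as initial content.\<close>

lemma dep_queue_op:
  "queue_op (\<lambda>s. x s - a) (\<lambda>s. w s + c * s - (a + e)) t + (a + e) = dep c x w e t"
  unfolding queue_op_def refl_map_def dep_def by (simp add: algebra_simps)

lemma continuous_on_nonneg_subset:
  "continuous_on {0..} (f :: real \<Rightarrow> real) \<Longrightarrow> continuous_on {0..t} f"
  by (erule continuous_on_subset) auto

lemma dep_attained:
  assumes "continuous_on {0..} x" "continuous_on {0..} w" "0 \<le> t"
  shows "\<And>s. s \<in> {0..t} \<Longrightarrow> dep c x w e t \<le> w t + c * t + min (x s + e - (w s + c * s)) 0"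
    and "\<exists>s\<in>{0..t}. dep c x w e t = w t + c * t + min (x s + e - (w s + c * s)) 0"
proof -
  let ?p = "\<lambda>s. min (x s + e - (w s + c * s)) 0"
  have c: "continuous_on {0..t} ?p"
    using assms by (intro continuous_intros) (auto intro: continuous_on_nonneg_subset)
  obtain s0 where s0: "s0 \<in> {0..t}" "\<forall>s\<in>{0..t}. ?p s0 \<le> ?p s"
    using continuous_attains_inf[OF compact_Icc _ c] \<open>0 \<le> t\<close> by auto
  have "Inf (?p ` {0..t}) = ?p s0"
    using s0 by (intro cInf_eq_minimum) auto
  then have *: "dep c x w e t = w t + c * t + ?p s0"
    unfolding dep_def by simp
  show "\<And>s. s \<in> {0..t} \<Longrightarrow> dep c x w e t \<le> w t + c * t + ?p s"
    unfolding * by (rule add_left_mono, rule s0(2)[rule_format])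
  show "\<exists>s\<in>{0..t}. dep c x w e t = w t + c * t + ?p s"
    by (rule bexI[where x = s0], rule *, rule s0(1))
qed

text \<open>Turning a lower bound on the infimum into a family of pointwise bounds is what makes
  \<open>dep\<close> measurable and what allows \<open>dep_flow\<close> to be proved by comparing
  lower bounds.\<close>

lemma dep_ge_iff:
  assumes "continuous_on {0..} x" "continuous_on {0..} w" "0 \<le> t"
  shows "a \<le> dep c x w e t \<longleftrightarrow> (\<forall>s\<in>{0..t}. a \<le> w t + c * t + min (x s + e - (w s + c * s)) 0)"
proof
  assume "a \<le> dep c x w e t"
  then show "\<forall>s\<in>{0..t}. a \<le> w t + c * t + min (x s + e - (w s + c * s)) 0"
    by (intro ballI order_trans[OF _ dep_attained(1)[OF assms]])
next
  assume "\<forall>s\<in>{0..t}. a \<le> w t + c * t + min (x s + e - (w s + c * s)) 0"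
  moreover obtain s where s: "s \<in> {0..t}" "dep c x w e t = w t + c * t + min (x s + e - (w s + c * s)) 0"
    using dep_attained(2)[OF assms, of c e] by blast
  ultimately show "a \<le> dep c x w e t" by simp
qed

text \<open>Each infimum is compared at the minimiser of the other, and truncation by
  \<open>min _ 0\<close> is 1-Lipschitz.\<close>

lemma dep_contractive:
  assumes "continuous_on {0..} x" "continuous_on {0..} x'" "continuous_on {0..} w" "0 \<le> t"
    and K: "\<And>s. s \<in> {0..t} \<Longrightarrow> \<bar>x s - x' s\<bar> \<le> K"
  shows "\<bar>dep c x w e t - dep c x' w e t\<bar> \<le> K"
proof -
  obtain s where s: "s \<in> {0..t}"
    and 1: "dep c x w e t = w t + c * t + min (x s + e - (w s + c * s)) 0"
    using dep_attained(2)[OF assms(1,3,4)] by blast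
  obtain s' where s': "s' \<in> {0..t}"
    and 2: "dep c x' w e t = w t + c * t + min (x' s' + e - (w s' + c * s')) 0"
    using dep_attained(2)[OF assms(2,3,4)] by blast
  have 3: "dep c x' w e t \<le> w t + c * t + min (x' s + e - (w s + c * s)) 0"
    using dep_attained(1)[OF assms(2,3,4) s] .
  have 4: "dep c x w e t \<le> w t + c * t + min (x s' + e - (w s' + c * s')) 0"
    using dep_attained(1)[OF assms(1,3,4) s'] .
  show ?thesis using 1 2 3 4 K[OF s] K[OF s'] unfolding min_def abs_if by argo
qed

lemma dep_busy:
  assumes "0 \<le> t" "\<And>s. s \<in> {0..t} \<Longrightarrow> w s + c * s \<le> x s + e"
  shows "dep c x w e t = w t + c * t"
proof -
  have "(\<lambda>s. min (x s + e - (w s + c * s)) 0) ` {0..t} = {0}"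
    using assms by (force simp: image_def)
  then show ?thesis unfolding dep_def by simp
qed

lemma dep_zero: "x 0 = 0 \<Longrightarrow> w 0 = 0 \<Longrightarrow> 0 \<le> e \<Longrightarrow> dep c x w e 0 = 0"
  by (simp add: dep_def)

text \<open>The part left after the service term is the running minimum of a continuous function,
  which inherits the modulus of continuity of that function.\<close>

lemma continuous_on_dep:
  assumes "continuous_on {0..} x" "continuous_on {0..} w"
  shows "continuous_on {0..} (dep c x w e)"
proof -
  define p where "p s = min (x s + e - (w s + c * s)) 0" for s
  define J where "J t = dep c x w e t - (w t + c * t)" for t
  have pc: "continuous_on {0..} p"
    unfolding p_def using assms by (intro continuous_intros)
  have J1: "J t \<le> p s" if "s \<in> {0..t}" for s t
    using dep_attained(1)[OF assms _ that, of c e] that unfolding J_def p_def by auto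
  have J2: "\<exists>s\<in>{0..t}. J t = p s" if "0 \<le> t" for t
    using dep_attained(2)[OF assms that, of c e] unfolding J_def p_def by auto
  have "continuous_on {0..} J"
    unfolding continuous_on_iff
  proof (intro ballI allI impI)
    fix t :: real and \<epsilon> :: real assume t: "t \<in> {0..}" and e: "0 < \<epsilon>"
    have "uniformly_continuous_on {0..t+1} p"
      by (intro compact_uniformly_continuous continuous_on_nonneg_subset[OF pc]) simp
    then obtain d where d: "d > 0" "\<And>u v. u \<in> {0..t+1} \<Longrightarrow> v \<in> {0..t+1} \<Longrightarrow> \<bar>v - u\<bar> < d \<Longrightarrow> \<bar>p v - p u\<bar> < \<epsilon>"
      unfolding uniformly_continuous_on_def dist_real_def using e by metis
    have key: "J b < J a + \<epsilon>" if ab: "a \<in> {0..t+1}" "b \<in> {0..t+1}" "\<bar>b - a\<bar> < d" for a b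
    proof -
      obtain s where s: "s \<in> {0..a}" "J a = p s" using J2[of a] ab by auto
      \<comment> \<open>The minimiser on {0..a}, cut off at \<open>b\<close>, is admissible for
        \<open>J b\<close> and has moved by at most |b - a|.\<close>
      let ?s = "min s b"
      have "J b \<le> p ?s" using s ab by (intro J1) auto
      also have "p ?s < p s + \<epsilon>"
        using d(2)[of s ?s] s ab e by (auto simp: min_def abs_if split: if_splits)
      finally show ?thesis using s by simp
    qed
    have "dist (J u) (J t) < \<epsilon>" if "u \<in> {0..}" "dist u t < min d 1" for u
    proof -
      have u: "u \<in> {0..t+1}" "t \<in> {0..t+1}" "\<bar>u - t\<bar> < d"
        using that t unfolding dist_real_def by auto
      show ?thesis
        using key[OF u(1,2)] key[OF u(2,1)] u(3) unfolding dist_real_def by (auto simp: abs_minus_commute abs_diff_less_iff)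
    qed
    then show "\<exists>d>0. \<forall>x'\<in>{0..}. dist x' t < d \<longrightarrow> dist (J x') (J t) < \<epsilon>"
      using d(1) by (intro exI[of _ "min d 1"]) auto
  qed
  then have "continuous_on {0..} (\<lambda>t. J t + (w t + c * t))"
    using assms by (intro continuous_intros)
  then show ?thesis unfolding J_def by simp
qed

section \<open>Queue length and restarting the queue\<close>

definition queue_len :: "real \<Rightarrow> (real \<Rightarrow> real) \<Rightarrow> (real \<Rightarrow> real) \<Rightarrow> real \<Rightarrow> real \<Rightarrow> real" where
  "queue_len c x w e t = x t + e - dep c x w e t"

lemma queue_len_nonneg:
  assumes "continuous_on {0..} x" "continuous_on {0..} w" "0 \<le> t"
  shows "0 \<le> queue_len c x w e t"
  using dep_attained(1)[OF assms, of t c e] assms(3) unfolding queue_len_def by auto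

text \<open>With D s = w s + c * s - x s, the queue length is max e (sup D) - D t. The first
  alternative says that the initial content alone accounts for \<open>v\<close>, the second that a
  past value of D does; Burke's theorem treats them separately.\<close>

lemma queue_len_ge_iff:
  assumes "continuous_on {0..} x" "continuous_on {0..} w" "0 \<le> t" "0 \<le> v"
  shows "v \<le> queue_len c x w e t \<longleftrightarrow>
    w t + c * t - x t + v \<le> e \<or> (\<exists>s\<in>{0..t}. w t + c * t - x t + v \<le> w s + c * s - x s)"
proof
  assume v: "v \<le> queue_len c x w e t"
  obtain s where s: "s \<in> {0..t}" "dep c x w e t = w t + c * t + min (x s + e - (w s + c * s)) 0"
    using dep_attained(2)[OF assms(1-3), of c e] by blast
  have "w t + c * t - x t + v \<le> e \<or> w t + c * t - x t + v \<le> w s + c * s - x s"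
    using v s(2) unfolding queue_len_def min_def by argo
  then show "w t + c * t - x t + v \<le> e \<or> (\<exists>s\<in>{0..t}. w t + c * t - x t + v \<le> w s + c * s - x s)"
    using s(1) by blast
next
  assume "w t + c * t - x t + v \<le> e \<or> (\<exists>s\<in>{0..t}. w t + c * t - x t + v \<le> w s + c * s - x s)"
  then obtain s where s: "s \<in> {0..t}" "w t + c * t - x t + v \<le> e \<or> w t + c * t - x t + v \<le> w s + c * s - x s"
    using assms(3) by auto
  then show "v \<le> queue_len c x w e t"
    using dep_attained(1)[OF assms(1-3) s(1), of c e] unfolding queue_len_def min_def by argo
qed

text \<open>The content at time \<open>s\<close> summarises the past: constraints from times before
  \<open>s\<close> enter the later departures only through \<open>dep c x w e s\<close>.\<close>

lemma dep_flow:
  assumes "continuous_on {0..} x" "continuous_on {0..} w" "0 \<le> s" "0 \<le> h"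
  shows "dep c (\<lambda>u. x (s + u) - x s) (\<lambda>u. w (s + u) - w s) (queue_len c x w e s) h
    = dep c x w e (s + h) - dep c x w e s"
proof -
  let ?x = "\<lambda>u. x (s + u) - x s" and ?w = "\<lambda>u. w (s + u) - w s" and ?q = "queue_len c x w e s"
  have c: "continuous_on {0..} ?x" "continuous_on {0..} ?w"
    using assms(1,2,3) by (auto intro!: continuous_intros continuous_on_compose2[of "{0..}" _ "{0..}" "\<lambda>u. s + u"])
  have *: "dep c ?x ?w ?q h \<ge> a \<longleftrightarrow> dep c x w e (s + h) - dep c x w e s \<ge> a" for a
  proof -
    let ?z = "\<lambda>r. w r + c * r - x r - e"
    obtain r where r: "r \<in> {0..s}" "dep c x w e s = w s + c * s + min (- ?z r) 0"
      using dep_attained(2)[OF assms(1-3), of c e] by (force simp: algebra_simps)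
    have r': "dep c x w e s \<le> w s + c * s + min (- ?z u) 0" if "u \<in> {0..s}" for u
      using dep_attained(1)[OF assms(1-3) that, of c e] by (simp add: algebra_simps)
    have "dep c ?x ?w ?q h \<ge> a \<longleftrightarrow> (\<forall>u\<in>{0..h}. a \<le> w (s+h) - w s + c * h + min (w s + c * s - dep c x w e s - ?z (s+u)) 0)"
      unfolding dep_ge_iff[OF c assms(4)] queue_len_def by (simp add: algebra_simps)
    also have "\<dots> \<longleftrightarrow> (\<forall>u\<in>{s..s+h}. a \<le> w (s+h) - w s + c * h + min (w s + c * s - dep c x w e s - ?z u) 0)"
      (is "_ \<longleftrightarrow> (\<forall>u\<in>_. ?Q u)")
    proof safe
      fix u assume *: "\<forall>u\<in>{0..h}. ?Q (s + u)" "u \<in> {s..s+h}"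
      have "u - s \<in> {0..h}" using *(2) by auto
      from *(1)[rule_format, OF this] show "?Q u" by simp
    next
      fix u assume *: "\<forall>u\<in>{s..s+h}. ?Q u" "u \<in> {0..h}"
      show "?Q (s + u)" by (rule *(1)[rule_format]) (use *(2) in auto)
    qed
    also have "\<dots> \<longleftrightarrow> (\<forall>u\<in>{0..s+h}. dep c x w e s + a \<le> w (s+h) + c * (s+h) + min (- ?z u) 0)"
    proof safe
      fix u assume *: "\<forall>u\<in>{s..s+h}. ?Q u" "u \<in> {0..s+h}"
      \<comment> \<open>Its \<open>min _ 0\<close> bounds \<open>a\<close> by the service offered on
        [s, s + h]; for times before \<open>s\<close> this is added to \<open>r'\<close>.\<close>
      have "?Q s" by (rule *(1)[rule_format]) (use assms in auto)
      show "dep c x w e s + a \<le> w (s+h) + c * (s+h) + min (- ?z u) 0"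
      proof (cases "u \<le> s")
        case True
        then have "dep c x w e s \<le> w s + c * s + min (- ?z u) 0" using r' *(2) by auto
        then show ?thesis using \<open>?Q s\<close> by (simp only: distrib_left min_def) argo
      next
        case False
        then have "?Q u" by (intro *(1)[rule_format]) (use *(2) in auto)
        then show ?thesis using r(2) \<open>?Q s\<close> by (simp only: distrib_left min_def) argo
      qed
    next
      fix u assume *: "\<forall>u\<in>{0..s+h}. dep c x w e s + a \<le> w (s+h) + c * (s+h) + min (- ?z u) 0" "u \<in> {s..s+h}"
      \<comment> \<open>The constraint at \<open>r\<close>, where the minimum up to \<open>s\<close>
        is attained, gives back the bound of \<open>a\<close> by the service on [s, s + h].\<close>
      have "u \<in> {0..s+h}" "r \<in> {0..s+h}" using * r assms by auto
      from *(1)[rule_format, OF this(1)] *(1)[rule_format, OF this(2)] r(2)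
      show "?Q u" by (simp only: distrib_left min_def) argo
    qed
    also have "\<dots> \<longleftrightarrow> dep c x w e (s + h) - dep c x w e s \<ge> a"
      using dep_ge_iff[OF assms(1,2), of "s + h" "dep c x w e s + a" c e] assms(3,4)
      by (simp add: algebra_simps)
    finally show ?thesis .
  qed
  show ?thesis using *[of "dep c ?x ?w ?q h"] *[of "dep c x w e (s + h) - dep c x w e s"] by auto
qed

lemma queue_len_flow:
  assumes "continuous_on {0..} x" "continuous_on {0..} w" "0 \<le> s" "0 \<le> h"
  shows "queue_len c (\<lambda>u. x (s + u) - x s) (\<lambda>u. w (s + u) - w s) (queue_len c x w e s) h
    = queue_len c x w e (s + h)"
  using dep_flow[OF assms, of c e] unfolding queue_len_def by simp

section \<open>Dyadic grids\<close>

text \<open>Rounding \<open>s\<close> down to the grid of level \<open>j\<close> moves it by at most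
  t / 2^j, and continuity passes the bound to the limit.\<close>

lemma dyadic_grid_le:
  assumes z: "continuous_on {0..t} (z :: real \<Rightarrow> real)" and s: "s \<in> {0..t}"
    and K: "\<And>j k. k \<le> 2 ^ j \<Longrightarrow> z (t * real k / 2 ^ j) \<le> K"
  shows "z s \<le> K"
proof (cases "t = 0")
  case True
  then show ?thesis using K[of 0 0] s by simp
next
  case False
  then have t: "t > 0" using s by auto
  define k where "k j = nat \<lfloor>s / t * 2 ^ j\<rfloor>" for j :: nat
  have k1: "real (k j) \<le> s / t * 2 ^ j" "s / t * 2 ^ j < real (k j) + 1" for j
  proof -
    have "0 \<le> s / t * 2 ^ j" using s t by auto
    then show "real (k j) \<le> s / t * 2 ^ j" "s / t * 2 ^ j < real (k j) + 1"
      unfolding k_def by linarith+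
  qed
  have k2: "k j \<le> 2 ^ j" for j
  proof -
    have "s / t * 2 ^ j \<le> 1 * 2 ^ j" using s t by (intro mult_right_mono) auto
    from order_trans[OF k1(1)[of j] this] show ?thesis by simp
  qed
  define u where "u j = t * real (k j) / 2 ^ j" for j
  have u1: "u j \<le> s" "s - t / 2 ^ j \<le> u j" for j
  proof -
    have "t * real (k j) \<le> t * (s / t * 2 ^ j)" "t * (s / t * 2 ^ j) \<le> t * (real (k j) + 1)"
      using k1[of j] t by (intro mult_left_mono; simp)+
    then have "t * real (k j) \<le> s * 2 ^ j" "s * 2 ^ j \<le> t + t * real (k j)"
      using t by (auto simp: algebra_simps)
    then have "u j \<le> s" "s \<le> (t + t * real (k j)) / 2 ^ j"
      unfolding u_def by (simp_all add: pos_divide_le_eq pos_le_divide_eq)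
    then show "u j \<le> s" "s - t / 2 ^ j \<le> u j"
      unfolding u_def by (simp_all add: add_divide_distrib)
  qed
  have u2: "u j \<in> {0..t}" for j
    using u1(1)[of j] s t unfolding u_def by auto
  have "(\<lambda>j. s - t * (1/2) ^ j) \<longlonglongrightarrow> s - t * 0"
    by (intro tendsto_intros LIMSEQ_power_zero) auto
  then have l: "(\<lambda>j. s - t / 2 ^ j) \<longlonglongrightarrow> s"
    by (simp add: power_one_over)
  have "u \<longlonglongrightarrow> s"
    by (rule tendsto_sandwich[OF _ _ l tendsto_const]) (simp_all add: u1)
  then have "(\<lambda>j. z (u j)) \<longlonglongrightarrow> z s"
    by (rule continuous_on_tendsto_compose[OF z _ s]) (intro always_eventually allI u2)
  then show ?thesis
    by (rule LIMSEQ_le_const2) (use K k2 in \<open>unfold u_def, blast\<close>)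
qed

lemma dyadic_grid_in:
  assumes "0 \<le> t" "k \<le> 2 ^ j"
  shows "t * real k / 2 ^ j \<in> {0..t}"
proof -
  have "real k / 2 ^ j \<le> 1" using assms(2) by simp
  then have "t * (real k / 2 ^ j) \<le> t * 1" using assms(1) by (rule mult_left_mono)
  then show ?thesis using assms(1) by simp
qed

lemma ball_le_dyadic:
  assumes z: "continuous_on {0..t} (z :: real \<Rightarrow> real)" and "0 \<le> t"
  shows "(\<forall>s\<in>{0..t}. z s \<le> K) \<longleftrightarrow> (\<forall>j. \<forall>k\<le>2^j. z (t * real k / 2 ^ j) \<le> K)"
  using dyadic_grid_in[OF \<open>0 \<le> t\<close>] dyadic_grid_le[OF z] by blast

text \<open>Continuity reduces the quantifier over an interval to dyadic times, hence to countably
  many measurable conditions. \<open>H\<close> is arbitrary because filtrations and generated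
  sigma-algebras are among the applications.\<close>

lemma sets_ball_le:
  fixes Z :: "real \<Rightarrow> 'a \<Rightarrow> real"
  assumes m: "\<And>s. s \<in> {0..t} \<Longrightarrow> Z s \<in> borel_measurable H" and "0 \<le> t"
    and c: "\<And>\<omega>. \<omega> \<in> space H \<Longrightarrow> continuous_on {0..t} (\<lambda>s. Z s \<omega>)"
  shows "{\<omega>\<in>space H. \<forall>s\<in>{0..t}. Z s \<omega> \<le> K} \<in> sets H"
proof -
  have "{\<omega>\<in>space H. \<forall>s\<in>{0..t}. Z s \<omega> \<le> K}
    = {\<omega>\<in>space H. \<forall>j. \<forall>k\<in>{..2^j}. Z (t * real k / 2 ^ j) \<omega> \<le> K}"
    using ball_le_dyadic[OF c \<open>0 \<le> t\<close>] by auto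
  moreover have "{\<omega>\<in>space H. Z (t * real k / 2 ^ j) \<omega> \<le> K} \<in> sets H" if "k \<le> 2 ^ j" for j k
    using m[OF dyadic_grid_in[OF \<open>0 \<le> t\<close> that]] by measurable
  ultimately show ?thesis
    by (auto intro!: sets.sets_Collect_countable_All sets.sets_Collect_finite_All')
qed

lemma measurable_dep:
  assumes "\<And>s. s \<in> {0..t} \<Longrightarrow> X s \<in> borel_measurable H" "\<And>s. s \<in> {0..t} \<Longrightarrow> W s \<in> borel_measurable H"
    and "E \<in> borel_measurable H" "0 \<le> t"
    and c: "\<And>\<omega>. \<omega> \<in> space H \<Longrightarrow> continuous_on {0..} (\<lambda>s. X s \<omega>)"
     "\<And>\<omega>. \<omega> \<in> space H \<Longrightarrow> continuous_on {0..} (\<lambda>s. W s \<omega>)"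
  shows "(\<lambda>\<omega>. dep c (\<lambda>s. X s \<omega>) (\<lambda>s. W s \<omega>) (E \<omega>) t) \<in> borel_measurable H"
proof -
  have [measurable]: "W t \<in> borel_measurable H" using assms by auto
  note [measurable] = assms(3)
  let ?Z = "\<lambda>s \<omega>. - (W t \<omega> + c * t + min (X s \<omega> + E \<omega> - (W s \<omega> + c * s)) 0)"
  have "{\<omega>\<in>space H. a \<le> dep c (\<lambda>s. X s \<omega>) (\<lambda>s. W s \<omega>) (E \<omega>) t} \<in> sets H" for a
  proof -
    have "{\<omega>\<in>space H. \<forall>s\<in>{0..t}. ?Z s \<omega> \<le> - a} \<in> sets H"
    proof (rule sets_ball_le[OF _ \<open>0 \<le> t\<close>])
      fix s assume "s \<in> {0..t}"
      then have [measurable]: "X s \<in> borel_measurable H" "W s \<in> borel_measurable H" using assms by auto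
      show "?Z s \<in> borel_measurable H" by measurable
    next
      fix \<omega> assume "\<omega> \<in> space H"
      then show "continuous_on {0..t} (\<lambda>s. ?Z s \<omega>)"
        by (intro continuous_intros continuous_on_nonneg_subset c)
    qed
    moreover have "{\<omega>\<in>space H. a \<le> dep c (\<lambda>s. X s \<omega>) (\<lambda>s. W s \<omega>) (E \<omega>) t}
      = {\<omega>\<in>space H. \<forall>s\<in>{0..t}. ?Z s \<omega> \<le> - a}"
      unfolding neg_le_iff_le by (intro Collect_cong conj_cong refl dep_ge_iff c \<open>0 \<le> t\<close>)
    ultimately show ?thesis by simp
  qed
  then show ?thesis unfolding borel_measurable_iff_ge by blast
qed

section \<open>Laws on path space\<close>

text \<open>Lower orthants are closed under intersection and generate the Borel sets. Finite
  measures are allowed because laws restricted to an event are compared later, in the plane and in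
  three dimensions.\<close>

lemma finite_measure_eqI_atMost:
  fixes M N :: "'a::ordered_euclidean_space measure"
  assumes "finite_measure M" and sets: "sets M = sets borel" "sets N = sets borel"
    and eq: "\<And>a. emeasure M {..a} = emeasure N {..a}"
  shows "M = N"
proof (rule measure_eqI_generator_eq[where E="range (\<lambda>a. {..a})" and A="\<lambda>n. {..real n *\<^sub>R One}" and \<Omega>=UNIV])
  show "Int_stable (range (\<lambda>a::'a. {..a}))"
  proof (rule Int_stableI)
    fix A B :: "'a set" assume "A \<in> range (\<lambda>a. {..a})" "B \<in> range (\<lambda>a. {..a})"
    then obtain a b where "A = {..a}" "B = {..b}" by auto
    then have "A \<inter> B = {..inf a b}" by auto
    then show "A \<inter> B \<in> range (\<lambda>a. {..a})" by simp
  qed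
  show "sets M = sigma_sets UNIV (range (\<lambda>a. {..a}))" "sets N = sigma_sets UNIV (range (\<lambda>a. {..a}))"
    unfolding sets by (simp_all add: borel_eq_atMost)
  show "(\<Union>n. {..real n *\<^sub>R (One::'a)}) = UNIV"
  proof (rule UNIV_eq_I[symmetric])
    fix x :: 'a
    obtain n where n: "norm x \<le> real n" using real_arch_simple by blast
    have "x \<le> real n *\<^sub>R One"
      unfolding eucl_le[where 'a='a]
    proof
      fix i :: 'a assume i: "i \<in> Basis"
      have "x \<bullet> i \<le> norm x" using Basis_le_norm[OF i, of x] by simp
      then show "x \<bullet> i \<le> real n *\<^sub>R One \<bullet> i" using n i by simp
    qed
    then show "x \<in> (\<Union>n. {..real n *\<^sub>R (One::'a)})" by auto
  qed
  show "emeasure M {..real i *\<^sub>R One} \<noteq> \<infinity>" for i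
    using finite_measure.emeasure_finite[OF assms(1)] by simp
qed (auto simp: eq)

section \<open>Gaussian increments along a grid\<close>

abbreviation gauss :: "real \<Rightarrow> real measure" where
  "gauss r \<equiv> density lborel (normal_density 0 (sqrt r))"

lemma prob_space_gauss: "0 < r \<Longrightarrow> prob_space (gauss r)"
  by (rule prob_space_normal_density) simp

lemma std_BM_measurable: "std_BM M Y \<Longrightarrow> 0 \<le> t \<Longrightarrow> Y t \<in> borel_measurable M"
  unfolding std_BM_def by blast

lemma std_BM_increment_distr:
  assumes "std_BM M Y" "0 \<le> s" "s < t"
  shows "distr M borel (\<lambda>\<omega>. Y t \<omega> - Y s \<omega>) = gauss (t - s)"
proof -
  have "distributed M lborel (\<lambda>\<omega>. Y t \<omega> - Y s \<omega>) (normal_density 0 (sqrt (t - s)))"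
    using assms unfolding std_BM_def by blast
  then have "distr M lborel (\<lambda>\<omega>. Y t \<omega> - Y s \<omega>) = gauss (t - s)"
    unfolding distributed_def by blast
  moreover have "distr M lborel (\<lambda>\<omega>. Y t \<omega> - Y s \<omega>) = distr M borel (\<lambda>\<omega>. Y t \<omega> - Y s \<omega>)"
    by (rule distr_cong) simp_all
  ultimately show ?thesis by simp
qed

text \<open>The increments on a grid of spacing \<open>d\<close> have, as one sequence, an explicit
  product law; through it Brownian motions on different spaces can be compared.\<close>

lemma std_BM_grid_distr:
  assumes "prob_space M" "std_BM M Y" "0 < d"
  shows "distr M (PiM UNIV (\<lambda>_. borel)) (\<lambda>\<omega> i. Y (d * real (Suc i)) \<omega> - Y (d * real i) \<omega>)
    = PiM UNIV (\<lambda>_::nat. gauss d)"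
proof -
  interpret prob_space M by fact
  let ?D = "\<lambda>i \<omega>. Y (d * real (Suc i)) \<omega> - Y (d * real i) \<omega>"
  have m [measurable]: "?D i \<in> borel_measurable M" for i
    using std_BM_measurable[OF assms(2)] \<open>0 < d\<close> by (intro borel_measurable_diff) auto
  have fin: "indep_vars (\<lambda>_. borel) ?D {..<k}" for k
  proof -
    have "\<forall>(ts :: nat \<Rightarrow> real) k. 0 \<le> ts 0 \<and> (\<forall>i<k. ts i < ts (Suc i)) \<longrightarrow>
        indep_vars (\<lambda>_. borel) (\<lambda>i \<omega>. Y (ts (Suc i)) \<omega> - Y (ts i) \<omega>) {..<k}"
      using assms(2) unfolding std_BM_def by blast
    from this[rule_format, of "\<lambda>i. d * real i" k] show ?thesis
      using \<open>0 < d\<close> by auto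
  qed
  have "indep_vars (\<lambda>_. borel) ?D UNIV"
    unfolding indep_vars_def2
  proof (intro conjI ballI m)
    \<comment> \<open>\<open>std_BM\<close> gives independence for finitely many increments; every
      finite index set lies in some {..<k}.\<close>
    show "indep_sets (\<lambda>i. {?D i -` A \<inter> space M |A. A \<in> sets borel}) UNIV"
      unfolding indep_sets_finite_index_sets[of _ UNIV]
    proof (intro allI impI)
      fix J :: "nat set" assume "finite J"
      then obtain k where "J \<subseteq> {..<k}" by (meson finite_nat_iff_bounded)
      then have "indep_vars (\<lambda>_. borel) ?D J" by (rule indep_vars_subset[OF fin])
      then show "indep_sets (\<lambda>i. {?D i -` A \<inter> space M |A. A \<in> sets borel}) J"
        unfolding indep_vars_def2 by blast
    qed
  qed
  then have "distr M (PiM UNIV (\<lambda>_. borel)) (\<lambda>\<omega>. \<lambda>i\<in>UNIV. ?D i \<omega>) = PiM UNIV (\<lambda>i. distr M borel (?D i))"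
    using m by (subst (asm) indep_vars_iff_distr_eq_PiM) auto
  also have "(\<lambda>i. distr M borel (?D i)) = (\<lambda>_. gauss d)"
  proof
    fix i :: nat
    have "d * real (Suc i) - d * real i = d" by (simp add: algebra_simps)
    then show "distr M borel (?D i) = gauss d"
      using std_BM_increment_distr[OF assms(2), of "d * real i" "d * real (Suc i)"] \<open>0 < d\<close>
      by simp
  qed
  finally show ?thesis by (simp add: restrict_def)
qed

section \<open>Piecewise linear interpolation\<close>

lemma continuous_on_nonnegI:
  fixes f :: "real \<Rightarrow> real"
  assumes "\<And>T. 0 \<le> T \<Longrightarrow> continuous_on {0..T} f"
  shows "continuous_on {0..} f"
  unfolding continuous_on_iff
proof (intro ballI allI impI)
  fix t e :: real assume t: "t \<in> {0..}" and e: "0 < e"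
  have "continuous_on {0..t+1} f" using t by (intro assms) auto
  then obtain d where d: "d > 0" "\<And>u. u \<in> {0..t+1} \<Longrightarrow> dist u t < d \<Longrightarrow> dist (f u) (f t) < e"
    unfolding continuous_on_iff using t e by (metis atLeastAtMost_iff atLeast_iff less_add_one less_eq_real_def)
  have "dist (f u) (f t) < e" if "u \<in> {0..}" "dist u t < min d 1" for u
    using that t by (intro d(2)) (auto simp: dist_real_def)
  then show "\<exists>d>0. \<forall>u\<in>{0..}. dist u t < d \<longrightarrow> dist (f u) (f t) < e"
    using d(1) by (intro exI[of _ "min d 1"]) auto
qed

text \<open>The path that starts at 0 and is linear with increment \<open>v k\<close> on
  [k / n, (k + 1) / n]: the weight of \<open>v k\<close> is the fraction of that interval already
  traversed. Terms with k >= t * n vanish, so the range of summation may be enlarged and made common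
  to all \<open>t\<close> in an interval.\<close>

definition interp :: "nat \<Rightarrow> (nat \<Rightarrow> real) \<Rightarrow> real \<Rightarrow> real" where
  "interp n v t = (\<Sum>k<nat \<lceil>t * real n\<rceil>. v k * min 1 (max 0 (t * real n - real k)))"

lemma interp_eq:
  assumes "t * real n \<le> real K"
  shows "interp n v t = (\<Sum>k<K. v k * min 1 (max 0 (t * real n - real k)))"
  unfolding interp_def
proof (rule sum.mono_neutral_left)
  show "{..<nat \<lceil>t * real n\<rceil>} \<subseteq> {..<K}" using assms by (auto simp: nat_less_iff)
  show "\<forall>i\<in>{..<K} - {..<nat \<lceil>t * real n\<rceil>}. v i * min 1 (max 0 (t * real n - real i)) = 0"
  proof
    fix i assume "i \<in> {..<K} - {..<nat \<lceil>t * real n\<rceil>}"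
    then have "t * real n \<le> real i" by simp
    then show "v i * min 1 (max 0 (t * real n - real i)) = 0" by simp
  qed
qed simp

lemma interp_eq_bounded:
  assumes "t \<in> {0..T}"
  shows "interp n v t = (\<Sum>k<nat \<lceil>T * real n\<rceil>. v k * min 1 (max 0 (t * real n - real k)))"
proof (rule interp_eq)
  have "t * real n \<le> T * real n" using assms by (intro mult_right_mono) auto
  then show "t * real n \<le> real (nat \<lceil>T * real n\<rceil>)" by linarith
qed

lemma continuous_on_interp: "continuous_on {0..} (interp n v)"
proof (rule continuous_on_nonnegI)
  fix T :: real
  show "continuous_on {0..T} (interp n v)"
    by (rule continuous_on_eq[OF _ interp_eq_bounded[of _ T, symmetric]]) (intro continuous_intros)
qed

text \<open>On [0, T] the interpolation is a linear function of finitely many coordinates with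
  weights in [0, 1]. This makes a test functional continuous in the sequence of increments.\<close>

lemma uniform_limit_interp:
  assumes "\<And>k. (\<lambda>m. vs m k) \<longlonglongrightarrow> v k"
  shows "uniform_limit {0..T} (\<lambda>m. interp n (vs m)) (interp n v) sequentially"
proof (rule uniform_limitI)
  fix e :: real assume "e > 0"
  let ?K = "nat \<lceil>T * real n\<rceil>"
  have "(\<lambda>m. \<Sum>k<?K. \<bar>vs m k - v k\<bar>) \<longlonglongrightarrow> (\<Sum>k<?K. \<bar>v k - v k\<bar>)"
    by (intro tendsto_intros assms)
  then have "\<forall>\<^sub>F m in sequentially. (\<Sum>k<?K. \<bar>vs m k - v k\<bar>) < e"
    using \<open>e > 0\<close> by (auto dest: order_tendstoD(2))
  then show "\<forall>\<^sub>F m in sequentially. \<forall>t\<in>{0..T}. dist (interp n (vs m) t) (interp n v t) < e"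
  proof eventually_elim
    case (elim m)
    show ?case
    proof
      fix t assume t: "t \<in> {0..T}"
      have "dist (interp n (vs m) t) (interp n v t)
        = \<bar>\<Sum>k<?K. (vs m k - v k) * min 1 (max 0 (t * real n - real k))\<bar>"
        unfolding interp_eq_bounded[OF t] dist_real_def by (simp add: left_diff_distrib sum_subtractf)
      also have "\<dots> \<le> (\<Sum>k<?K. \<bar>(vs m k - v k) * min 1 (max 0 (t * real n - real k))\<bar>)"
        by (rule sum_abs)
      also have "\<dots> \<le> (\<Sum>k<?K. \<bar>vs m k - v k\<bar> * 1)"
        unfolding abs_mult by (intro sum_mono mult_left_mono) auto
      finally show "dist (interp n (vs m) t) (interp n v t) < e" using elim by simp
    qed
  qed
qed

text \<open>Between two grid points the interpolation is a convex combination of the values of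
  \<open>f\<close> there, and both points lie within one mesh of \<open>t\<close>. The index
  \<open>Suc j\<close> avoids the spacing 1 / 0.\<close>

lemma uniform_limit_interp_increments:
  assumes f: "continuous_on {0..} f" "f 0 = 0"
  shows "uniform_limit {0..T} (\<lambda>j. interp (Suc j) (\<lambda>i. f (1 / real (Suc j) * real (Suc i)) - f (1 / real (Suc j) * real i))) f sequentially"
proof (rule uniform_limitI)
  fix e :: real assume "e > 0"
  have "uniformly_continuous_on {0..T+1} f"
    by (intro compact_uniformly_continuous continuous_on_nonneg_subset f) simp
  then obtain d where d: "d > 0" "\<And>u v. u \<in> {0..T+1} \<Longrightarrow> v \<in> {0..T+1} \<Longrightarrow> \<bar>v - u\<bar> < d \<Longrightarrow> \<bar>f v - f u\<bar> < e"
    unfolding uniformly_continuous_on_def dist_real_def using \<open>e > 0\<close> by metis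
  have "(\<lambda>j. 1 / real (Suc j)) \<longlonglongrightarrow> 0" by (rule LIMSEQ_Suc[OF lim_1_over_n])
  then have "\<forall>\<^sub>F j in sequentially. 1 / real (Suc j) < d" using d(1) by (rule order_tendstoD)
  then show "\<forall>\<^sub>F j in sequentially. \<forall>t\<in>{0..T}. dist (interp (Suc j) (\<lambda>i. f (1 / real (Suc j) * real (Suc i)) - f (1 / real (Suc j) * real i)) t) (f t) < e"
  proof eventually_elim
    case (elim j)
    define n where "n = real (Suc j)"
    have n: "n \<ge> 1" "1 / n < d" using elim unfolding n_def by auto
    show ?case
    proof
      fix t assume t: "t \<in> {0..T}"
      define i where "i = nat \<lfloor>t * n\<rfloor>"
      have "0 \<le> t * n" using t n by auto
      then have i: "real i \<le> t * n" "t * n < real i + 1" unfolding i_def by linarith+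
      let ?v = "\<lambda>i. f (1 / n * real (Suc i)) - f (1 / n * real i)"
      have "interp (Suc j) ?v t = (\<Sum>k<Suc i. ?v k * min 1 (max 0 (t * n - real k)))"
        unfolding n_def by (rule interp_eq) (use i n_def in simp)
      also have "\<dots> = (\<Sum>k<i. ?v k) + ?v i * (t * n - real i)"
      proof -
        have "(\<Sum>k<i. ?v k * min 1 (max 0 (t * n - real k))) = (\<Sum>k<i. ?v k)"
        proof (rule sum.cong[OF refl])
          fix k assume "k \<in> {..<i}"
          then have "real k + 1 \<le> t * n" using i by auto
          then show "?v k * min 1 (max 0 (t * n - real k)) = ?v k" by simp
        qed
        then show ?thesis using i by simp
      qed
      also have "(\<Sum>k<i. ?v k) = f (1 / n * real i)"
        using f(2) by (subst sum_lessThan_telescope) simp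
      finally have eq: "interp (Suc j) ?v t = f (1 / n * real i) + ?v i * (t * n - real i)" .
      have a: "1 / n * real i \<le> t" "t < 1 / n * real i + 1 / n" using i n by (auto simp: field_simps)
      have b: "1 / n * real (Suc i) = 1 / n * real i + 1 / n" by (simp add: algebra_simps)
      have c: "1 / n \<le> 1" using n by simp
      have 1: "\<bar>f (1 / n * real i) - f t\<bar> < e"
        using a n t by (intro d(2)) auto
      have 2: "\<bar>f (1 / n * real (Suc i)) - f t\<bar> < e"
      proof (rule d(2))
        have "0 \<le> 1 / n * real i" using n by simp
        then show "1 / n * real (Suc i) \<in> {0..T + 1}"
          using a c t unfolding b atLeastAtMost_iff by linarith
        show "t \<in> {0..T + 1}" using t by auto
        show "\<bar>1 / n * real (Suc i) - t\<bar> < d" using a n(2) unfolding b by linarith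
      qed
      define h where "h = t * n - real i"
      have h: "0 \<le> h" "h \<le> 1" using i unfolding h_def by auto
      have "interp (Suc j) ?v t - f t = (1 - h) * (f (1 / n * real i) - f t) + h * (f (1 / n * real (Suc i)) - f t)"
        unfolding eq h_def by (simp add: algebra_simps)
      moreover have "\<bar>(1 - h) * (f (1 / n * real i) - f t) + h * (f (1 / n * real (Suc i)) - f t)\<bar> < e"
        using convex_bound_lt[OF 1 2, of "1 - h" h] h
        by (intro order.strict_trans1[OF abs_triangle_ineq]) (auto simp: abs_mult)
      ultimately show "dist (interp (Suc j) (\<lambda>i. f (1 / real (Suc j) * real (Suc i)) - f (1 / real (Suc j) * real i)) t) (f t) < e"
        unfolding dist_real_def n_def by simp
    qed
  qed
qed

section \<open>Test functionals and laws on path space\<close>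

lemma lu_test_bound: "lu_test \<Phi> \<Longrightarrow> \<exists>K. \<forall>f. \<bar>\<Phi> f\<bar> \<le> K"
  unfolding lu_test_def by blast

lemma lu_test_LIMSEQ:
  assumes "lu_test \<Phi>" "continuous_on {0..} f" "\<And>m. continuous_on {0..} (fs m)"
    "\<And>T. uniform_limit {0..T} fs f sequentially"
  shows "(\<lambda>m. \<Phi> (fs m)) \<longlonglongrightarrow> \<Phi> f"
  using assms unfolding lu_test_def by blast

text \<open>A countable product of lines is metrizable, so sequential continuity along
  interpolations is continuity, and its Borel sets are those of the product sigma-algebra.\<close>

lemma lu_test_interp_measurable:
  assumes "lu_test \<Phi>"
  shows "(\<lambda>v. \<Phi> (interp n v)) \<in> borel_measurable (PiM UNIV (\<lambda>_. borel))"
proof -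
  have "continuous_on UNIV (\<lambda>v. \<Phi> (interp n v))"
    unfolding continuous_on_sequentially comp_def
  proof safe
    fix vs :: "nat \<Rightarrow> nat \<Rightarrow> real" and v assume "vs \<longlonglongrightarrow> v"
    then have "(\<lambda>m. vs m k) \<longlonglongrightarrow> v k" for k
      using continuous_on_tendsto_compose[OF continuous_on_product_coordinates] by auto
    then show "(\<lambda>m. \<Phi> (interp n (vs m))) \<longlonglongrightarrow> \<Phi> (interp n v)"
      by (rule lu_test_LIMSEQ[OF assms continuous_on_interp continuous_on_interp uniform_limit_interp])
  qed
  then have m: "(\<lambda>v. \<Phi> (interp n v)) \<in> borel_measurable borel"
    by (rule borel_measurable_continuous_onI)
  have eq: "sets (PiM UNIV (\<lambda>_::nat. borel :: real measure)) = sets borel"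
    by (rule sets_PiM_equal_borel)
  show ?thesis unfolding measurable_cong_sets[OF eq refl] by (rule m)
qed

text \<open>\<open>lu_test\<close> asks for continuity on continuous paths only, so measurability
  along a process is obtained from pointwise limits of functions of countably many
  increments.\<close>

lemma lu_test_measurable:
  assumes \<Phi>: "lu_test \<Phi>" and m: "\<And>t. 0 \<le> t \<Longrightarrow> Y t \<in> borel_measurable M"
    and c: "\<And>\<omega>. \<omega> \<in> space M \<Longrightarrow> continuous_on {0..} (\<lambda>t. Y t \<omega>)"
    and z: "\<And>\<omega>. \<omega> \<in> space M \<Longrightarrow> Y 0 \<omega> = 0"
  defines "D \<equiv> \<lambda>j \<omega> i. Y (1 / real (Suc j) * real (Suc i)) \<omega> - Y (1 / real (Suc j) * real i) \<omega>"
  shows "\<And>j. (\<lambda>\<omega>. D j \<omega>) \<in> measurable M (PiM UNIV (\<lambda>_. borel))"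
    and "\<And>\<omega>. \<omega> \<in> space M \<Longrightarrow> (\<lambda>j. \<Phi> (interp (Suc j) (D j \<omega>))) \<longlonglongrightarrow> \<Phi> (\<lambda>t. Y t \<omega>)"
    and "(\<lambda>\<omega>. \<Phi> (\<lambda>t. Y t \<omega>)) \<in> borel_measurable M"
proof -
  show *: "(\<lambda>\<omega>. D j \<omega>) \<in> measurable M (PiM UNIV (\<lambda>_. borel))" for j
    unfolding D_def by (intro measurable_PiM_single' borel_measurable_diff m) auto
  show **: "(\<lambda>j. \<Phi> (interp (Suc j) (D j \<omega>))) \<longlonglongrightarrow> \<Phi> (\<lambda>t. Y t \<omega>)" if "\<omega> \<in> space M" for \<omega>
    unfolding D_def
    by (rule lu_test_LIMSEQ[OF \<Phi> c[OF that] continuous_on_interp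
          uniform_limit_interp_increments[OF c[OF that] z[OF that]]])
  show "(\<lambda>\<omega>. \<Phi> (\<lambda>t. Y t \<omega>)) \<in> borel_measurable M"
    by (rule borel_measurable_LIMSEQ_real[OF **])
      (auto intro: measurable_compose[OF * lu_test_interp_measurable[OF \<Phi>]])
qed

text \<open>Both expectations are limits of the same Gaussian integrals. Hence \<open>std_BM\<close>
  determines the law on path space, and the limiting Brownian motion can be exchanged for a
  stationary output.\<close>

lemma lu_test_expectation_std_BM:
  assumes \<Phi>: "lu_test \<Phi>"
    and M: "prob_space M" "std_BM M Y" "\<And>\<omega>. \<omega> \<in> space M \<Longrightarrow> continuous_on {0..} (\<lambda>t. Y t \<omega>)"
      "\<And>\<omega>. \<omega> \<in> space M \<Longrightarrow> Y 0 \<omega> = 0"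
    and N: "prob_space N" "std_BM N B" "\<And>\<omega>. \<omega> \<in> space N \<Longrightarrow> continuous_on {0..} (\<lambda>t. B t \<omega>)"
      "\<And>\<omega>. \<omega> \<in> space N \<Longrightarrow> B 0 \<omega> = 0"
  shows "(\<integral>\<omega>. \<Phi> (\<lambda>t. Y t \<omega>) \<partial>M) = (\<integral>\<omega>. \<Phi> (\<lambda>t. B t \<omega>) \<partial>N)"
proof -
  obtain K where K: "\<And>f. \<bar>\<Phi> f\<bar> \<le> K" using lu_test_bound[OF \<Phi>] by blast
  \<comment> \<open>The type of the space is generalised after this proof, so that the fact applies
    to \<open>M\<close> and to \<open>N\<close>.\<close>
  have lim: "(\<lambda>j. \<integral>v. \<Phi> (interp (Suc j) v) \<partial>(PiM UNIV (\<lambda>_::nat. gauss (1 / real (Suc j))))) \<longlonglongrightarrow> (\<integral>\<omega>. \<Phi> (\<lambda>t. Y t \<omega>) \<partial>M)"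
    if M: "prob_space M" "std_BM M Y" "\<And>\<omega>. \<omega> \<in> space M \<Longrightarrow> continuous_on {0..} (\<lambda>t. Y t \<omega>)"
      "\<And>\<omega>. \<omega> \<in> space M \<Longrightarrow> Y 0 \<omega> = 0" for M :: "'d measure" and Y
  proof -
    interpret prob_space M by fact
    note L = lu_test_measurable[OF \<Phi> std_BM_measurable[OF M(2)] M(3,4)]
    let ?D = "\<lambda>j \<omega> i. Y (1 / real (Suc j) * real (Suc i)) \<omega> - Y (1 / real (Suc j) * real i) \<omega>"
    have "(\<lambda>j. \<integral>\<omega>. \<Phi> (interp (Suc j) (?D j \<omega>)) \<partial>M) \<longlonglongrightarrow> (\<integral>\<omega>. \<Phi> (\<lambda>t. Y t \<omega>) \<partial>M)"
    proof (rule integral_dominated_convergence[where w="\<lambda>_. K"])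
      show "(\<lambda>\<omega>. \<Phi> (interp (Suc j) (?D j \<omega>))) \<in> borel_measurable M" for j
        by (rule measurable_compose[OF L(1) lu_test_interp_measurable[OF \<Phi>]])
    qed (use L(2,3) K in auto)
    moreover have "(\<integral>\<omega>. \<Phi> (interp (Suc j) (?D j \<omega>)) \<partial>M)
      = (\<integral>v. \<Phi> (interp (Suc j) v) \<partial>(PiM UNIV (\<lambda>_::nat. gauss (1 / real (Suc j)))))" for j
    proof -
      have g: "PiM UNIV (\<lambda>_::nat. gauss (1 / real (Suc j))) = distr M (PiM UNIV (\<lambda>_. borel)) (?D j)"
        by (rule std_BM_grid_distr[OF M(1,2), symmetric]) simp
      show ?thesis
        unfolding g by (rule integral_distr[OF L(1) lu_test_interp_measurable[OF \<Phi>], symmetric])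
    qed
    ultimately show ?thesis by simp
  qed
  show ?thesis using LIMSEQ_unique[OF lim[OF M] lim[OF N]] .
qed

text \<open>The indicator of a bound on the supremum is not continuous in the path, so
  \<open>lu_test_expectation_std_BM\<close> does not apply. Instead, the bounds along finer dyadic
  grids are decreasing events whose probabilities are read off the same product law for both
  processes.\<close>

lemma std_BM_sup_law:
  assumes M: "prob_space M" "std_BM M Y" "\<And>\<omega>. \<omega> \<in> space M \<Longrightarrow> continuous_on {0..} (\<lambda>t. Y t \<omega>)"
      "\<And>\<omega>. \<omega> \<in> space M \<Longrightarrow> Y 0 \<omega> = 0"
    and N: "prob_space N" "std_BM N B" "\<And>\<omega>. \<omega> \<in> space N \<Longrightarrow> continuous_on {0..} (\<lambda>t. B t \<omega>)"
      "\<And>\<omega>. \<omega> \<in> space N \<Longrightarrow> B 0 \<omega> = 0"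
    and "0 < T"
  shows "measure M {\<omega>\<in>space M. \<forall>s\<in>{0..T}. \<bar>Y s \<omega>\<bar> \<le> K} = measure N {\<omega>\<in>space N. \<forall>s\<in>{0..T}. \<bar>B s \<omega>\<bar> \<le> K}"
proof -
  let ?S = "\<lambda>j. {v\<in>space (PiM UNIV (\<lambda>_::nat. borel)). \<forall>k\<in>{..2^j}. \<bar>\<Sum>i<k. v i :: real\<bar> \<le> K}"
  have S: "?S j \<in> sets (PiM UNIV (\<lambda>_::nat. borel))" for j :: nat by measurable
  have lim: "(\<lambda>j. measure (PiM UNIV (\<lambda>_::nat. gauss (T / 2 ^ j))) (?S j))
      \<longlonglongrightarrow> measure M {\<omega>\<in>space M. \<forall>s\<in>{0..T}. \<bar>Y s \<omega>\<bar> \<le> K}"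
    if M: "prob_space M" "std_BM M Y" "\<And>\<omega>. \<omega> \<in> space M \<Longrightarrow> continuous_on {0..} (\<lambda>t. Y t \<omega>)"
      "\<And>\<omega>. \<omega> \<in> space M \<Longrightarrow> Y 0 \<omega> = 0" for M :: "'d measure" and Y
  proof -
    interpret prob_space M by fact
    let ?A = "\<lambda>j::nat. {\<omega>\<in>space M. \<forall>k\<in>{..2^j}. \<bar>Y (T * real k / 2 ^ j) \<omega>\<bar> \<le> K}"
    let ?D = "\<lambda>j \<omega> i. Y (T / 2 ^ j * real (Suc i)) \<omega> - Y (T / 2 ^ j * real i) \<omega>"
    have Dm: "?D j \<in> measurable M (PiM UNIV (\<lambda>_. borel))" for j :: nat
      using \<open>0 < T\<close> by (intro measurable_PiM_single' borel_measurable_diff std_BM_measurable[OF M(2)]) auto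
    have sum: "(\<Sum>i<k. ?D j \<omega> i) = Y (T * real k / 2 ^ j) \<omega>" if "\<omega> \<in> space M" for j k \<omega>
      using M(4)[OF that] by (subst sum_lessThan_telescope) simp
    have A: "?A j = ?D j -` ?S j \<inter> space M" for j
      using sum by (auto simp: space_PiM)
    have Am: "?A j \<in> sets M" for j unfolding A using measurable_sets[OF Dm S] .
    have "measure M (?A j) = measure (PiM UNIV (\<lambda>_::nat. gauss (T / 2 ^ j))) (?S j)" for j
    proof -
      have g: "PiM UNIV (\<lambda>_::nat. gauss (T / 2 ^ j)) = distr M (PiM UNIV (\<lambda>_. borel)) (?D j)"
        by (rule std_BM_grid_distr[OF M(1,2), symmetric]) (use \<open>0 < T\<close> in simp)
      show ?thesis unfolding A g by (rule measure_distr[OF Dm S, symmetric])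
    qed
    moreover have "(\<lambda>j. measure M (?A j)) \<longlonglongrightarrow> measure M (\<Inter>j. ?A j)"
    proof (rule finite_Lim_measure_decseq)
      show "range ?A \<subseteq> sets M" using Am by auto
      show "decseq ?A"
      proof (rule decseq_SucI)
        fix j :: nat
        show "?A (Suc j) \<subseteq> ?A j"
        proof safe
          fix \<omega> and k :: nat assume *: "\<forall>k\<in>{..2 ^ Suc j}. \<bar>Y (T * real k / 2 ^ Suc j) \<omega>\<bar> \<le> K" "k \<le> 2 ^ j"
          have "2 * k \<in> {..2 ^ Suc j}" using *(2) by simp
          from *(1)[rule_format, OF this] show "\<bar>Y (T * real k / 2 ^ j) \<omega>\<bar> \<le> K" by simp
        qed
      qed
    qed
    moreover have "(\<Inter>j. ?A j) = {\<omega>\<in>space M. \<forall>s\<in>{0..T}. \<bar>Y s \<omega>\<bar> \<le> K}"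
    proof -
      have "(\<forall>s\<in>{0..T}. \<bar>Y s \<omega>\<bar> \<le> K) \<longleftrightarrow> (\<forall>j. \<forall>k\<le>2^j. \<bar>Y (T * real k / 2 ^ j) \<omega>\<bar> \<le> K)" if "\<omega> \<in> space M" for \<omega>
        using \<open>0 < T\<close> by (intro ball_le_dyadic continuous_intros continuous_on_nonneg_subset[OF M(3)[OF that]]) auto
      then show ?thesis by auto
    qed
    ultimately show ?thesis by simp
  qed
  show ?thesis using LIMSEQ_unique[OF lim[OF M] lim[OF N]] .
qed

section \<open>Weak convergence from agreement on compacts\<close>

text \<open>Inf-convolutions: they increase to the functional, and, unlike the functional itself, they
  only see a compact time interval.\<close>

definition lower_env :: "((real \<Rightarrow> real) \<Rightarrow> real) \<Rightarrow> nat \<Rightarrow> (real \<Rightarrow> real) \<Rightarrow> real" where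
  "lower_env \<Phi> k f = (if continuous_on {0..} f then Inf {\<Phi> g + real k * r | g r.
      continuous_on {0..} g \<and> 0 \<le> r \<and> (\<forall>t\<in>{0..real k}. \<bar>f t - g t\<bar> \<le> r)} else 0)"

context
  fixes \<Phi> :: "(real \<Rightarrow> real) \<Rightarrow> real" and K :: real
  assumes K: "\<And>f. \<bar>\<Phi> f\<bar> \<le> K"
begin

lemma lower_env_le:
  assumes "continuous_on {0..} f" "continuous_on {0..} g" "0 \<le> r" "\<And>t. t \<in> {0..real k} \<Longrightarrow> \<bar>f t - g t\<bar> \<le> r"
  shows "lower_env \<Phi> k f \<le> \<Phi> g + real k * r"
proof -
  have "bdd_below {\<Phi> g + real k * r | g r.
      continuous_on {0..} g \<and> 0 \<le> r \<and> (\<forall>t\<in>{0..real k}. \<bar>f t - g t\<bar> \<le> r)}"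
  proof (rule bdd_belowI[of _ "- K"], safe)
    fix g :: "real \<Rightarrow> real" and r :: real assume "0 \<le> r"
    then have "0 \<le> real k * r" by simp
    then show "- K \<le> \<Phi> g + real k * r" using K[of g] by linarith
  qed
  moreover have "\<Phi> g + real k * r \<in> {\<Phi> g + real k * r | g r.
      continuous_on {0..} g \<and> 0 \<le> r \<and> (\<forall>t\<in>{0..real k}. \<bar>f t - g t\<bar> \<le> r)}"
    using assms(2-4) by blast
  ultimately show ?thesis unfolding lower_env_def using assms(1) by (simp add: cInf_lower)
qed

lemma lower_env_greatest:
  assumes "continuous_on {0..} f"
    and "\<And>g r. continuous_on {0..} g \<Longrightarrow> 0 \<le> r \<Longrightarrow> (\<And>t. t \<in> {0..real k} \<Longrightarrow> \<bar>f t - g t\<bar> \<le> r) \<Longrightarrow> a \<le> \<Phi> g + real k * r"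
  shows "a \<le> lower_env \<Phi> k f"
proof -
  let ?S = "{\<Phi> g + real k * r | g r.
      continuous_on {0..} g \<and> 0 \<le> r \<and> (\<forall>t\<in>{0..real k}. \<bar>f t - g t\<bar> \<le> r)}"
  have "\<Phi> f + real k * 0 \<in> ?S" using assms(1) by (intro CollectI exI[of _ f] exI[of _ 0]) auto
  then have "?S \<noteq> {}" by blast
  then have "a \<le> Inf ?S" by (rule cInf_greatest) (use assms(2) in blast)
  then show ?thesis unfolding lower_env_def using assms(1) by simp
qed

lemma lower_env_le_self: "continuous_on {0..} f \<Longrightarrow> lower_env \<Phi> k f \<le> \<Phi> f"
  using lower_env_le[of f f 0 k] by simp

lemma lower_env_bound: "\<bar>lower_env \<Phi> k f\<bar> \<le> K"
proof (cases "continuous_on {0..} f")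
  case True
  have "- K \<le> lower_env \<Phi> k f"
  proof (rule lower_env_greatest[OF True])
    fix g :: "real \<Rightarrow> real" and r :: real assume "0 \<le> r"
    then have "0 \<le> real k * r" by simp
    then show "- K \<le> \<Phi> g + real k * r" using K[of g] by linarith
  qed
  moreover have "lower_env \<Phi> k f \<le> K"
    using lower_env_le_self[OF True, of k] K[of f] by linarith
  ultimately show ?thesis by linarith
next
  case False
  then show ?thesis using K[of f] unfolding lower_env_def by simp
qed

text \<open>A competitor for \<open>f\<close> at distance \<open>r\<close> is one for
  \<open>f'\<close> at distance \<open>r + d\<close>, at an extra cost of \<open>real k * d\<close>.
  This makes the envelope itself a test functional.\<close>

lemma lower_env_lipschitz:
  assumes "continuous_on {0..} f" "continuous_on {0..} f'" "\<And>t. t \<in> {0..real k} \<Longrightarrow> \<bar>f t - f' t\<bar> \<le> d" "0 \<le> d"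
  shows "lower_env \<Phi> k f' \<le> lower_env \<Phi> k f + real k * d"
proof -
  have "lower_env \<Phi> k f' - real k * d \<le> lower_env \<Phi> k f"
  proof (rule lower_env_greatest[OF assms(1)])
    fix g :: "real \<Rightarrow> real" and r :: real
    assume g: "continuous_on {0..} g" "0 \<le> r" "\<And>t. t \<in> {0..real k} \<Longrightarrow> \<bar>f t - g t\<bar> \<le> r"
    have "lower_env \<Phi> k f' \<le> \<Phi> g + real k * (r + d)"
    proof (rule lower_env_le[OF assms(2) g(1)])
      fix t assume "t \<in> {0..real k}"
      from g(3)[OF this] assms(3)[OF this] show "\<bar>f' t - g t\<bar> \<le> r + d" by linarith
    qed (use g(2) assms(4) in simp)
    then show "lower_env \<Phi> k f' - real k * d \<le> \<Phi> g + real k * r" by (simp add: algebra_simps)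
  qed
  then show ?thesis by simp
qed

lemma lu_test_lower_env: "lu_test (lower_env \<Phi> k)"
  unfolding lu_test_def
proof (intro conjI allI impI)
  show "\<exists>K. \<forall>f. \<bar>lower_env \<Phi> k f\<bar> \<le> K" using lower_env_bound by blast
next
  fix f g :: "real \<Rightarrow> real" assume fg: "\<forall>t\<ge>0. f t = g t"
  have "continuous_on {0..} f \<longleftrightarrow> continuous_on {0..} g"
    using fg by (intro continuous_on_cong) auto
  then show "lower_env \<Phi> k f = lower_env \<Phi> k g"
    unfolding lower_env_def using fg by auto
next
  fix fs :: "nat \<Rightarrow> real \<Rightarrow> real" and f
  assume *: "continuous_on {0..} f \<and> (\<forall>m. continuous_on {0..} (fs m)) \<and> (\<forall>T. uniform_limit {0..T} fs f sequentially)"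
  show "(\<lambda>m. lower_env \<Phi> k (fs m)) \<longlonglongrightarrow> lower_env \<Phi> k f"
  proof (rule tendstoI)
    fix e :: real assume "e > 0"
    define d where "d = e / (real k + 1)"
    have d: "d > 0" "real k * d < e" using \<open>e > 0\<close> unfolding d_def by (auto simp: field_simps)
    have "\<forall>\<^sub>F m in sequentially. \<forall>t\<in>{0..real k}. dist (fs m t) (f t) < d"
      using * d(1) by (blast intro: uniform_limitD)
    then show "\<forall>\<^sub>F m in sequentially. dist (lower_env \<Phi> k (fs m)) (lower_env \<Phi> k f) < e"
    proof eventually_elim
      case (elim m)
      have 1: "\<bar>fs m t - f t\<bar> \<le> d" "\<bar>f t - fs m t\<bar> \<le> d" if "t \<in> {0..real k}" for t
        using elim that unfolding dist_real_def by (auto simp: abs_minus_commute intro: less_imp_le)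
      have "lower_env \<Phi> k f \<le> lower_env \<Phi> k (fs m) + real k * d"
        "lower_env \<Phi> k (fs m) \<le> lower_env \<Phi> k f + real k * d"
        using lower_env_lipschitz[of "fs m" f k d] lower_env_lipschitz[of f "fs m" k d] * 1 d(1) by auto
      then show ?case using d(2) unfolding dist_real_def by linarith
    qed
  qed
qed

text \<open>Near-minimisers \<open>g k\<close> satisfy k * |f - g k| <= 2 * K on [0, k], hence
  converge to \<open>f\<close> uniformly on compacts; continuity of \<open>\<Phi>\<close> then
  prevents the values \<open>\<Phi> (g k)\<close> from staying below
  \<open>\<Phi> f\<close>.\<close>

lemma lower_env_LIMSEQ:
  assumes "lu_test \<Phi>" and f: "continuous_on {0..} f"
  shows "(\<lambda>k. lower_env \<Phi> k f) \<longlonglongrightarrow> \<Phi> f"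
proof (rule order_tendstoI)
  fix a assume a: "\<Phi> f < a"
  show "\<forall>\<^sub>F k in sequentially. lower_env \<Phi> k f < a"
    using order.strict_trans1[OF lower_env_le_self[OF f] a] by simp
next
  fix a assume a: "a < \<Phi> f"
  show "\<forall>\<^sub>F k in sequentially. a < lower_env \<Phi> k f"
  proof (rule ccontr)
    assume not: "\<not> (\<forall>\<^sub>F k in sequentially. a < lower_env \<Phi> k f)"
    define b where "b = (a + \<Phi> f) / 2"
    have b: "a < b" "b < \<Phi> f" using a unfolding b_def by auto
    \<comment> \<open>Where the envelope already exceeds \<open>a\<close>, \<open>f\<close> itself
      serves, so that some \<open>g\<close> exists for every \<open>k\<close>. The bound 2 * K comes
      from real k * r < b - \<Phi> g < \<Phi> f - \<Phi> g.\<close>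
    have "\<exists>g. continuous_on {0..} g \<and> (\<forall>t\<in>{0..real k}. real k * \<bar>f t - g t\<bar> \<le> 2 * K) \<and>
        (\<Phi> g \<le> b \<or> a < lower_env \<Phi> k f)" for k
    proof (cases "a < lower_env \<Phi> k f")
      case True
      have "0 \<le> 2 * K" using K[of f] by linarith
      then show ?thesis using True f by (intro exI[of _ f]) auto
    next
      case False
      then have "\<not> b \<le> lower_env \<Phi> k f" using b by linarith
      then obtain g r where g: "continuous_on {0..} g" "0 \<le> r" "\<And>t. t \<in> {0..real k} \<Longrightarrow> \<bar>f t - g t\<bar> \<le> r"
        "\<Phi> g + real k * r < b"
        using lower_env_greatest[OF f, of k b] by force
      have "real k * \<bar>f t - g t\<bar> \<le> 2 * K" if "t \<in> {0..real k}" for t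
      proof -
        have "real k * \<bar>f t - g t\<bar> \<le> real k * r" using g(3)[OF that] by (rule mult_left_mono) simp
        then show ?thesis using g(4) b(2) K[of g] K[of f] by linarith
      qed
      moreover have "\<Phi> g \<le> b" using g(4) mult_nonneg_nonneg[OF of_nat_0_le_iff g(2), of k] by linarith
      ultimately show ?thesis using g(1) by blast
    qed
    then obtain g where g: "\<And>k. continuous_on {0..} (g k)"
      "\<And>k t. t \<in> {0..real k} \<Longrightarrow> real k * \<bar>f t - g k t\<bar> \<le> 2 * K"
      "\<And>k. \<Phi> (g k) \<le> b \<or> a < lower_env \<Phi> k f" by metis
    have "uniform_limit {0..T} g f sequentially" for T
    proof (rule uniform_limitI)
      fix e :: real assume "e > 0"
      have "\<forall>\<^sub>F k in sequentially. max T (2 * K / e) < real k"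
        using filterlim_real_sequentially unfolding filterlim_at_top_dense by blast
      then show "\<forall>\<^sub>F k in sequentially. \<forall>t\<in>{0..T}. dist (g k t) (f t) < e"
      proof eventually_elim
        case (elim k)
        then have k: "T < real k" "2 * K < e * real k" using \<open>e > 0\<close> by (auto simp: field_simps)
        have kp: "0 < real k" using k(2) K[of f] \<open>e > 0\<close> by (cases "k = 0") auto
        show ?case
        proof
          fix t assume "t \<in> {0..T}"
          then have "real k * \<bar>f t - g k t\<bar> \<le> 2 * K" using k by (intro g(2)) auto
          then have "real k * \<bar>f t - g k t\<bar> < real k * e" using k(2) by (simp add: mult.commute)
          then have "\<bar>f t - g k t\<bar> < e" using kp by (simp only: mult_less_cancel_left_pos)
          then show "dist (g k t) (f t) < e" unfolding dist_real_def by (simp add: abs_minus_commute)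
        qed
      qed
    qed
    then have "(\<lambda>k. \<Phi> (g k)) \<longlonglongrightarrow> \<Phi> f" by (rule lu_test_LIMSEQ[OF assms(1) f g(1)])
    then have "\<forall>\<^sub>F k in sequentially. b < \<Phi> (g k)" using b(2) by (rule order_tendstoD)
    then have "\<forall>\<^sub>F k in sequentially. a < lower_env \<Phi> k f"
      by eventually_elim (use g(3) in force)
    then show False using not by blast
  qed
qed

end

lemma lu_test_uminus: "lu_test \<Phi> \<Longrightarrow> lu_test (\<lambda>f. - \<Phi> f)"
  unfolding lu_test_def by (auto intro!: tendsto_minus; blast)

text \<open>All path properties are required at every point of the space; null sets are removed once
  and for all at the end.\<close>

locale coupled_paths = prob_space M for M :: "'a measure" +
  fixes X Y :: "nat \<Rightarrow> real \<Rightarrow> 'a \<Rightarrow> real"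
  assumes X_meas: "\<And>n t. 0 \<le> t \<Longrightarrow> X n t \<in> borel_measurable M"
    and X_cont: "\<And>n \<omega>. \<omega> \<in> space M \<Longrightarrow> continuous_on {0..} (\<lambda>t. X n t \<omega>)"
    and X_zero: "\<And>n \<omega>. \<omega> \<in> space M \<Longrightarrow> X n 0 \<omega> = 0"
    and Y_BM: "\<And>n. std_BM M (Y n)"
    and Y_cont: "\<And>n \<omega>. \<omega> \<in> space M \<Longrightarrow> continuous_on {0..} (\<lambda>t. Y n t \<omega>)"
    and Y_zero: "\<And>n \<omega>. \<omega> \<in> space M \<Longrightarrow> Y n 0 \<omega> = 0"
    and agree: "\<And>k::nat. (\<lambda>n. prob {\<omega>\<in>space M. \<forall>s\<in>{0..real k}. X n s \<omega> = Y n s \<omega>}) \<longlonglongrightarrow> 1"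
begin

lemma agree_sets: "0 \<le> T \<Longrightarrow> {\<omega>\<in>space M. \<forall>s\<in>{0..T}. X n s \<omega> = Y n s \<omega>} \<in> sets M"
proof -
  assume "0 \<le> T"
  have "{\<omega>\<in>space M. \<forall>s\<in>{0..T}. \<bar>X n s \<omega> - Y n s \<omega>\<bar> \<le> 0} \<in> sets M"
    using \<open>0 \<le> T\<close> X_cont Y_cont
    by (intro sets_ball_le borel_measurable_abs borel_measurable_diff X_meas std_BM_measurable[OF Y_BM]
        continuous_intros continuous_on_nonneg_subset) auto
  then show ?thesis by simp
qed

text \<open>On the event of agreement \<open>X n\<close> is a competitor with r = 0, so the envelope
  at \<open>Y n\<close> lies below \<open>\<Phi>\<close> at \<open>X n\<close>; elsewhere the two
  differ by at most 2 * K. As \<open>Y n\<close> is Brownian, the expectation of the envelope does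
  not depend on \<open>n\<close>. The matching upper bound comes from the negated
  functional.\<close>

lemma eventually_expectation_gt:
  assumes \<Phi>: "lu_test \<Phi>"
    and N: "prob_space N" "std_BM N B" "\<And>\<omega>. \<omega> \<in> space N \<Longrightarrow> continuous_on {0..} (\<lambda>t. B t \<omega>)"
      "\<And>\<omega>. \<omega> \<in> space N \<Longrightarrow> B 0 \<omega> = 0"
    and a: "a < (\<integral>\<omega>. \<Phi> (\<lambda>t. B t \<omega>) \<partial>N)"
  shows "\<forall>\<^sub>F n in sequentially. a < expectation (\<lambda>\<omega>. \<Phi> (\<lambda>t. X n t \<omega>))"
proof -
  interpret N: prob_space N by fact
  obtain K where K: "\<And>f. \<bar>\<Phi> f\<bar> \<le> K" using lu_test_bound[OF \<Phi>] by blast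
  note L = lu_test_lower_env[OF K]
  have lb: "\<bar>lower_env \<Phi> k f\<bar> \<le> K" for k f by (rule lower_env_bound) (rule K)
  note BN = lu_test_measurable(3)[OF _ std_BM_measurable[OF N(2)] N(3,4)]
  note XM = lu_test_measurable(3)[OF _ X_meas X_cont X_zero]
  note YM = lu_test_measurable(3)[OF _ std_BM_measurable[OF Y_BM] Y_cont Y_zero]
  have "(\<lambda>k. \<integral>\<omega>. lower_env \<Phi> k (\<lambda>t. B t \<omega>) \<partial>N) \<longlonglongrightarrow> (\<integral>\<omega>. \<Phi> (\<lambda>t. B t \<omega>) \<partial>N)"
    by (rule integral_dominated_convergence[where w="\<lambda>_. K"])
      (use BN L \<Phi> lower_env_bound[OF K] lower_env_LIMSEQ[OF K \<Phi> N(3)] in auto)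
  then obtain k where k: "a < (\<integral>\<omega>. lower_env \<Phi> k (\<lambda>t. B t \<omega>) \<partial>N)"
    using order_tendstoD(1)[OF _ a] eventually_happens[of _ sequentially] by fastforce
  define b where "b = (\<integral>\<omega>. lower_env \<Phi> k (\<lambda>t. B t \<omega>) \<partial>N)"
  define A where "A n = {\<omega>\<in>space M. \<forall>s\<in>{0..real k}. X n s \<omega> = Y n s \<omega>}" for n
  have A[measurable]: "A n \<in> sets M" for n unfolding A_def by (rule agree_sets) simp
  have ge: "b - 2 * K * (1 - prob (A n)) \<le> expectation (\<lambda>\<omega>. \<Phi> (\<lambda>t. X n t \<omega>))" for n
  proof -
    have i: "integrable M (\<lambda>\<omega>. \<Phi> (\<lambda>t. X n t \<omega>))"
      by (rule integrable_const_bound[of _ K]) (use XM[OF \<Phi>] K in auto)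
    have j: "integrable M (\<lambda>\<omega>. lower_env \<Phi> k (\<lambda>t. Y n t \<omega>))"
      by (rule integrable_const_bound[of _ K]) (use YM[OF L] lower_env_bound[OF K] in auto)
    have m: "integrable M (\<lambda>\<omega>. indicator (space M - A n) \<omega> :: real)"
      by (rule integrable_const_bound[of _ 1]) (auto simp: indicator_def)
    have "expectation (\<lambda>\<omega>. lower_env \<Phi> k (\<lambda>t. Y n t \<omega>) - 2 * K * indicator (space M - A n) \<omega>)
      \<le> expectation (\<lambda>\<omega>. \<Phi> (\<lambda>t. X n t \<omega>))"
    proof (rule integral_mono)
      show "integrable M (\<lambda>\<omega>. lower_env \<Phi> k (\<lambda>t. Y n t \<omega>) - 2 * K * indicator (space M - A n) \<omega>)"
        using j m by simp
      fix \<omega> assume w: "\<omega> \<in> space M"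
      show "lower_env \<Phi> k (\<lambda>t. Y n t \<omega>) - 2 * K * indicator (space M - A n) \<omega> \<le> \<Phi> (\<lambda>t. X n t \<omega>)"
      proof (cases "\<omega> \<in> A n")
        case True
        then have "lower_env \<Phi> k (\<lambda>t. Y n t \<omega>) \<le> \<Phi> (\<lambda>t. X n t \<omega>) + real k * 0"
          using X_cont[OF w] Y_cont[OF w] unfolding A_def by (intro lower_env_le[OF K]) auto
        then show ?thesis using True by simp
      next
        case False
        then show ?thesis
          using w lb[of k "\<lambda>t. Y n t \<omega>"] K[of "\<lambda>t. X n t \<omega>"] by (simp add: abs_le_iff)
      qed
    qed (rule i)
    moreover have "expectation (\<lambda>\<omega>. lower_env \<Phi> k (\<lambda>t. Y n t \<omega>) - 2 * K * indicator (space M - A n) \<omega>)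
      = b - 2 * K * (1 - prob (A n))"
      using j m lu_test_expectation_std_BM[OF L prob_space_axioms Y_BM Y_cont Y_zero N]
      unfolding b_def by (simp add: prob_compl[OF A])
    ultimately show ?thesis by simp
  qed
  have "(\<lambda>n. b - 2 * K * (1 - prob (A n))) \<longlonglongrightarrow> b - 2 * K * (1 - 1)"
    unfolding A_def by (intro tendsto_intros agree)
  then have "\<forall>\<^sub>F n in sequentially. a < b - 2 * K * (1 - prob (A n))"
    using k unfolding b_def by (intro order_tendstoD(1)) auto
  then show ?thesis by eventually_elim (use ge in \<open>auto intro: order.strict_trans2\<close>)
qed

lemma expectation_LIMSEQ:
  assumes \<Phi>: "lu_test \<Phi>"
    and N: "prob_space N" "std_BM N B" "\<And>\<omega>. \<omega> \<in> space N \<Longrightarrow> continuous_on {0..} (\<lambda>t. B t \<omega>)"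
      "\<And>\<omega>. \<omega> \<in> space N \<Longrightarrow> B 0 \<omega> = 0"
  shows "(\<lambda>n. expectation (\<lambda>\<omega>. \<Phi> (\<lambda>t. X n t \<omega>))) \<longlonglongrightarrow> (\<integral>\<omega>. \<Phi> (\<lambda>t. B t \<omega>) \<partial>N)"
proof (rule order_tendstoI)
  fix a assume "a < (\<integral>\<omega>. \<Phi> (\<lambda>t. B t \<omega>) \<partial>N)"
  from eventually_expectation_gt[OF \<Phi> N this]
  show "\<forall>\<^sub>F n in sequentially. a < expectation (\<lambda>\<omega>. \<Phi> (\<lambda>t. X n t \<omega>))" .
next
  fix a assume "(\<integral>\<omega>. \<Phi> (\<lambda>t. B t \<omega>) \<partial>N) < a"
  then have "- a < (\<integral>\<omega>. - \<Phi> (\<lambda>t. B t \<omega>) \<partial>N)" by simp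
  from eventually_expectation_gt[OF lu_test_uminus[OF \<Phi>] N this]
  show "\<forall>\<^sub>F n in sequentially. expectation (\<lambda>\<omega>. \<Phi> (\<lambda>t. X n t \<omega>)) < a" by simp
qed

end

section \<open>Coupling two tandem networks\<close>

lemma in_proc_sigma: "0 \<le> t \<Longrightarrow> A \<in> sets borel \<Longrightarrow> X t -` A \<inter> space M \<in> proc_sigma M X"
  unfolding proc_sigma_def by (rule sigma_sets.Basic) auto

lemma proc_sigma_Pow: "(\<Union>t\<in>{0..}. {X t -` A \<inter> space M | A. A \<in> sets borel}) \<subseteq> Pow (space M)"
  by auto

lemma sets_proc_measure:
  "sets (sigma (space M) (\<Union>t\<in>{0..}. {X t -` A \<inter> space M | A. A \<in> sets borel})) = proc_sigma M X"
  unfolding proc_sigma_def by (rule sets_measure_of[OF proc_sigma_Pow])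

lemma sets_ball_abs_le:
  fixes Z :: "real \<Rightarrow> 'a \<Rightarrow> real"
  assumes m: "\<And>s. 0 \<le> s \<Longrightarrow> Z s \<in> borel_measurable H" and "0 \<le> t"
    and c: "\<And>\<omega>. \<omega> \<in> space H \<Longrightarrow> continuous_on {0..} (\<lambda>s. Z s \<omega>)"
  shows "{\<omega>\<in>space H. \<forall>s\<in>{0..t}. \<bar>Z s \<omega>\<bar> \<le> K} \<in> sets H"
proof (rule sets_ball_le[OF _ \<open>0 \<le> t\<close>])
  show "(\<lambda>\<omega>. \<bar>Z s \<omega>\<bar>) \<in> borel_measurable H" if "s \<in> {0..t}" for s
    using that by (intro borel_measurable_abs m) auto
  show "continuous_on {0..t} (\<lambda>s. \<bar>Z s \<omega>\<bar>)" if "\<omega> \<in> space H" for \<omega>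
    by (intro continuous_on_rabs continuous_on_nonneg_subset c that)
qed

text \<open>Independence of the services is available for events in \<open>proc_sigma\<close>, so a
  bound on a whole stretch of path has to be located there.\<close>

lemma proc_ball_le_in_proc_sigma:
  assumes "0 \<le> T" "\<And>\<omega>. \<omega> \<in> space M \<Longrightarrow> continuous_on {0..} (\<lambda>t. W t \<omega>)"
  shows "{\<omega>\<in>space M. \<forall>s\<in>{0..T}. \<bar>W s \<omega>\<bar> \<le> K} \<in> proc_sigma M W"
proof -
  let ?H = "sigma (space M) (\<Union>t\<in>{0..}. {W t -` A \<inter> space M | A. A \<in> sets borel})"
  have sp: "space ?H = space M" by (rule space_measure_of[OF proc_sigma_Pow])
  have m: "W t \<in> borel_measurable ?H" if "0 \<le> t" for t
    by (rule measurableI) (use in_proc_sigma[OF that] in \<open>auto simp: sets_proc_measure sp\<close>)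
  have "{\<omega>\<in>space ?H. \<forall>s\<in>{0..T}. \<bar>W s \<omega>\<bar> \<le> K} \<in> sets ?H"
    by (rule sets_ball_abs_le) (use assms m in \<open>auto simp: sp\<close>)
  then show ?thesis unfolding sp sets_proc_measure .
qed

lemma (in prob_space) prob_path_bounded_LIMSEQ:
  fixes Z :: "real \<Rightarrow> 'a \<Rightarrow> real"
  assumes m: "\<And>s. 0 \<le> s \<Longrightarrow> Z s \<in> borel_measurable M" and "0 \<le> T"
    and c: "\<And>\<omega>. \<omega> \<in> space M \<Longrightarrow> continuous_on {0..} (\<lambda>s. Z s \<omega>)"
  shows "(\<lambda>K::nat. prob {\<omega>\<in>space M. \<forall>s\<in>{0..T}. \<bar>Z s \<omega>\<bar> \<le> real K}) \<longlonglongrightarrow> 1"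
proof -
  let ?A = "\<lambda>K::nat. {\<omega>\<in>space M. \<forall>s\<in>{0..T}. \<bar>Z s \<omega>\<bar> \<le> real K}"
  have "(\<lambda>K. prob (?A K)) \<longlonglongrightarrow> prob (\<Union>K. ?A K)"
  proof (rule finite_Lim_measure_incseq)
    show "range ?A \<subseteq> sets M"
      by (rule image_subsetI, rule sets_ball_abs_le[OF _ \<open>0 \<le> T\<close>]) (simp_all add: m c)
    show "incseq ?A" by (rule incseq_SucI) force
  qed
  also have "(\<Union>K. ?A K) = space M"
  proof (intro equalityI subsetI)
    fix \<omega> assume w: "\<omega> \<in> space M"
    have "bounded ((\<lambda>s. Z s \<omega>) ` {0..T})"
      by (intro compact_imp_bounded compact_continuous_image continuous_on_nonneg_subset c w compact_Icc)
    then obtain B where "\<forall>s\<in>{0..T}. \<bar>Z s \<omega>\<bar> \<le> B" unfolding bounded_iff by auto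
    moreover obtain K where "B \<le> real K" using real_arch_simple by blast
    ultimately have "\<omega> \<in> ?A K" using w by force
    then show "\<omega> \<in> (\<Union>K. ?A K)" by blast
  qed auto
  finally show ?thesis by (simp add: prob_space)
qed

text \<open>\<open>F n\<close> is the information present before station \<open>n\<close> serves:
  \<open>X n\<close> and \<open>Y n\<close> are measurable for it, \<open>W n\<close> and
  \<open>E n\<close> are independent of it and become known in \<open>F (Suc n)\<close>. As
  \<open>X 0\<close> and \<open>Y 0\<close> share \<open>F 0\<close>, they may depend on each
  other.\<close>

locale tandem_coupling = prob_space M for M :: "'a measure" +
  fixes F :: "nat \<Rightarrow> 'a measure" and X Y W :: "nat \<Rightarrow> real \<Rightarrow> 'a \<Rightarrow> real" and E :: "nat \<Rightarrow> 'a \<Rightarrow> real" and c :: real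
  assumes c: "0 < c"
    and subalg: "\<And>n. subalgebra M (F n)"
    and mono: "\<And>n. sets (F n) \<subseteq> sets (F (Suc n))"
    and X0: "\<And>t. 0 \<le> t \<Longrightarrow> X 0 t \<in> borel_measurable (F 0)" "\<And>\<omega>. \<omega> \<in> space M \<Longrightarrow> X 0 0 \<omega> = 0"
      "\<And>\<omega>. \<omega> \<in> space M \<Longrightarrow> continuous_on {0..} (\<lambda>t. X 0 t \<omega>)"
    and Y0: "\<And>t. 0 \<le> t \<Longrightarrow> Y 0 t \<in> borel_measurable (F 0)" "\<And>\<omega>. \<omega> \<in> space M \<Longrightarrow> Y 0 0 \<omega> = 0"
      "\<And>\<omega>. \<omega> \<in> space M \<Longrightarrow> continuous_on {0..} (\<lambda>t. Y 0 t \<omega>)"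
    and XSuc: "\<And>n t \<omega>. X (Suc n) t \<omega> = dep c (\<lambda>s. X n s \<omega>) (\<lambda>s. W n s \<omega>) (E n \<omega>) t"
    and YSuc: "\<And>n t \<omega>. Y (Suc n) t \<omega> = dep c (\<lambda>s. Y n s \<omega>) (\<lambda>s. W n s \<omega>) (E n \<omega>) t"
    and W: "\<And>n t. 0 \<le> t \<Longrightarrow> W n t \<in> borel_measurable (F (Suc n))" "\<And>n \<omega>. \<omega> \<in> space M \<Longrightarrow> W n 0 \<omega> = 0"
      "\<And>n \<omega>. \<omega> \<in> space M \<Longrightarrow> continuous_on {0..} (\<lambda>t. W n t \<omega>)"
    and E: "\<And>n. E n \<in> borel_measurable (F (Suc n))" "\<And>n \<omega>. \<omega> \<in> space M \<Longrightarrow> 0 \<le> E n \<omega>"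
    and W_BM: "\<And>n. std_BM M (W n)"
    and E_tail: "\<And>n a. 0 \<le> a \<Longrightarrow> prob {\<omega>\<in>space M. a < E n \<omega>} = exp (- c * a)"
    and indep: "\<And>n A B C. A \<in> sets (F n) \<Longrightarrow> B \<in> proc_sigma M (W n) \<Longrightarrow> C \<in> rv_sigma M (E n) \<Longrightarrow>
      prob (A \<inter> B \<inter> C) = prob A * prob B * prob C"
begin

lemma space_F [simp]: "space (F n) = space M"
  using subalg[of n] unfolding subalgebra_def by simp

lemma sets_F: "A \<in> sets (F n) \<Longrightarrow> A \<in> sets M"
  using subalg[of n] unfolding subalgebra_def by auto

lemma measurable_F_Suc: "f \<in> borel_measurable (F n) \<Longrightarrow> f \<in> borel_measurable (F (Suc n))"
  by (rule measurable_from_subalg[of _ "F n"]) (auto simp: subalgebra_def mono)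

text \<open>\<open>Z\<close> stands for either network, as both obey the recursion with the same
  services.\<close>

lemma paths:
  "(\<forall>t\<ge>0. Z 0 t \<in> borel_measurable (F 0)) \<Longrightarrow> (\<forall>\<omega>\<in>space M. Z 0 0 \<omega> = 0 \<and> continuous_on {0..} (\<lambda>t. Z 0 t \<omega>)) \<Longrightarrow>
   (\<And>n t \<omega>. Z (Suc n) t \<omega> = dep c (\<lambda>s. Z n s \<omega>) (\<lambda>s. W n s \<omega>) (E n \<omega>) t) \<Longrightarrow>
   (\<forall>t\<ge>0. Z n t \<in> borel_measurable (F n)) \<and> (\<forall>\<omega>\<in>space M. Z n 0 \<omega> = 0 \<and> continuous_on {0..} (\<lambda>t. Z n t \<omega>))"
proof (induction n)
  case 0
  then show ?case by blast
next
  case (Suc n)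
  note IH = Suc.IH[OF Suc.prems]
  have *: "Z (Suc n) = (\<lambda>t \<omega>. dep c (\<lambda>s. Z n s \<omega>) (\<lambda>s. W n s \<omega>) (E n \<omega>) t)"
    using Suc.prems(3) by blast
  have "Z (Suc n) t \<in> borel_measurable (F (Suc n))" if "0 \<le> t" for t
    unfolding *
  proof (rule measurable_dep[OF _ _ E(1) that])
    show "Z n s \<in> borel_measurable (F (Suc n))" if "s \<in> {0..t}" for s
      using IH that by (intro measurable_F_Suc) auto
  qed (use IH W in auto)
  moreover have "Z (Suc n) 0 \<omega> = 0" "continuous_on {0..} (\<lambda>t. Z (Suc n) t \<omega>)" if "\<omega> \<in> space M" for \<omega>
    unfolding * using IH W E that by (auto intro!: dep_zero continuous_on_dep)
  ultimately show ?case by blast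
qed

lemma X_paths:
  "0 \<le> t \<Longrightarrow> X n t \<in> borel_measurable (F n)" "\<omega> \<in> space M \<Longrightarrow> X n 0 \<omega> = 0"
  "\<omega> \<in> space M \<Longrightarrow> continuous_on {0..} (\<lambda>t. X n t \<omega>)"
  using paths[of X n] X0 XSuc by auto

lemma Y_paths:
  "0 \<le> t \<Longrightarrow> Y n t \<in> borel_measurable (F n)" "\<omega> \<in> space M \<Longrightarrow> Y n 0 \<omega> = 0"
  "\<omega> \<in> space M \<Longrightarrow> continuous_on {0..} (\<lambda>t. Y n t \<omega>)"
  using paths[of Y n] Y0 YSuc by auto

lemma measurable_F_M: "f \<in> borel_measurable (F n) \<Longrightarrow> f \<in> borel_measurable M"
  by (rule measurable_from_subalg[OF subalg])

lemma measurable_M: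
  "0 \<le> t \<Longrightarrow> X n t \<in> borel_measurable M" "0 \<le> t \<Longrightarrow> Y n t \<in> borel_measurable M"
  "0 \<le> t \<Longrightarrow> W n t \<in> borel_measurable M" "E n \<in> borel_measurable M"
  by (auto intro: measurable_F_M X_paths(1) Y_paths(1) W(1) E(1))

lemma diff_le:
  assumes "\<omega> \<in> space M" "\<And>s. s \<in> {0..T} \<Longrightarrow> \<bar>X 0 s \<omega> - Y 0 s \<omega>\<bar> \<le> K" "s \<in> {0..T}"
  shows "\<bar>X n s \<omega> - Y n s \<omega>\<bar> \<le> K"
  using assms(3)
proof (induction n arbitrary: s)
  case 0
  then show ?case using assms(2) by blast
next
  case (Suc n)
  show ?case unfolding XSuc YSuc
    by (rule dep_contractive) (use Suc X_paths(3) Y_paths(3) W(3) assms(1) in auto)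
qed

definition agreed :: "real \<Rightarrow> nat \<Rightarrow> 'a set" where
  "agreed T n = {\<omega>\<in>space M. \<forall>s\<in>{0..T}. X n s \<omega> = Y n s \<omega>}"

lemma agreed_sets:
  assumes "0 \<le> T" shows "agreed T n \<in> sets (F n)"
proof -
  have "{\<omega>\<in>space (F n). \<forall>s\<in>{0..T}. \<bar>X n s \<omega> - Y n s \<omega>\<bar> \<le> 0} \<in> sets (F n)"
    by (rule sets_ball_abs_le[OF _ assms])
      (auto intro!: borel_measurable_diff continuous_on_diff X_paths Y_paths)
  then show ?thesis unfolding agreed_def by simp
qed

lemma agreed_Suc: "agreed T n \<subseteq> agreed T (Suc n)"
proof
  fix \<omega> assume *: "\<omega> \<in> agreed T n"
  then have w: "\<omega> \<in> space M" unfolding agreed_def by blast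
  have "\<bar>X (Suc n) s \<omega> - Y (Suc n) s \<omega>\<bar> \<le> 0" if "s \<in> {0..T}" for s
    unfolding XSuc YSuc
    by (rule dep_contractive) (use * that w X_paths(3) Y_paths(3) W(3) in \<open>auto simp: agreed_def\<close>)
  then show "\<omega> \<in> agreed T (Suc n)" using w unfolding agreed_def by auto
qed

text \<open>The probabilities of agreement increase to some \<open>l\<close>. Outside an event of
  probability at most 2 * e, a disagreement is repaired at each station with probability at least
  \<open>p\<close>, so l + (1 - 2 * e - l) * p <= l, which forces 1 - 2 * e <= l.\<close>

lemma agreed_LIMSEQ:
  assumes Y_BM: "\<And>n. std_BM M (Y n)" and "0 < T"
  shows "(\<lambda>n. prob (agreed T n)) \<longlonglongrightarrow> 1"
proof -
  have A: "agreed T n \<in> sets (F n)" for n using agreed_sets \<open>0 < T\<close> by simp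
  have AM [measurable]: "agreed T n \<in> sets M" for n using A sets_F by blast
  let ?WB = "\<lambda>n K. {\<omega>\<in>space M. \<forall>s\<in>{0..T}. \<bar>W n s \<omega>\<bar> \<le> K}"
  let ?YB = "\<lambda>n K. {\<omega>\<in>space M. \<forall>s\<in>{0..T}. \<bar>Y n s \<omega>\<bar> \<le> K}"
  let ?DB = "\<lambda>K. {\<omega>\<in>space M. \<forall>s\<in>{0..T}. \<bar>X 0 s \<omega> - Y 0 s \<omega>\<bar> \<le> K}"
  \<comment> \<open>All services and all stationary inputs have the same supremum law, so a bound
    \<open>K\<close> chosen once works at every station.\<close>
  have Wp: "prob (?WB n K) = prob (?WB 0 K)" for n K
    by (rule std_BM_sup_law) (use prob_space_axioms W_BM W \<open>0 < T\<close> in auto)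
  have Yp: "prob (?YB n K) = prob (?WB 0 K)" for n K
    by (rule std_BM_sup_law) (use prob_space_axioms W_BM Y_BM W Y_paths \<open>0 < T\<close> in auto)
  have YB: "?YB n K \<in> sets (F n)" for n K
  proof -
    have "{\<omega>\<in>space (F n). \<forall>s\<in>{0..T}. \<bar>Y n s \<omega>\<bar> \<le> K} \<in> sets (F n)"
      by (rule sets_ball_abs_le) (use \<open>0 < T\<close> Y_paths in auto)
    then show ?thesis by simp
  qed
  have F0: "A \<in> sets (F 0) \<Longrightarrow> A \<in> sets (F n)" for A n
    using mono by (induction n) auto
  have DB: "?DB K \<in> sets (F n)" for n K
  proof (rule F0)
    have "{\<omega>\<in>space (F 0). \<forall>s\<in>{0..T}. \<bar>X 0 s \<omega> - Y 0 s \<omega>\<bar> \<le> K} \<in> sets (F 0)"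
      by (rule sets_ball_abs_le)
        (use \<open>0 < T\<close> in \<open>auto intro!: borel_measurable_diff continuous_on_diff X0 Y0\<close>)
    then show "?DB K \<in> sets (F 0)" by simp
  qed
  have lW: "(\<lambda>K::nat. prob (?WB 0 (real K))) \<longlonglongrightarrow> 1"
    by (rule prob_path_bounded_LIMSEQ) (use W \<open>0 < T\<close> measurable_M in auto)
  have lD: "(\<lambda>K::nat. prob (?DB (real K))) \<longlonglongrightarrow> 1"
    by (rule prob_path_bounded_LIMSEQ)
      (use \<open>0 < T\<close> in \<open>auto intro!: borel_measurable_diff measurable_M continuous_on_diff X0 Y0\<close>)
  have inc: "incseq (\<lambda>n. prob (agreed T n))"
    by (intro incseq_SucI finite_measure_mono agreed_Suc AM)
  then have "\<exists>l. (\<lambda>n. prob (agreed T n)) \<longlonglongrightarrow> l"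
    using incseq_convergent[OF inc, of 1] by auto
  then obtain l where l: "(\<lambda>n. prob (agreed T n)) \<longlonglongrightarrow> l" by blast
  have l1: "l \<le> 1" by (rule LIMSEQ_le_const2[OF l]) auto
  have lower: "1 - 2 * e \<le> l" if "0 < e" "e < 1/2" for e
  proof -
    have "\<forall>\<^sub>F K in sequentially. 1 - e < prob (?WB 0 (real K)) \<and> 1 - e < prob (?DB (real K))"
      using order_tendstoD(1)[OF lW, of "1 - e"] order_tendstoD(1)[OF lD, of "1 - e"] that
      by (simp add: eventually_conj)
    then obtain K :: nat where K: "1 - e < prob (?WB 0 (real K))" "1 - e < prob (?DB (real K))"
      using eventually_happens[of _ sequentially] by fastforce
    \<comment> \<open>The content 3 * K + c * T keeps both queues busy: \<open>Y n\<close> is at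
      least -K and \<open>X n\<close> at least -2 * K, while the offered service is at most K + c *
      T.\<close>
    define p where "p = prob (?WB 0 (real K)) * exp (- c * (3 * real K + c * T))"
    have p: "0 < p" using K(1) that unfolding p_def by (intro mult_pos_pos) auto
    have step: "prob (agreed T n) + (1 - 2 * e - prob (agreed T n)) * p \<le> prob (agreed T (Suc n))" for n
    proof -
      define B where "B = ?YB n (real K) \<inter> ?DB (real K)"
      define H where "H = {\<omega>\<in>space M. 3 * real K + c * T < E n \<omega>}"
      have B: "B \<in> sets (F n)" unfolding B_def using YB DB by blast
      have BM [measurable]: "B \<in> sets M" using B sets_F by blast
      have WB: "?WB n (real K) \<in> proc_sigma M (W n)"
        by (rule proc_ball_le_in_proc_sigma) (use \<open>0 < T\<close> W in auto)
      have WBM [measurable]: "?WB n (real K) \<in> sets M"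
        by (rule sets_ball_abs_le) (use \<open>0 < T\<close> W measurable_M in auto)
      have H: "H \<in> rv_sigma M (E n)"
        unfolding rv_sigma_def H_def by (rule sigma_sets.Basic) (auto intro!: exI[of _ "{3 * real K + c * T<..}"])
      note [measurable] = measurable_M(4)
      have HM [measurable]: "H \<in> sets M" unfolding H_def by measurable
      \<comment> \<open>The first set belongs to \<open>F n\<close>; the other two concern the fresh
        inputs, so the probability factorises.\<close>
      let ?S = "(B - agreed T n) \<inter> ?WB n (real K) \<inter> H"
      have "?S \<subseteq> agreed T (Suc n)"
      proof
        fix \<omega> assume S: "\<omega> \<in> ?S"
        then have w: "\<omega> \<in> space M" unfolding H_def by blast
        have busy: "W n s \<omega> + c * s \<le> X n s \<omega> + E n \<omega>" "W n s \<omega> + c * s \<le> Y n s \<omega> + E n \<omega>"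
          if s: "s \<in> {0..T}" for s
        proof -
          have "\<bar>Y n s \<omega>\<bar> \<le> real K" "\<bar>W n s \<omega>\<bar> \<le> real K" "3 * real K + c * T < E n \<omega>"
            using S s unfolding B_def H_def by auto
          moreover have "\<bar>X n s \<omega> - Y n s \<omega>\<bar> \<le> real K"
            by (rule diff_le[OF w _ s]) (use S in \<open>auto simp: B_def\<close>)
          moreover have "c * s \<le> c * T" using s c by (intro mult_left_mono) auto
          ultimately show "W n s \<omega> + c * s \<le> X n s \<omega> + E n \<omega>" "W n s \<omega> + c * s \<le> Y n s \<omega> + E n \<omega>"
            by linarith+
        qed
        have "X (Suc n) s \<omega> = W n s \<omega> + c * s" "Y (Suc n) s \<omega> = W n s \<omega> + c * s" if "s \<in> {0..T}" for s
          unfolding XSuc YSuc using that by (auto intro!: dep_busy busy)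
        then show "\<omega> \<in> agreed T (Suc n)" using w unfolding agreed_def by auto
      qed
      then have "prob (agreed T n \<union> ?S) \<le> prob (agreed T (Suc n))"
        using agreed_Suc by (intro finite_measure_mono) auto
      moreover have "prob (agreed T n \<union> ?S) = prob (agreed T n) + prob ?S"
        by (rule finite_measure_Union) auto
      moreover have "prob ?S = prob (B - agreed T n) * p"
      proof -
        have "prob ?S = prob (B - agreed T n) * prob (?WB n (real K)) * prob H"
          by (rule indep) (use A B WB H in auto)
        then show ?thesis
          using E_tail[of "3 * real K + c * T" n] c \<open>0 < T\<close> Wp[of n "real K"] unfolding p_def H_def by simp
      qed
      moreover have "1 - 2 * e - prob (agreed T n) \<le> prob (B - agreed T n)"
      proof -
        have YM: "?YB n (real K) \<in> events" and DM: "?DB (real K) \<in> events"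
          by (rule sets_F[OF YB], rule sets_F[OF DB])
        have "prob (?YB n (real K) - ?DB (real K)) = prob (?YB n (real K)) - prob B"
          unfolding B_def by (rule finite_measure_Diff'[OF YM DM])
        moreover have "prob (?YB n (real K) - ?DB (real K)) \<le> prob (space M - ?DB (real K))"
          by (rule finite_measure_mono[OF _ sets.compl_sets[OF DM]]) auto
        moreover note prob_compl[OF DM]
        ultimately have "1 - 2 * e \<le> prob B"
          using K Yp[of n "real K"] by linarith
        moreover have "prob B \<le> prob (agreed T n \<union> (B - agreed T n))"
          by (intro finite_measure_mono) auto
        moreover have "prob (agreed T n \<union> (B - agreed T n)) = prob (agreed T n) + prob (B - agreed T n)"
          by (rule finite_measure_Union) auto
        ultimately show ?thesis by linarith
      qed
      ultimately show ?thesis using p by (smt (verit) mult_right_mono)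
    qed
    have "l + (1 - 2 * e - l) * p \<le> l"
    proof (rule LIMSEQ_le)
      show "(\<lambda>n. prob (agreed T n) + (1 - 2 * e - prob (agreed T n)) * p) \<longlonglongrightarrow> l + (1 - 2 * e - l) * p"
        by (intro tendsto_intros l)
      show "(\<lambda>n. prob (agreed T (Suc n))) \<longlonglongrightarrow> l" by (rule LIMSEQ_Suc[OF l])
    qed (use step in auto)
    then have "(1 - 2 * e - l) * p \<le> 0" by simp
    then show ?thesis using p by (simp add: mult_le_0_iff)
  qed
  have "l = 1"
  proof (rule ccontr)
    assume "l \<noteq> 1"
    \<comment> \<open>Chosen so that 1 - 2 * e exceeds \<open>l\<close>.\<close>
    define e where "e = min (1/4) ((1 - l) / 4)"
    have e: "0 < e" "e < 1/2" "4 * e \<le> 1 - l" using l1 \<open>l \<noteq> 1\<close> unfolding e_def min_def by (auto simp: field_simps)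
    have "l < 1" using l1 \<open>l \<noteq> 1\<close> by simp
    moreover have "1 - 2 * e \<le> l" by (rule lower[OF e(1,2)])
    ultimately show False using e by argo
  qed
  then show ?thesis using l by simp
qed

lemma coupled_paths:
  assumes Y_BM: "\<And>n. std_BM M (Y n)"
  shows "coupled_paths M X Y"
proof
  fix k :: nat
  \<comment> \<open>\<open>agreed_LIMSEQ\<close> requires a positive horizon and \<open>k\<close>
    may be 0.\<close>
  have "(\<lambda>n. prob (agreed (real k + 1) n)) \<longlonglongrightarrow> 1"
    by (rule agreed_LIMSEQ[OF Y_BM]) simp
  then have "(\<lambda>n. prob (agreed (real k) n)) \<longlonglongrightarrow> 1"
  proof (rule tendsto_sandwich[OF _ _ _ tendsto_const, rotated 2])
    show "\<forall>\<^sub>F n in sequentially. prob (agreed (real k + 1) n) \<le> prob (agreed (real k) n)"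
      using sets_F[OF agreed_sets[of "real k"]]
      by (intro always_eventually allI finite_measure_mono) (auto simp: agreed_def)
  qed simp
  then show "(\<lambda>n. prob {\<omega>\<in>space M. \<forall>s\<in>{0..real k}. X n s \<omega> = Y n s \<omega>}) \<longlonglongrightarrow> 1"
    unfolding agreed_def .
qed (use X_paths Y_paths measurable_M Y_BM in auto)

end

section \<open>Reflection for Brownian motion with drift\<close>

lemma nn_integral_lborel_shift:
  fixes f :: "real \<Rightarrow> ennreal"
  assumes "f \<in> borel_measurable borel"
  shows "(\<integral>\<^sup>+x. f (x + a) \<partial>lborel) = (\<integral>\<^sup>+x. f x \<partial>lborel)"
  using nn_integral_real_affine[OF assms, of 1 a] by (simp add: add.commute)

lemma nn_integral_lborel_reflect:
  fixes f :: "real \<Rightarrow> ennreal"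
  assumes "f \<in> borel_measurable borel"
  shows "(\<integral>\<^sup>+x. f (a - x) \<partial>lborel) = (\<integral>\<^sup>+x. f x \<partial>lborel)"
  using nn_integral_real_affine[OF assms, of "-1" a] by simp

text \<open>Up to the common factor -1 / (2 * r), the exponents agree because x^2 + w^2 + 2 * c * r
  * (w - x + c * r) = (x - c * r)^2 + (w + c * r)^2.\<close>

lemma normal_density_tilt:
  assumes "0 < r"
  shows "normal_density 0 (sqrt r) x * normal_density 0 (sqrt r) w * exp (- c * (w - x + c * r))
    = normal_density 0 (sqrt r) (x - c * r) * normal_density 0 (sqrt r) (w + c * r)"
proof -
  have "- x\<^sup>2 / (2 * r) + - w\<^sup>2 / (2 * r) + - c * (w - x + c * r)
    = - (x - c * r)\<^sup>2 / (2 * r) + - (w + c * r)\<^sup>2 / (2 * r)"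
    using assms by (simp add: field_simps power2_eq_square)
  then have "exp (- x\<^sup>2 / (2 * r)) * exp (- w\<^sup>2 / (2 * r)) * exp (- c * (w - x + c * r))
    = exp (- (x - c * r)\<^sup>2 / (2 * r)) * exp (- (w + c * r)\<^sup>2 / (2 * r))"
    unfolding exp_add[symmetric] by simp
  then show ?thesis using assms unfolding normal_density_def by (simp add: algebra_simps)
qed

text \<open>Swapping the two increments (up to the drift) reflects \<open>w - x + c * r\<close> and fixes \<open>w + x\<close>;
  the exponential factor is the ratio of the Gaussian densities.\<close>

lemma gauss_swap:
  fixes H :: "real \<Rightarrow> real \<Rightarrow> ennreal"
  assumes [measurable]: "case_prod H \<in> borel_measurable (borel \<Otimes>\<^sub>M borel)" and r: "0 < r"
  shows "(\<integral>\<^sup>+x. \<integral>\<^sup>+w. H x w \<partial>gauss r \<partial>gauss r)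
    = (\<integral>\<^sup>+x. \<integral>\<^sup>+w. H (w + c * r) (x - c * r) * ennreal (exp (- c * (w - x + c * r))) \<partial>gauss r \<partial>gauss r)"
proof -
  let ?n = "normal_density 0 (sqrt r)"
  have "(\<integral>\<^sup>+x. \<integral>\<^sup>+w. H (w + c * r) (x - c * r) * ennreal (exp (- c * (w - x + c * r))) \<partial>gauss r \<partial>gauss r)
    = (\<integral>\<^sup>+x. \<integral>\<^sup>+w. ennreal (?n x) * (ennreal (?n w) * (H (w + c * r) (x - c * r) * ennreal (exp (- c * (w - x + c * r))))) \<partial>lborel \<partial>lborel)"
    by (simp add: nn_integral_density nn_integral_cmult)
  also have "\<dots> = (\<integral>\<^sup>+x. \<integral>\<^sup>+w. ennreal (?n (x - c * r)) * (ennreal (?n (w + c * r)) * H (w + c * r) (x - c * r)) \<partial>lborel \<partial>lborel)"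
  proof (intro nn_integral_cong)
    fix x w :: real
    have "ennreal (?n x) * (ennreal (?n w) * (H (w + c * r) (x - c * r) * ennreal (exp (- c * (w - x + c * r)))))
      = ennreal (?n x * ?n w * exp (- c * (w - x + c * r))) * H (w + c * r) (x - c * r)"
      by (simp add: ennreal_mult mult_ac)
    then show "ennreal (?n x) * (ennreal (?n w) * (H (w + c * r) (x - c * r) * ennreal (exp (- c * (w - x + c * r)))))
      = ennreal (?n (x - c * r)) * (ennreal (?n (w + c * r)) * H (w + c * r) (x - c * r))"
      unfolding normal_density_tilt[OF r] by (simp add: ennreal_mult mult_ac)
  qed
  also have "\<dots> = (\<integral>\<^sup>+x. \<integral>\<^sup>+w. ennreal (?n (x - c * r)) * (ennreal (?n w) * H w (x - c * r)) \<partial>lborel \<partial>lborel)"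
    by (intro nn_integral_cong nn_integral_lborel_shift) measurable
  also have "\<dots> = (\<integral>\<^sup>+x. \<integral>\<^sup>+w. ennreal (?n x) * (ennreal (?n w) * H w x) \<partial>lborel \<partial>lborel)"
    using nn_integral_lborel_shift[of "\<lambda>x. \<integral>\<^sup>+w. ennreal (?n x) * (ennreal (?n w) * H w x) \<partial>lborel" "- (c * r)"] by simp
  also have "\<dots> = (\<integral>\<^sup>+w. \<integral>\<^sup>+x. ennreal (?n x) * (ennreal (?n w) * H w x) \<partial>lborel \<partial>lborel)"
    by (rule lborel_pair.Fubini') measurable
  also have "\<dots> = (\<integral>\<^sup>+x. \<integral>\<^sup>+w. H x w \<partial>gauss r \<partial>gauss r)"
    by (simp add: nn_integral_density nn_integral_cmult[symmetric] mult_ac)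
  finally show ?thesis ..
qed

lemma emeasure_gauss_singleton [simp]: "emeasure (gauss r) {a} = 0"
proof -
  have "{a} \<in> null_sets lborel" by (auto intro: null_setsI)
  then show ?thesis by (simp add: emeasure_density nn_integral_null_set)
qed

text \<open>The grid point before the first passage lies below \<open>m\<close>, so the overshoot is
  at most the oscillation of \<open>d\<close> over one mesh. By \<open>d 0 < m\<close> the first
  passage has a predecessor; by \<open>m < d t\<close> it exists on the grid of every level.\<close>

lemma first_grid_passage_LIMSEQ:
  assumes d: "continuous_on {0..t} (d :: real \<Rightarrow> real)" and "0 < t" "d 0 < m" "m < d t"
  shows "(\<lambda>j. d (t * real (LEAST k. m \<le> d (t * real k / 2 ^ j)) / 2 ^ j)) \<longlonglongrightarrow> m"
proof (rule LIMSEQ_I)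
  fix e :: real assume "0 < e"
  have "uniformly_continuous_on {0..t} d" by (intro compact_uniformly_continuous d) simp
  then obtain \<delta> where \<delta>: "\<delta> > 0" "\<And>u v. u \<in> {0..t} \<Longrightarrow> v \<in> {0..t} \<Longrightarrow> \<bar>v - u\<bar> < \<delta> \<Longrightarrow> \<bar>d v - d u\<bar> < e"
    unfolding uniformly_continuous_on_def dist_real_def using \<open>0 < e\<close> by metis
  obtain j0 where j0: "(1/2) ^ j0 < \<delta> / t"
    using real_arch_pow_inv[of "\<delta> / t" "1/2"] \<delta>(1) \<open>0 < t\<close> by auto
  show "\<exists>j0. \<forall>j\<ge>j0. norm (d (t * real (LEAST k. m \<le> d (t * real k / 2 ^ j)) / 2 ^ j) - m) < e"
  proof (intro exI allI impI)
    fix j :: nat assume j: "j0 \<le> j"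
    define P where "P k \<longleftrightarrow> m \<le> d (t * real k / 2 ^ j)" for k :: nat
    define k where "k = (LEAST k. P k)"
    have P1: "P (2 ^ j)" using \<open>m < d t\<close> unfolding P_def by simp
    have Pk: "P k" and k_le: "k \<le> 2 ^ j" unfolding k_def using P1 by (auto intro: LeastI Least_le)
    have "k \<noteq> 0" using Pk \<open>d 0 < m\<close> unfolding P_def by (cases k) auto
    then obtain i where i: "k = Suc i" by (cases k) auto
    have "\<not> P i" unfolding i[symmetric] by (rule not_less_Least) (use i k_def in simp)
    have "(1/2::real) ^ j \<le> (1/2) ^ j0" using j by (intro power_decreasing) auto
    then have "t * (1/2) ^ j \<le> t * (1/2) ^ j0" using \<open>0 < t\<close> by (intro mult_left_mono) auto
    also have "\<dots> < \<delta>" using j0 \<open>0 < t\<close> by (simp add: pos_less_divide_eq mult.commute)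
    finally have "t / 2 ^ j < \<delta>" by (simp add: power_one_over)
    moreover have "t * real k / 2 ^ j - t * real i / 2 ^ j = t / 2 ^ j"
      unfolding i by (simp add: field_simps)
    ultimately have "\<bar>d (t * real k / 2 ^ j) - d (t * real i / 2 ^ j)\<bar> < e"
      using \<open>0 < t\<close> k_le i by (intro \<delta>(2) dyadic_grid_in) auto
    then have "norm (d (t * real k / 2 ^ j) - m) < e"
      using Pk \<open>\<not> P i\<close> unfolding P_def by auto
    then show "norm (d (t * real (LEAST k. m \<le> d (t * real k / 2 ^ j)) / 2 ^ j) - m) < e"
      unfolding k_def P_def .
  qed
qed

text \<open>The last assumption says that \<open>X\<close> and \<open>W\<close> are independent
  Brownian motions relative to the filtration \<open>G\<close>, with \<open>E\<close> known at time
  0. This form, through increments after \<open>s\<close>, survives both conditioning on an event of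
  the past and restarting the queue.\<close>

locale bm_queue = prob_space M for M :: "'a measure" +
  fixes G :: "real \<Rightarrow> 'a measure" and X W :: "real \<Rightarrow> 'a \<Rightarrow> real" and E :: "'a \<Rightarrow> real" and c :: real
  assumes c: "0 < c"
    and subalg: "\<And>s. 0 \<le> s \<Longrightarrow> subalgebra M (G s)"
    and mono: "\<And>s t. 0 \<le> s \<Longrightarrow> s \<le> t \<Longrightarrow> sets (G s) \<subseteq> sets (G t)"
    and X_G: "\<And>s. 0 \<le> s \<Longrightarrow> X s \<in> borel_measurable (G s)"
    and W_G: "\<And>s. 0 \<le> s \<Longrightarrow> W s \<in> borel_measurable (G s)"
    and E_G: "E \<in> borel_measurable (G 0)"
    and X_zero: "\<And>\<omega>. \<omega> \<in> space M \<Longrightarrow> X 0 \<omega> = 0"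
    and W_zero: "\<And>\<omega>. \<omega> \<in> space M \<Longrightarrow> W 0 \<omega> = 0"
    and X_cont: "\<And>\<omega>. \<omega> \<in> space M \<Longrightarrow> continuous_on {0..} (\<lambda>s. X s \<omega>)"
    and W_cont: "\<And>\<omega>. \<omega> \<in> space M \<Longrightarrow> continuous_on {0..} (\<lambda>s. W s \<omega>)"
    and E_nonneg: "\<And>\<omega>. \<omega> \<in> space M \<Longrightarrow> 0 \<le> E \<omega>"
    and E_distr: "distr M borel E = density lborel (exponential_density c)"
    and increments: "\<And>s t A B C. 0 \<le> s \<Longrightarrow> s < t \<Longrightarrow> A \<in> sets (G s) \<Longrightarrow> B \<in> sets borel \<Longrightarrow> C \<in> sets borel \<Longrightarrow>
      prob (A \<inter> {\<omega>\<in>space M. X t \<omega> - X s \<omega> \<in> B} \<inter> {\<omega>\<in>space M. W t \<omega> - W s \<omega> \<in> C})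
        = prob A * measure (gauss (t - s)) B * measure (gauss (t - s)) C"
begin

lemma space_G: "0 \<le> s \<Longrightarrow> space (G s) = space M"
  using subalg[of s] unfolding subalgebra_def by simp

lemma sets_G: "0 \<le> s \<Longrightarrow> A \<in> sets (G s) \<Longrightarrow> A \<in> sets M"
  using subalg[of s] unfolding subalgebra_def by auto

lemma measurable_G_mono: "0 \<le> s \<Longrightarrow> s \<le> t \<Longrightarrow> f \<in> measurable (G s) S \<Longrightarrow> f \<in> measurable (G t) S"
  by (rule measurable_from_subalg[of _ "G s"]) (auto simp: subalgebra_def mono space_G)

lemma measurable_G_M: "0 \<le> s \<Longrightarrow> f \<in> measurable (G s) S \<Longrightarrow> f \<in> measurable M S"
  by (rule measurable_from_subalg[OF subalg])

lemma X_M [measurable]: "0 \<le> s \<Longrightarrow> X s \<in> borel_measurable M"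
  and W_M [measurable]: "0 \<le> s \<Longrightarrow> W s \<in> borel_measurable M"
  and E_M [measurable]: "E \<in> borel_measurable M"
  by (auto intro: measurable_G_M X_G W_G E_G)

text \<open>Quadrants determine a finite measure in the plane, so the product rule for pairs of sets
  extends to all measurable \<open>Q\<close>. Restriction to \<open>A\<close> is expressed by a
  density.\<close>

lemma increments_pair:
  assumes s: "0 \<le> s" "s < t" and A: "A \<in> sets (G s)" and Q: "Q \<in> sets (borel \<Otimes>\<^sub>M borel)"
  shows "emeasure M (A \<inter> {\<omega>\<in>space M. (X t \<omega> - X s \<omega>, W t \<omega> - W s \<omega>) \<in> Q})
    = emeasure M A * emeasure (gauss (t - s) \<Otimes>\<^sub>M gauss (t - s)) Q"
proof -
  interpret g: prob_space "gauss (t - s)" using s by (intro prob_space_gauss) simp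
  interpret gg: pair_prob_space "gauss (t - s)" "gauss (t - s)" ..
  have A': "A \<in> sets M" using sets_G s A by blast
  have [measurable]: "X t \<in> borel_measurable M" "X s \<in> borel_measurable M"
    "W t \<in> borel_measurable M" "W s \<in> borel_measurable M" using s by auto
  let ?D = "\<lambda>\<omega>. (X t \<omega> - X s \<omega>, W t \<omega> - W s \<omega>)"
  let ?l = "distr (density M (indicator A)) borel ?D"
  let ?r = "scale_measure (emeasure M A) (gauss (t - s) \<Otimes>\<^sub>M gauss (t - s))"
  have Dm [measurable]: "?D \<in> measurable M borel" unfolding borel_prod[symmetric] by measurable
  have l: "emeasure ?l Q = emeasure M (A \<inter> {\<omega>\<in>space M. ?D \<omega> \<in> Q})" if "Q \<in> sets borel" for Q
  proof -
    have S: "{\<omega>\<in>space M. ?D \<omega> \<in> Q} \<in> sets M"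
      using measurable_sets[OF Dm that] by (simp add: vimage_def Int_def conj_commute)
    have "emeasure ?l Q = emeasure (density M (indicator A)) {\<omega>\<in>space M. ?D \<omega> \<in> Q}"
      using that by (subst emeasure_distr) (auto simp: vimage_def Int_def conj_commute)
    also have "\<dots> = (\<integral>\<^sup>+\<omega>. indicator (A \<inter> {\<omega>\<in>space M. ?D \<omega> \<in> Q}) \<omega> \<partial>M)"
      unfolding indicator_inter_arith by (rule emeasure_density[OF borel_measurable_indicator[OF A'] S])
    also have "\<dots> = emeasure M (A \<inter> {\<omega>\<in>space M. ?D \<omega> \<in> Q})"
      by (rule nn_integral_indicator) (use A' S in auto)
    finally show ?thesis .
  qed
  have "?l = ?r"
  proof (rule finite_measure_eqI_atMost)
    show "finite_measure ?l"
      by (rule finite_measureI) (use l[of UNIV] A' in \<open>simp add: emeasure_eq_measure\<close>)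
    show "sets ?r = sets borel" by (simp add: borel_prod[symmetric] cong: sets_pair_measure_cong)
    fix z :: "real \<times> real"
    obtain a b where z: "z = (a, b)" by fastforce
    have at: "{..z} = {..a} \<times> {..b}" unfolding z by (auto simp: less_eq_prod_def)
    have "emeasure ?l {..z} = emeasure M (A \<inter> {\<omega>\<in>space M. X t \<omega> - X s \<omega> \<in> {..a}} \<inter> {\<omega>\<in>space M. W t \<omega> - W s \<omega> \<in> {..b}})"
    proof -
      have Z: "{..z} \<in> sets borel" unfolding at borel_prod[symmetric] by (rule pair_measureI) auto
      show ?thesis unfolding l[OF Z] by (rule arg_cong[where f="emeasure M"]) (auto simp: at)
    qed
    also have "\<dots> = emeasure M A * (emeasure (gauss (t - s)) {..a} * emeasure (gauss (t - s)) {..b})"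
      using increments[OF s A, of "{..a}" "{..b}"]
      by (simp add: emeasure_eq_measure g.emeasure_eq_measure ennreal_mult mult.assoc)
    also have "\<dots> = emeasure ?r {..z}"
      unfolding at by (simp add: g.emeasure_pair_measure_Times)
    finally show "emeasure ?l {..z} = emeasure ?r {..z}" .
  qed simp
  then have "emeasure ?l Q = emeasure ?r Q" by simp
  then show ?thesis using l[of Q] Q unfolding borel_prod by simp
qed

text \<open>The increments after \<open>s\<close> are integrated out as an independent Gaussian pair
  while the past is frozen in the parameter \<open>p\<close>; its space \<open>S\<close> is
  arbitrary so that it can carry whatever part of the past an integrand refers to.\<close>

lemma kernel:
  assumes s: "0 \<le> s" "s < t" and p: "p \<in> measurable (G s) S"
    and F [measurable]: "F \<in> borel_measurable (S \<Otimes>\<^sub>M (borel \<Otimes>\<^sub>M borel))"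
  shows "(\<integral>\<^sup>+\<omega>. F (p \<omega>, X t \<omega> - X s \<omega>, W t \<omega> - W s \<omega>) \<partial>M)
    = (\<integral>\<^sup>+\<omega>. \<integral>\<^sup>+x. \<integral>\<^sup>+w. F (p \<omega>, x, w) \<partial>gauss (t - s) \<partial>gauss (t - s) \<partial>M)"
proof -
  let ?g = "gauss (t - s)"
  interpret g: prob_space ?g using s by (intro prob_space_gauss) simp
  interpret gg: pair_prob_space ?g ?g ..
  have pM [measurable]: "p \<in> measurable M S" using measurable_G_M s(1) p by blast
  interpret P: prob_space "distr M S p" by (rule prob_space_distr) measurable
  have [measurable]: "X t \<in> borel_measurable M" "X s \<in> borel_measurable M"
    "W t \<in> borel_measurable M" "W s \<in> borel_measurable M" using s by auto
  let ?D = "\<lambda>\<omega>. (X t \<omega> - X s \<omega>, W t \<omega> - W s \<omega>)"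
  have eq: "distr M S p \<Otimes>\<^sub>M (?g \<Otimes>\<^sub>M ?g) = distr M (S \<Otimes>\<^sub>M (borel \<Otimes>\<^sub>M borel)) (\<lambda>\<omega>. (p \<omega>, ?D \<omega>))"
  proof (rule pair_measure_eqI)
    show "sigma_finite_measure (distr M S p)" "sigma_finite_measure (?g \<Otimes>\<^sub>M ?g)" by unfold_locales
    show "sets (distr M S p \<Otimes>\<^sub>M (?g \<Otimes>\<^sub>M ?g)) = sets (distr M (S \<Otimes>\<^sub>M (borel \<Otimes>\<^sub>M borel)) (\<lambda>\<omega>. (p \<omega>, ?D \<omega>)))"
      by (simp cong: sets_pair_measure_cong)
    fix A Q assume AQ: "A \<in> sets (distr M S p)" "Q \<in> sets (?g \<Otimes>\<^sub>M ?g)"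
    then have A: "A \<in> sets S" and Q: "Q \<in> sets (borel \<Otimes>\<^sub>M borel)" by (simp_all cong: sets_pair_measure_cong)
    have pA: "p -` A \<inter> space M \<in> sets (G s)" using measurable_sets[OF p A] space_G[OF s(1)] by simp
    have "emeasure (distr M S p) A * emeasure (?g \<Otimes>\<^sub>M ?g) Q = emeasure M ((p -` A \<inter> space M) \<inter> {\<omega>\<in>space M. ?D \<omega> \<in> Q})"
      using A by (simp add: emeasure_distr increments_pair[OF s pA Q])
    also have "\<dots> = emeasure (distr M (S \<Otimes>\<^sub>M (borel \<Otimes>\<^sub>M borel)) (\<lambda>\<omega>. (p \<omega>, ?D \<omega>))) (A \<times> Q)"
      using A Q by (subst emeasure_distr) (auto intro!: arg_cong[where f="emeasure M"])
    finally show "emeasure (distr M S p) A * emeasure (?g \<Otimes>\<^sub>M ?g) Q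
      = emeasure (distr M (S \<Otimes>\<^sub>M (borel \<Otimes>\<^sub>M borel)) (\<lambda>\<omega>. (p \<omega>, ?D \<omega>))) (A \<times> Q)" .
  qed
  have sg: "sets (?g \<Otimes>\<^sub>M ?g) = sets (borel \<Otimes>\<^sub>M borel)" by (simp cong: sets_pair_measure_cong)
  have Fm: "F \<in> borel_measurable (distr M S p \<Otimes>\<^sub>M (?g \<Otimes>\<^sub>M ?g))"
    using F by (simp cong: measurable_cong_sets sets_pair_measure_cong)
  have "(\<integral>\<^sup>+\<omega>. F (p \<omega>, ?D \<omega>) \<partial>M) = (\<integral>\<^sup>+z. F z \<partial>(distr M S p \<Otimes>\<^sub>M (?g \<Otimes>\<^sub>M ?g)))"
    unfolding eq by (subst nn_integral_distr) measurable
  also have "\<dots> = (\<integral>\<^sup>+a. \<integral>\<^sup>+q. F (a, q) \<partial>(?g \<Otimes>\<^sub>M ?g) \<partial>distr M S p)"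
    by (rule gg.P.nn_integral_fst[symmetric, OF Fm])
  also have "\<dots> = (\<integral>\<^sup>+\<omega>. \<integral>\<^sup>+q. F (p \<omega>, q) \<partial>(?g \<Otimes>\<^sub>M ?g) \<partial>M)"
    by (rule nn_integral_distr[OF pM])
      (use gg.P.borel_measurable_nn_integral_fst[OF Fm] in simp)
  also have "\<dots> = (\<integral>\<^sup>+\<omega>. \<integral>\<^sup>+x. \<integral>\<^sup>+w. F (p \<omega>, x, w) \<partial>?g \<partial>?g \<partial>M)"
  proof (rule nn_integral_cong)
    fix \<omega> assume "\<omega> \<in> space M"
    then have "p \<omega> \<in> space S" by (rule measurable_space[OF pM])
    then have "(\<lambda>q. F (p \<omega>, q)) \<in> borel_measurable (borel \<Otimes>\<^sub>M borel)" by measurable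
    then have "(\<lambda>q. F (p \<omega>, q)) \<in> borel_measurable (?g \<Otimes>\<^sub>M ?g)"
      by (simp cong: measurable_cong_sets sets_pair_measure_cong)
    from g.nn_integral_fst[OF this] show "(\<integral>\<^sup>+q. F (p \<omega>, q) \<partial>(?g \<Otimes>\<^sub>M ?g)) = (\<integral>\<^sup>+x. \<integral>\<^sup>+w. F (p \<omega>, x, w) \<partial>?g \<partial>?g)" ..
  qed
  finally show ?thesis .
qed


section \<open>Service minus arrivals, and its reflection at fixed times\<close>

definition drift :: "real \<Rightarrow> 'a \<Rightarrow> real" where
  "drift s \<omega> = W s \<omega> + c * s - X s \<omega>"

lemma drift_G [measurable (raw)]: "0 \<le> s \<Longrightarrow> drift s \<in> borel_measurable (G s)"
  unfolding drift_def using X_G W_G by (intro borel_measurable_diff borel_measurable_add) auto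

lemma drift_M [measurable]: "0 \<le> s \<Longrightarrow> drift s \<in> borel_measurable M"
  by (rule measurable_G_M[OF _ drift_G])

lemma drift_zero: "\<omega> \<in> space M \<Longrightarrow> drift 0 \<omega> = 0"
  unfolding drift_def using X_zero W_zero by simp

lemma drift_cont: "\<omega> \<in> space M \<Longrightarrow> continuous_on {0..} (\<lambda>s. drift s \<omega>)"
  unfolding drift_def by (intro continuous_intros X_cont W_cont)

text \<open>\<open>gauss_swap\<close> is applied to the increments on [s, t], with everything up to
  \<open>s\<close> as a parameter: the increment of \<open>drift\<close> changes sign while
  \<open>X t + W t\<close> is preserved.\<close>

lemma reflect_at:
  assumes s: "0 \<le> s" "s \<le> t" and A: "A \<in> sets (G s)"
    and F [measurable]: "F \<in> borel_measurable (borel \<Otimes>\<^sub>M (borel \<Otimes>\<^sub>M borel))"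
  shows "(\<integral>\<^sup>+\<omega>. indicator A \<omega> * F (E \<omega>, X t \<omega>, drift t \<omega>) \<partial>M)
    = (\<integral>\<^sup>+\<omega>. indicator A \<omega> * (F (E \<omega>, X t \<omega> + drift t \<omega> - drift s \<omega>, 2 * drift s \<omega> - drift t \<omega>)
        * ennreal (exp (- c * (drift t \<omega> - drift s \<omega>)))) \<partial>M)"
proof (cases "s = t")
  case True
  then show ?thesis by simp
next
  case False
  then have st: "s < t" using s by simp
  define r where "r = t - s"
  have r: "0 < r" using st unfolding r_def by simp
  define p where "p \<omega> = (indicator A \<omega> :: ennreal, (E \<omega>, (X s \<omega>, drift s \<omega>)))" for \<omega>
  have p: "p \<in> measurable (G s) (borel \<Otimes>\<^sub>M (borel \<Otimes>\<^sub>M (borel \<Otimes>\<^sub>M borel)))"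
    unfolding p_def using A measurable_G_mono[OF order_refl s(1) E_G] X_G[OF s(1)] drift_G[OF s(1)]
    by (intro measurable_Pair) auto
  define f :: "(ennreal \<times> real \<times> real \<times> real) \<times> real \<times> real \<Rightarrow> ennreal" where
    "f z = fst (fst z) * F (fst (snd (fst z)), fst (snd (snd (fst z))) + fst (snd z),
      snd (snd (snd (fst z))) + snd (snd z) - fst (snd z) + c * r)" for z
  define g :: "(ennreal \<times> real \<times> real \<times> real) \<times> real \<times> real \<Rightarrow> ennreal" where
    "g z = fst (fst z) * (F (fst (snd (fst z)), fst (snd (snd (fst z))) + snd (snd z) + c * r,
      snd (snd (snd (fst z))) - (snd (snd z) - fst (snd z) + c * r)) * ennreal (exp (- c * (snd (snd z) - fst (snd z) + c * r))))" for z
  have fm: "f \<in> borel_measurable ((borel \<Otimes>\<^sub>M (borel \<Otimes>\<^sub>M (borel \<Otimes>\<^sub>M borel))) \<Otimes>\<^sub>M (borel \<Otimes>\<^sub>M borel))"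
    unfolding f_def by measurable
  have gm: "g \<in> borel_measurable ((borel \<Otimes>\<^sub>M (borel \<Otimes>\<^sub>M (borel \<Otimes>\<^sub>M borel))) \<Otimes>\<^sub>M (borel \<Otimes>\<^sub>M borel))"
    unfolding g_def by measurable
  have d: "drift t \<omega> = drift s \<omega> + (W t \<omega> - W s \<omega>) - (X t \<omega> - X s \<omega>) + c * r" for \<omega>
    unfolding drift_def r_def by (simp add: algebra_simps)
  have inner: "(\<integral>\<^sup>+x. \<integral>\<^sup>+w. f (q, x, w) \<partial>gauss r \<partial>gauss r) = (\<integral>\<^sup>+x. \<integral>\<^sup>+w. g (q, x, w) \<partial>gauss r \<partial>gauss r)" for q
  proof -
    obtain i e x d where q: "q = (i, e, x, d)" by (cases q)
    let ?H = "\<lambda>x' w'. i * F (e, x + x', d + w' - x' + c * r)"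
    have "case_prod ?H \<in> borel_measurable (borel \<Otimes>\<^sub>M borel)" by measurable
    from gauss_swap[OF this r, of c] show ?thesis
      unfolding q f_def g_def by (simp add: algebra_simps mult.assoc)
  qed
  have "(\<integral>\<^sup>+\<omega>. indicator A \<omega> * F (E \<omega>, X t \<omega>, drift t \<omega>) \<partial>M)
      = (\<integral>\<^sup>+\<omega>. f (p \<omega>, X t \<omega> - X s \<omega>, W t \<omega> - W s \<omega>) \<partial>M)"
    unfolding f_def p_def d by (simp add: algebra_simps)
  also have "\<dots> = (\<integral>\<^sup>+\<omega>. \<integral>\<^sup>+x. \<integral>\<^sup>+w. f (p \<omega>, x, w) \<partial>gauss r \<partial>gauss r \<partial>M)"
    unfolding r_def by (rule kernel[OF s(1) st p fm])
  also have "\<dots> = (\<integral>\<^sup>+\<omega>. \<integral>\<^sup>+x. \<integral>\<^sup>+w. g (p \<omega>, x, w) \<partial>gauss r \<partial>gauss r \<partial>M)"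
    unfolding inner ..
  also have "\<dots> = (\<integral>\<^sup>+\<omega>. g (p \<omega>, X t \<omega> - X s \<omega>, W t \<omega> - W s \<omega>) \<partial>M)"
    unfolding r_def by (rule kernel[OF s(1) st p gm, symmetric])
  also have "\<dots> = (\<integral>\<^sup>+\<omega>. indicator A \<omega> * (F (E \<omega>, X t \<omega> + drift t \<omega> - drift s \<omega>, 2 * drift s \<omega> - drift t \<omega>)
        * ennreal (exp (- c * (drift t \<omega> - drift s \<omega>)))) \<partial>M)"
    unfolding g_def p_def d by (simp add: algebra_simps)
  finally show ?thesis .
qed

section \<open>First passage through a level along a dyadic grid\<close>

definition passed :: "real \<Rightarrow> real \<Rightarrow> nat \<Rightarrow> 'a set" where
  "passed t m j = {\<omega>\<in>space M. \<exists>k\<le>2^j. m \<le> drift (t * real k / 2 ^ j) \<omega>}"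

text \<open>The value at the first grid passage, not its excess over \<open>m\<close>. Outside
  \<open>passed\<close> the least index may lie beyond the grid or be arbitrary, so the value is
  used next to the indicator of \<open>passed\<close>.\<close>

definition overshoot :: "real \<Rightarrow> real \<Rightarrow> nat \<Rightarrow> 'a \<Rightarrow> real" where
  "overshoot t m j \<omega> = drift (t * real (LEAST k. m \<le> drift (t * real k / 2 ^ j) \<omega>) / 2 ^ j) \<omega>"

definition first_passage :: "real \<Rightarrow> real \<Rightarrow> nat \<Rightarrow> nat \<Rightarrow> 'a set" where
  "first_passage t m j k = {\<omega>\<in>space M. m \<le> drift (t * real k / 2 ^ j) \<omega> \<and> (\<forall>i<k. drift (t * real i / 2 ^ j) \<omega> < m)}"

lemma first_passage_Least:
  "\<omega> \<in> first_passage t m j k \<longleftrightarrow> \<omega> \<in> space M \<and> (\<exists>k. m \<le> drift (t * real k / 2 ^ j) \<omega>) \<and> k = (LEAST k. m \<le> drift (t * real k / 2 ^ j) \<omega>)"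
proof
  assume *: "\<omega> \<in> first_passage t m j k"
  then have "(LEAST k. m \<le> drift (t * real k / 2 ^ j) \<omega>) = k"
    unfolding first_passage_def by (intro Least_equality) (auto simp: not_less[symmetric])
  then show "\<omega> \<in> space M \<and> (\<exists>k. m \<le> drift (t * real k / 2 ^ j) \<omega>) \<and> k = (LEAST k. m \<le> drift (t * real k / 2 ^ j) \<omega>)"
    using * unfolding first_passage_def by blast
next
  assume *: "\<omega> \<in> space M \<and> (\<exists>k. m \<le> drift (t * real k / 2 ^ j) \<omega>) \<and> k = (LEAST k. m \<le> drift (t * real k / 2 ^ j) \<omega>)"
  define P where "P k \<longleftrightarrow> m \<le> drift (t * real k / 2 ^ j) \<omega>" for k
  have k: "k = Least P" and ex: "\<exists>k. P k" and w: "\<omega> \<in> space M" using * unfolding P_def by blast+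
  have "P k" unfolding k by (rule LeastI_ex[OF ex])
  moreover have "\<not> P i" if "i < k" for i
    using that unfolding k by (rule not_less_Least)
  ultimately show "\<omega> \<in> first_passage t m j k"
    using w unfolding first_passage_def P_def by (simp add: not_le)
qed

lemma first_passage_G:
  assumes "0 \<le> t" shows "first_passage t m j k \<in> sets (G (t * real k / 2 ^ j))"
proof -
  let ?s = "\<lambda>i::nat. t * real i / 2 ^ j"
  have s: "0 \<le> ?s i" for i using assms by simp
  have le: "?s i \<le> ?s k" if "i \<le> k" for i
    using assms that by (intro divide_right_mono mult_left_mono) auto
  have m: "drift (?s i) \<in> borel_measurable (G (?s k))" if "i \<le> k" for i
    by (rule measurable_G_mono[OF s le[OF that] drift_G[OF s]])
  have 1: "{\<omega>\<in>space (G (?s k)). m \<le> drift (?s k) \<omega>} \<in> sets (G (?s k))"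
    using m[of k] by measurable
  have 2: "{\<omega>\<in>space (G (?s k)). \<forall>i\<in>{..<k}. drift (?s i) \<omega> < m} \<in> sets (G (?s k))"
  proof (rule sets.sets_Collect_finite_All)
    fix i assume "i \<in> {..<k}"
    then show "{\<omega>\<in>space (G (?s k)). drift (?s i) \<omega> < m} \<in> sets (G (?s k))"
      using m[of i] by (intro borel_measurable_less borel_measurable_const) auto
  qed simp
  have "first_passage t m j k = {\<omega>\<in>space (G (?s k)). m \<le> drift (?s k) \<omega>} \<inter> {\<omega>\<in>space (G (?s k)). \<forall>i\<in>{..<k}. drift (?s i) \<omega> < m}"
    unfolding first_passage_def by (auto simp: space_G[OF s])
  then show ?thesis using 1 2 by simp
qed

text \<open>Splitting by the index of the first passage replaces the random time by finitely many
  fixed ones; at most one summand is nonzero.\<close>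

lemma indicator_passed:
  fixes h :: "real \<Rightarrow> ennreal"
  shows "indicator (passed t m j) \<omega> * h (overshoot t m j \<omega>)
    = (\<Sum>k\<le>2^j. indicator (first_passage t m j k) \<omega> * h (drift (t * real k / 2 ^ j) \<omega>))"
proof (cases "\<omega> \<in> passed t m j")
  case True
  let ?k = "LEAST k. m \<le> drift (t * real k / 2 ^ j) \<omega>"
  obtain k0 where k0: "k0 \<le> 2 ^ j" "m \<le> drift (t * real k0 / 2 ^ j) \<omega>" and w: "\<omega> \<in> space M"
    using True unfolding passed_def by auto
  have k: "?k \<le> 2 ^ j" using Least_le[of "\<lambda>k. m \<le> drift (t * real k / 2 ^ j) \<omega>", OF k0(2)] k0(1) by simp
  have "(\<Sum>k\<le>2^j. indicator (first_passage t m j k) \<omega> * h (drift (t * real k / 2 ^ j) \<omega>))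
    = (\<Sum>k\<le>2^j. if k = ?k then h (drift (t * real k / 2 ^ j) \<omega>) else 0)"
    using w k0(2) by (intro sum.cong refl) (auto simp: indicator_def first_passage_Least)
  also have "\<dots> = h (overshoot t m j \<omega>)" using k unfolding overshoot_def by (subst sum.delta) auto
  finally show ?thesis using True by simp
next
  case False
  then have "\<omega> \<notin> first_passage t m j k" if "k \<le> 2 ^ j" for k
    using that unfolding passed_def first_passage_def by blast
  then show ?thesis using False by simp
qed

lemma first_passage_M: "0 \<le> t \<Longrightarrow> first_passage t m j k \<in> sets M"
  using sets_G[OF _ first_passage_G] by simp

lemma measurable_passed_overshoot:
  assumes "0 \<le> t" and h: "case_prod h \<in> borel_measurable (M \<Otimes>\<^sub>M (borel :: real measure))"
  shows "(\<lambda>\<omega>. indicator (passed t m j) \<omega> * (h \<omega> (overshoot t m j \<omega>) :: ennreal)) \<in> borel_measurable M"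
proof -
  have "(\<lambda>\<omega>. h \<omega> (drift (t * real k / 2 ^ j) \<omega>)) \<in> borel_measurable M" for k
  proof -
    have "(\<lambda>\<omega>. (\<omega>, drift (t * real k / 2 ^ j) \<omega>)) \<in> measurable M (M \<Otimes>\<^sub>M borel)"
      using drift_M[of "t * real k / 2 ^ j"] assms(1) by (intro measurable_Pair) auto
    from measurable_compose[OF this h] show ?thesis by simp
  qed
  then have "(\<lambda>\<omega>. \<Sum>k\<le>2^j. indicator (first_passage t m j k) \<omega> * h \<omega> (drift (t * real k / 2 ^ j) \<omega>)) \<in> borel_measurable M"
    using first_passage_M[OF assms(1)] by (intro borel_measurable_sum borel_measurable_times_ennreal borel_measurable_indicator)
  then show ?thesis unfolding indicator_passed[of t m j _ "h _"] .
qed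

lemma passed_M: "0 \<le> t \<Longrightarrow> passed t m j \<in> sets M"
proof -
  assume "0 \<le> t"
  then have "(\<lambda>\<omega>. indicator (passed t m j) \<omega> * (1::ennreal)) \<in> borel_measurable M"
    by (intro measurable_passed_overshoot) auto
  then have "{\<omega>\<in>space M. indicator (passed t m j) \<omega> * (1::ennreal) = 1} \<in> sets M" by measurable
  moreover have "{\<omega>\<in>space M. indicator (passed t m j) \<omega> * (1::ennreal) = 1} = passed t m j"
    by (auto simp: indicator_def passed_def)
  ultimately show ?thesis by simp
qed

text \<open>On \<open>first_passage t m j k\<close> the passage happens at a fixed time and the
  event belongs to the past of that time, so \<open>reflect_at\<close> applies to each
  piece.\<close>

lemma reflect_grid:
  assumes t: "0 \<le> t" and F [measurable]: "F \<in> borel_measurable (borel \<Otimes>\<^sub>M (borel \<Otimes>\<^sub>M borel))"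
  shows "(\<integral>\<^sup>+\<omega>. indicator (passed t m j) \<omega> * F (E \<omega>, X t \<omega>, drift t \<omega>) \<partial>M)
    = (\<integral>\<^sup>+\<omega>. indicator (passed t m j) \<omega> * (F (E \<omega>, X t \<omega> + drift t \<omega> - overshoot t m j \<omega>, 2 * overshoot t m j \<omega> - drift t \<omega>)
        * ennreal (exp (- c * (drift t \<omega> - overshoot t m j \<omega>)))) \<partial>M)"
proof -
  let ?s = "\<lambda>k::nat. t * real k / 2 ^ j"
  let ?h = "\<lambda>\<omega> y. F (E \<omega>, X t \<omega> + drift t \<omega> - y, 2 * y - drift t \<omega>) * ennreal (exp (- c * (drift t \<omega> - y)))"
  note [measurable] = X_M[OF t] drift_M[OF t] first_passage_M[OF t]
  have [measurable]: "drift (?s k) \<in> borel_measurable M" for k using t by (intro drift_M) simp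
  have "(\<integral>\<^sup>+\<omega>. indicator (passed t m j) \<omega> * F (E \<omega>, X t \<omega>, drift t \<omega>) \<partial>M)
    = (\<integral>\<^sup>+\<omega>. (\<Sum>k\<le>2^j. indicator (first_passage t m j k) \<omega> * F (E \<omega>, X t \<omega>, drift t \<omega>)) \<partial>M)"
    by (intro nn_integral_cong) (rule indicator_passed[where h="\<lambda>_. F _"])
  also have "\<dots> = (\<Sum>k\<le>2^j. \<integral>\<^sup>+\<omega>. indicator (first_passage t m j k) \<omega> * F (E \<omega>, X t \<omega>, drift t \<omega>) \<partial>M)"
    by (rule nn_integral_sum) measurable
  also have "\<dots> = (\<Sum>k\<le>2^j. \<integral>\<^sup>+\<omega>. indicator (first_passage t m j k) \<omega> * ?h \<omega> (drift (?s k) \<omega>) \<partial>M)"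
  proof (rule sum.cong[OF refl])
    fix k :: nat assume "k \<in> {..2^j}"
    then have "?s k \<in> {0..t}" by (intro dyadic_grid_in t) simp
    then show "(\<integral>\<^sup>+\<omega>. indicator (first_passage t m j k) \<omega> * F (E \<omega>, X t \<omega>, drift t \<omega>) \<partial>M)
      = (\<integral>\<^sup>+\<omega>. indicator (first_passage t m j k) \<omega> * ?h \<omega> (drift (?s k) \<omega>) \<partial>M)"
      by (intro reflect_at first_passage_G t F) auto
  qed
  also have "\<dots> = (\<integral>\<^sup>+\<omega>. (\<Sum>k\<le>2^j. indicator (first_passage t m j k) \<omega> * ?h \<omega> (drift (?s k) \<omega>)) \<partial>M)"
    by (rule nn_integral_sum[symmetric]) measurable
  also have "\<dots> = (\<integral>\<^sup>+\<omega>. indicator (passed t m j) \<omega> * ?h \<omega> (overshoot t m j \<omega>) \<partial>M)"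
    by (intro nn_integral_cong) (rule indicator_passed[symmetric])
  finally show ?thesis .
qed

text \<open>Given \<open>X t\<close>, the value \<open>W t\<close> has a Gaussian law, which has no
  atoms. This removes the boundaries of orthants when indicators are passed to the limit.\<close>

lemma AE_W_neq:
  assumes "0 < t" and f [measurable]: "f \<in> borel_measurable borel"
  shows "AE \<omega> in M. W t \<omega> \<noteq> f (X t \<omega>)"
proof -
  \<comment> \<open>From time 0 there is no past to remember, hence the parameter of type
    \<open>unit\<close>.\<close>
  let ?F = "\<lambda>(u :: unit, x, w). indicator {f x} w :: ennreal"
  have Fm: "?F \<in> borel_measurable (count_space UNIV \<Otimes>\<^sub>M (borel \<Otimes>\<^sub>M borel))"
  proof -
    have "(\<lambda>(u :: unit, x, w). indicator {0} (w - f x) :: ennreal) \<in> borel_measurable (count_space UNIV \<Otimes>\<^sub>M (borel \<Otimes>\<^sub>M borel))"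
      by measurable
    moreover have "(\<lambda>(u :: unit, x, w). indicator {0} (w - f x) :: ennreal) = ?F"
      by (auto simp: indicator_def fun_eq_iff)
    ultimately show ?thesis by simp
  qed
  have "(\<integral>\<^sup>+\<omega>. ?F ((), X t \<omega> - X 0 \<omega>, W t \<omega> - W 0 \<omega>) \<partial>M)
    = (\<integral>\<^sup>+\<omega>. \<integral>\<^sup>+x. \<integral>\<^sup>+w. ?F ((), x, w) \<partial>gauss (t - 0) \<partial>gauss (t - 0) \<partial>M)"
    by (rule kernel[OF _ assms(1) _ Fm]) auto
  also have "\<dots> = 0" by simp
  finally have "(\<integral>\<^sup>+\<omega>. indicator {f (X t \<omega>)} (W t \<omega>) \<partial>M) = 0"
    by (simp add: X_zero W_zero cong: nn_integral_cong)
  moreover have "(\<lambda>\<omega>. indicator {f (X t \<omega>)} (W t \<omega>) :: ennreal) \<in> borel_measurable M"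
  proof -
    note [measurable] = X_M[OF less_imp_le[OF assms(1)]] W_M[OF less_imp_le[OF assms(1)]]
    have "(\<lambda>\<omega>. indicator {0} (W t \<omega> - f (X t \<omega>)) :: ennreal) \<in> borel_measurable M" by measurable
    then show ?thesis by (simp add: indicator_def)
  qed
  ultimately have "AE \<omega> in M. indicator {f (X t \<omega>)} (W t \<omega>) = (0::ennreal)"
    by (subst (asm) nn_integral_0_iff_AE) auto
  then show ?thesis by eventually_elim (auto simp: indicator_def split: if_splits)
qed


section \<open>Reflection at a level in continuous time\<close>

definition crossed :: "real \<Rightarrow> real \<Rightarrow> 'a set" where
  "crossed t m = (\<Union>j. passed t m j)"

lemma crossed_M: "0 \<le> t \<Longrightarrow> crossed t m \<in> sets M"
  unfolding crossed_def using passed_M by blast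

lemma passed_Suc: "passed t m j \<subseteq> passed t m (Suc j)"
proof
  fix \<omega> assume "\<omega> \<in> passed t m j"
  then obtain k where k: "k \<le> 2 ^ j" "m \<le> drift (t * real k / 2 ^ j) \<omega>" "\<omega> \<in> space M"
    unfolding passed_def by blast
  have "t * real (2 * k) / 2 ^ Suc j = t * real k / 2 ^ j" by simp
  then have "m \<le> drift (t * real (2 * k) / 2 ^ Suc j) \<omega>" using k(2) by (simp only:)
  moreover have "2 * k \<le> 2 ^ Suc j" using k(1) by simp
  ultimately show "\<omega> \<in> passed t m (Suc j)" using k(3) unfolding passed_def by blast
qed

lemma overshoot_ge: "\<omega> \<in> passed t m j \<Longrightarrow> m \<le> overshoot t m j \<omega>"
proof -
  assume \<omega>: "\<omega> \<in> passed t m j"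
  define P where "P k \<longleftrightarrow> m \<le> drift (t * real k / 2 ^ j) \<omega>" for k
  have "\<exists>k. P k" using \<omega> unfolding passed_def P_def by blast
  then have "P (Least P)" by (rule LeastI_ex)
  then show ?thesis unfolding overshoot_def P_def .
qed

lemma drift_ge_passed: "\<omega> \<in> space M \<Longrightarrow> m \<le> drift t \<omega> \<Longrightarrow> \<omega> \<in> passed t m j"
  unfolding passed_def by (auto intro!: exI[of _ "2 ^ j"])

text \<open>The grid identity passes to the limit by dominated convergence. The condition
  \<open>b \<le> m\<close> provides the dominating constant: where the indicator does not vanish,
  the value at passage is at most \<open>drift t\<close>, so the exponential is at most 1.\<close>

lemma reflect_orthant:
  assumes t: "0 < t" and m: "0 < m" and b: "b \<le> m"
  shows "emeasure M (crossed t m \<inter> {\<omega>\<in>space M. (E \<omega>, X t \<omega>, drift t \<omega>) \<in> {..z} \<times> {..a} \<times> {..b}})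
    = (\<integral>\<^sup>+\<omega>. indicator ({..z} \<times> {..a} \<times> {..b}) (E \<omega>, X t \<omega> + drift t \<omega> - m, 2 * m - drift t \<omega>)
        * ennreal (exp (- c * (drift t \<omega> - m))) \<partial>M)"
proof -
  have t0: "0 \<le> t" using t by simp
  note [measurable] = X_M[OF t0] W_M[OF t0] drift_M[OF t0]
  let ?S = "{\<omega>\<in>space M. (E \<omega>, X t \<omega>, drift t \<omega>) \<in> {..z} \<times> {..a} \<times> {..b}}"
  let ?I = "indicator ({..z} \<times> {..a} \<times> {..b}) :: real \<times> real \<times> real \<Rightarrow> ennreal"
  define h where "h \<omega> y = ?I (E \<omega>, X t \<omega> + drift t \<omega> - y, 2 * y - drift t \<omega>) * ennreal (exp (- c * (drift t \<omega> - y)))" for \<omega> y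
  define u where "u j \<omega> = indicator (passed t m j) \<omega> * h \<omega> (overshoot t m j \<omega>)" for j \<omega>
  have I [measurable]: "?I \<in> borel_measurable (borel \<Otimes>\<^sub>M (borel \<Otimes>\<^sub>M borel))" by measurable
  have S [measurable]: "?S \<in> sets M" by measurable
  have hm: "case_prod h \<in> borel_measurable (M \<Otimes>\<^sub>M borel)" unfolding h_def by measurable
  have um: "u j \<in> borel_measurable M" for j
    unfolding u_def by (rule measurable_passed_overshoot[OF t0 hm])
  have ueq: "emeasure M (passed t m j \<inter> ?S) = (\<integral>\<^sup>+\<omega>. u j \<omega> \<partial>M)" for j
  proof -
    have "emeasure M (passed t m j \<inter> ?S) = (\<integral>\<^sup>+\<omega>. indicator (passed t m j \<inter> ?S) \<omega> \<partial>M)"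
      using passed_M[OF t0] by (intro nn_integral_indicator[symmetric]) auto
    also have "\<dots> = (\<integral>\<^sup>+\<omega>. indicator (passed t m j) \<omega> * ?I (E \<omega>, X t \<omega>, drift t \<omega>) \<partial>M)"
      by (intro nn_integral_cong) (auto simp: indicator_def)
    also have "\<dots> = (\<integral>\<^sup>+\<omega>. u j \<omega> \<partial>M)"
      unfolding u_def h_def by (rule reflect_grid[OF t0 I])
    finally show ?thesis .
  qed
  have "(\<lambda>j. emeasure M (passed t m j \<inter> ?S)) \<longlonglongrightarrow> emeasure M (\<Union>j. passed t m j \<inter> ?S)"
  proof (rule Lim_emeasure_incseq)
    show "incseq (\<lambda>j. passed t m j \<inter> ?S)" by (rule incseq_SucI) (use passed_Suc in blast)
  qed (use passed_M[OF t0] in auto)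
  also have "(\<Union>j. passed t m j \<inter> ?S) = crossed t m \<inter> ?S" unfolding crossed_def by blast
  finally have lim1: "(\<lambda>j. \<integral>\<^sup>+\<omega>. u j \<omega> \<partial>M) \<longlonglongrightarrow> emeasure M (crossed t m \<inter> ?S)" unfolding ueq .
  have lim2: "(\<lambda>j. \<integral>\<^sup>+\<omega>. u j \<omega> \<partial>M) \<longlonglongrightarrow> (\<integral>\<^sup>+\<omega>. h \<omega> m \<partial>M)"
  proof (rule nn_integral_dominated_convergence[where w="\<lambda>_. 1"])
    show "(\<lambda>\<omega>. h \<omega> m) \<in> borel_measurable M" unfolding h_def by measurable
    show "AE \<omega> in M. u j \<omega> \<le> 1" for j
    proof (rule AE_I2)
      fix \<omega>
      show "u j \<omega> \<le> 1"
      proof (cases "\<omega> \<in> passed t m j \<and> 2 * overshoot t m j \<omega> - drift t \<omega> \<le> b")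
        case True
        then have "overshoot t m j \<omega> \<le> drift t \<omega>" using overshoot_ge[of \<omega> t m j] b by linarith
        then have "exp (- c * (drift t \<omega> - overshoot t m j \<omega>)) \<le> 1" using c by simp
        then show ?thesis unfolding u_def h_def by (auto simp: indicator_def)
      next
        case False
        then show ?thesis unfolding u_def h_def by (auto simp: indicator_def)
      qed
    qed
    show "(\<integral>\<^sup>+\<omega>. 1 \<partial>M) < \<infinity>" by (simp add: emeasure_space_1)
    \<comment> \<open>This line and the next exclude drift t = 2 * m - b and X t + drift t - m = a,
      where the indicators might fail to converge; the second is a condition on \<open>W t\<close>
      alone because X t + drift t = W t + c * t.\<close>
    have "AE \<omega> in M. W t \<omega> \<noteq> 2 * m - b - c * t + X t \<omega>" by (rule AE_W_neq[OF t]) measurable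
    moreover have "AE \<omega> in M. W t \<omega> \<noteq> (\<lambda>_. a + m - c * t) (X t \<omega>)" by (rule AE_W_neq[OF t]) measurable
    ultimately show "AE \<omega> in M. (\<lambda>j. u j \<omega>) \<longlonglongrightarrow> h \<omega> m"
      using AE_space
    proof eventually_elim
      case (elim \<omega>)
      have R: "drift t \<omega> \<noteq> 2 * m - b" and A: "X t \<omega> + drift t \<omega> - m \<noteq> a"
        using elim unfolding drift_def by auto
      show ?case
      proof (cases "drift t \<omega> < 2 * m - b")
        case True
        have "u j \<omega> = 0" for j
          using True overshoot_ge[of \<omega> t m j] unfolding u_def h_def by (auto simp: indicator_def)
        moreover have "h \<omega> m = 0" using True unfolding h_def by (auto simp: indicator_def)
        ultimately show ?thesis by simp
      next
        case False
        then have R': "2 * m - drift t \<omega> < b" using R by simp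
        then have mR: "m < drift t \<omega>" using b by simp
        have O: "(\<lambda>j. overshoot t m j \<omega>) \<longlonglongrightarrow> m"
          unfolding overshoot_def
          by (rule first_grid_passage_LIMSEQ[OF continuous_on_nonneg_subset[OF drift_cont] t _ mR])
            (use elim drift_zero m in auto)
        have "(\<lambda>j. 2 * overshoot t m j \<omega> - drift t \<omega>) \<longlonglongrightarrow> 2 * m - drift t \<omega>"
          by (intro tendsto_intros O)
        then have ev1: "\<forall>\<^sub>F j in sequentially. 2 * overshoot t m j \<omega> - drift t \<omega> < b"
          using R' by (rule order_tendstoD)
        have l: "(\<lambda>j. X t \<omega> + drift t \<omega> - overshoot t m j \<omega>) \<longlonglongrightarrow> X t \<omega> + drift t \<omega> - m"
          by (intro tendsto_intros O)
        have ev2: "\<forall>\<^sub>F j in sequentially. X t \<omega> + drift t \<omega> - overshoot t m j \<omega> \<le> a \<longleftrightarrow> X t \<omega> + drift t \<omega> - m \<le> a"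
        proof (cases "X t \<omega> + drift t \<omega> - m < a")
          case True
          show ?thesis using order_tendstoD(2)[OF l True] by eventually_elim (use True in auto)
        next
          case False
          then have a: "a < X t \<omega> + drift t \<omega> - m" using A by simp
          show ?thesis using order_tendstoD(1)[OF l a] by eventually_elim (use a in auto)
        qed
        define i where "i = ?I (E \<omega>, X t \<omega> + drift t \<omega> - m, 2 * m - drift t \<omega>)"
        have ev: "\<forall>\<^sub>F j in sequentially. i * ennreal (exp (- c * (drift t \<omega> - overshoot t m j \<omega>))) = u j \<omega>"
          using ev1 ev2
        proof eventually_elim
          case (elim j)
          have "\<omega> \<in> passed t m j" using drift_ge_passed mR \<open>\<omega> \<in> space M\<close> by simp
          then show ?case using elim R' unfolding u_def h_def i_def by (auto simp: indicator_def)
        qed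
        have "(\<lambda>j. ennreal (exp (- c * (drift t \<omega> - overshoot t m j \<omega>)))) \<longlonglongrightarrow> ennreal (exp (- c * (drift t \<omega> - m)))"
          by (intro tendsto_ennrealI tendsto_intros O)
        moreover have "i = 0 \<or> i = 1" unfolding i_def by (auto simp: indicator_def)
        ultimately have "(\<lambda>j. i * ennreal (exp (- c * (drift t \<omega> - overshoot t m j \<omega>)))) \<longlonglongrightarrow> i * ennreal (exp (- c * (drift t \<omega> - m)))"
          by auto
        then have "(\<lambda>j. u j \<omega>) \<longlonglongrightarrow> i * ennreal (exp (- c * (drift t \<omega> - m)))"
          by (rule Lim_transform_eventually[OF _ ev])
        then show ?thesis unfolding h_def i_def .
      qed
    qed
  qed (use um in auto)
  show ?thesis using LIMSEQ_unique[OF lim1 lim2] unfolding h_def .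
qed

text \<open>Both sides are integrals of \<open>F\<close> against finite measures on
  three-dimensional space, and these agree on orthants.\<close>

lemma reflect:
  assumes t: "0 < t" and m: "0 < m" and F: "F \<in> borel_measurable (borel \<Otimes>\<^sub>M (borel \<Otimes>\<^sub>M borel))"
  shows "(\<integral>\<^sup>+\<omega>. indicator (crossed t m \<inter> {\<omega>\<in>space M. drift t \<omega> \<le> m}) \<omega> * F (E \<omega>, X t \<omega>, drift t \<omega>) \<partial>M)
    = (\<integral>\<^sup>+\<omega>. indicator {\<omega>\<in>space M. m \<le> drift t \<omega>} \<omega> * ennreal (exp (- c * (drift t \<omega> - m)))
        * F (E \<omega>, X t \<omega> + drift t \<omega> - m, 2 * m - drift t \<omega>) \<partial>M)"
proof -
  have t0: "0 \<le> t" using t by simp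
  note [measurable] = X_M[OF t0] W_M[OF t0] drift_M[OF t0] crossed_M[OF t0]
  let ?B = "borel \<Otimes>\<^sub>M (borel \<Otimes>\<^sub>M borel) :: (real \<times> real \<times> real) measure"
  have B: "?B = borel" unfolding borel_prod ..
  let ?p = "\<lambda>\<omega>. (E \<omega>, X t \<omega>, drift t \<omega>)" and ?q = "\<lambda>\<omega>. (E \<omega>, X t \<omega> + drift t \<omega> - m, 2 * m - drift t \<omega>)"
  let ?f = "\<lambda>\<omega>. indicator (crossed t m \<inter> {\<omega>\<in>space M. drift t \<omega> \<le> m}) \<omega> :: ennreal"
  let ?g = "\<lambda>\<omega>. indicator {\<omega>\<in>space M. m \<le> drift t \<omega>} \<omega> * ennreal (exp (- c * (drift t \<omega> - m)))"
  have fm [measurable]: "?f \<in> borel_measurable M" by measurable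
  have gm [measurable]: "?g \<in> borel_measurable M" by measurable
  have pm [measurable]: "?p \<in> measurable M ?B" by measurable
  have qm [measurable]: "?q \<in> measurable M ?B" by measurable
  have l: "emeasure (distr (density M f) ?B p) Q = (\<integral>\<^sup>+\<omega>. f \<omega> * indicator Q (p \<omega>) \<partial>M)"
    if [measurable]: "f \<in> borel_measurable M" "p \<in> measurable M ?B" "Q \<in> sets ?B" for f p Q
  proof -
    have "emeasure (distr (density M f) ?B p) Q = (\<integral>\<^sup>+z. indicator Q z \<partial>distr (density M f) ?B p)" by simp
    also have "\<dots> = (\<integral>\<^sup>+\<omega>. f \<omega> * indicator Q (p \<omega>) \<partial>M)"
      by (subst nn_integral_distr) (auto simp: nn_integral_density)
    finally show ?thesis .
  qed
  have eq: "distr (density M ?f) ?B ?p = distr (density M ?g) ?B ?q"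
  proof (rule finite_measure_eqI_atMost)
    show "finite_measure (distr (density M ?f) ?B ?p)"
    proof (rule finite_measureI)
      have "emeasure (distr (density M ?f) ?B ?p) (space ?B) \<le> (\<integral>\<^sup>+\<omega>. 1 \<partial>M)"
        unfolding l[OF fm pm sets.top] by (rule nn_integral_mono) (auto simp: indicator_def)
      then show "emeasure (distr (density M ?f) ?B ?p) (space (distr (density M ?f) ?B ?p)) \<noteq> \<infinity>"
        by (auto simp: emeasure_space_1 top_unique)
    qed
    show "sets (distr (density M ?f) ?B ?p) = sets borel" "sets (distr (density M ?g) ?B ?q) = sets borel"
      unfolding B by simp_all
    fix v :: "real \<times> real \<times> real"
    obtain z a b where v: "v = (z, a, b)" by (cases v)
    have at: "{..v} = {..z} \<times> {..a} \<times> {..b}" unfolding v by (auto simp: less_eq_prod_def)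
    have Q: "{..z} \<times> {..a} \<times> {..b} \<in> sets ?B" by measurable
    \<comment> \<open>The constraint drift t <= m is absorbed into the orthant, which supplies the
      condition of \<open>reflect_orthant\<close>.\<close>
    let ?b = "min b m"
    have "emeasure (distr (density M ?f) ?B ?p) {..v}
      = (\<integral>\<^sup>+\<omega>. indicator (crossed t m \<inter> {\<omega>\<in>space M. ?p \<omega> \<in> {..z} \<times> {..a} \<times> {..?b}}) \<omega> \<partial>M)"
      unfolding at l[OF fm pm Q] by (intro nn_integral_cong) (auto simp: indicator_def)
    also have "\<dots> = emeasure M (crossed t m \<inter> {\<omega>\<in>space M. ?p \<omega> \<in> {..z} \<times> {..a} \<times> {..?b}})"
      by (rule nn_integral_indicator) measurable
    also have "\<dots> = (\<integral>\<^sup>+\<omega>. indicator ({..z} \<times> {..a} \<times> {..?b}) (?q \<omega>) * ennreal (exp (- c * (drift t \<omega> - m))) \<partial>M)"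
      by (rule reflect_orthant[OF t m]) simp
    also have "\<dots> = emeasure (distr (density M ?g) ?B ?q) {..v}"
      unfolding at l[OF gm qm Q] by (intro nn_integral_cong) (auto simp: indicator_def)
    finally show "emeasure (distr (density M ?f) ?B ?p) {..v} = emeasure (distr (density M ?g) ?B ?q) {..v}" .
  qed
  have r: "(\<integral>\<^sup>+z. F z \<partial>distr (density M f) ?B p) = (\<integral>\<^sup>+\<omega>. f \<omega> * F (p \<omega>) \<partial>M)"
    if [measurable]: "f \<in> borel_measurable M" "p \<in> measurable M ?B" for f p
  proof -
    have [measurable]: "F \<in> borel_measurable ?B" by (rule F)
    show ?thesis by (subst nn_integral_distr) (auto simp: nn_integral_density)
  qed
  show ?thesis using r[OF fm pm] r[OF gm qm] unfolding eq by simp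
qed

lemma law_at:
  assumes t: "0 < t" and F [measurable]: "F \<in> borel_measurable (borel \<Otimes>\<^sub>M (borel \<Otimes>\<^sub>M borel))"
  shows "(\<integral>\<^sup>+\<omega>. F (E \<omega>, X t \<omega>, drift t \<omega>) \<partial>M)
    = (\<integral>\<^sup>+e. ennreal (exponential_density c e) * (\<integral>\<^sup>+x. \<integral>\<^sup>+w. F (e, x, w + c * t - x) \<partial>gauss t \<partial>gauss t) \<partial>lborel)"
proof -
  let ?F = "\<lambda>(e, x, w). F (e, x, w + c * t - x)"
  interpret g: prob_space "gauss t" by (rule prob_space_gauss[OF t])
  have Fm [measurable]: "?F \<in> borel_measurable (borel \<Otimes>\<^sub>M (borel \<Otimes>\<^sub>M borel))" by measurable
  have gm: "(\<lambda>e. \<integral>\<^sup>+x. \<integral>\<^sup>+w. F (e, x, w + c * t - x) \<partial>gauss t \<partial>gauss t) \<in> borel_measurable borel"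
    by measurable
  have "(\<integral>\<^sup>+\<omega>. F (E \<omega>, X t \<omega>, drift t \<omega>) \<partial>M) = (\<integral>\<^sup>+\<omega>. ?F (E \<omega>, X t \<omega> - X 0 \<omega>, W t \<omega> - W 0 \<omega>) \<partial>M)"
    by (intro nn_integral_cong) (simp add: drift_def X_zero W_zero)
  also have "\<dots> = (\<integral>\<^sup>+\<omega>. \<integral>\<^sup>+x. \<integral>\<^sup>+w. ?F (E \<omega>, x, w) \<partial>gauss (t - 0) \<partial>gauss (t - 0) \<partial>M)"
    by (rule kernel[OF order_refl t E_G Fm])
  also have "\<dots> = (\<integral>\<^sup>+e. \<integral>\<^sup>+x. \<integral>\<^sup>+w. F (e, x, w + c * t - x) \<partial>gauss t \<partial>gauss t \<partial>distr M borel E)"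
    using gm by (subst nn_integral_distr[OF E_M]) simp_all
  also have "\<dots> = (\<integral>\<^sup>+e. ennreal (exponential_density c e) * (\<integral>\<^sup>+x. \<integral>\<^sup>+w. F (e, x, w + c * t - x) \<partial>gauss t \<partial>gauss t) \<partial>lborel)"
    unfolding E_distr using gm by (subst nn_integral_density) auto
  finally show ?thesis .
qed

end

section \<open>Burke's theorem for the Brownian queue\<close>

context bm_queue
begin

definition departures :: "real \<Rightarrow> 'a \<Rightarrow> real" where
  "departures t \<omega> = dep c (\<lambda>s. X s \<omega>) (\<lambda>s. W s \<omega>) (E \<omega>) t"

definition qlen :: "real \<Rightarrow> 'a \<Rightarrow> real" where
  "qlen t \<omega> = queue_len c (\<lambda>s. X s \<omega>) (\<lambda>s. W s \<omega>) (E \<omega>) t"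

lemma qlen_eq: "qlen t \<omega> = X t \<omega> + E \<omega> - departures t \<omega>"
  unfolding qlen_def departures_def queue_len_def ..

lemma departures_G: "0 \<le> t \<Longrightarrow> departures t \<in> borel_measurable (G t)"
  unfolding departures_def
proof (rule measurable_dep)
  assume t: "0 \<le> t"
  show "X s \<in> borel_measurable (G t)" "W s \<in> borel_measurable (G t)" if "s \<in> {0..t}" for s
    using that by (auto intro!: measurable_G_mono[of s t] X_G W_G)
  show "E \<in> borel_measurable (G t)" using t by (intro measurable_G_mono[OF _ _ E_G]) auto
qed (auto simp: space_G X_cont W_cont)

lemma qlen_G: "0 \<le> t \<Longrightarrow> qlen t \<in> borel_measurable (G t)"
  unfolding qlen_eq using departures_G X_G measurable_G_mono[OF order_refl _ E_G]
  by (intro borel_measurable_diff borel_measurable_add) auto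

lemma departures_M [measurable]: "0 \<le> t \<Longrightarrow> departures t \<in> borel_measurable M"
  and qlen_M [measurable]: "0 \<le> t \<Longrightarrow> qlen t \<in> borel_measurable M"
  using measurable_G_M departures_G qlen_G by blast+

lemma qlen_nonneg: "\<omega> \<in> space M \<Longrightarrow> 0 \<le> t \<Longrightarrow> 0 \<le> qlen t \<omega>"
  unfolding qlen_def by (intro queue_len_nonneg X_cont W_cont)

lemma qlen_ge_iff:
  "\<omega> \<in> space M \<Longrightarrow> 0 \<le> t \<Longrightarrow> 0 \<le> v \<Longrightarrow>
    v \<le> qlen t \<omega> \<longleftrightarrow> drift t \<omega> + v \<le> E \<omega> \<or> (\<exists>s\<in>{0..t}. drift t \<omega> + v \<le> drift s \<omega>)"
  unfolding qlen_def drift_def by (intro queue_len_ge_iff X_cont W_cont)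

text \<open>The two sides can only differ when \<open>m\<close> is the maximum of the path.\<close>

lemma AE_crossed_iff:
  assumes "\<omega> \<in> space M" "0 \<le> t"
  shows "AE m in lborel. (\<exists>s\<in>{0..t}. m \<le> drift s \<omega>) \<longleftrightarrow> \<omega> \<in> crossed t m"
proof -
  have d: "continuous_on {0..t} (\<lambda>s. drift s \<omega>)"
    by (rule continuous_on_nonneg_subset[OF drift_cont[OF assms(1)]])
  obtain s0 where s0: "s0 \<in> {0..t}" "\<And>s. s \<in> {0..t} \<Longrightarrow> drift s \<omega> \<le> drift s0 \<omega>"
    using continuous_attains_sup[OF compact_Icc _ d] assms(2) by auto
  have "(\<exists>s\<in>{0..t}. m \<le> drift s \<omega>) \<longleftrightarrow> \<omega> \<in> crossed t m" if m: "m \<noteq> drift s0 \<omega>" for m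
  proof
    assume "\<exists>s\<in>{0..t}. m \<le> drift s \<omega>"
    then have "m < drift s0 \<omega>" using s0(2) m by force
    then have "\<not> (\<forall>j k. k \<le> 2 ^ j \<longrightarrow> drift (t * real k / 2 ^ j) \<omega> \<le> m)"
      using dyadic_grid_le[OF d s0(1), of m] by force
    then obtain j k where "k \<le> 2 ^ j" "m \<le> drift (t * real k / 2 ^ j) \<omega>" by force
    then show "\<omega> \<in> crossed t m" using assms(1) unfolding crossed_def passed_def by blast
  next
    assume "\<omega> \<in> crossed t m"
    then show "\<exists>s\<in>{0..t}. m \<le> drift s \<omega>"
      using dyadic_grid_in[OF assms(2)] unfolding crossed_def passed_def by blast
  qed
  moreover have "AE m in lborel. m \<noteq> drift s0 \<omega>" by (rule AE_lborel_singleton)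
  ultimately show ?thesis by (auto elim: eventually_mono)
qed

text \<open>The level becomes an integration variable, so measurability is needed jointly.\<close>

lemma pred_crossed:
  assumes "0 \<le> t"
  shows "Measurable.pred (M \<Otimes>\<^sub>M borel) (\<lambda>z. fst z \<in> crossed t (snd z))"
proof -
  have [measurable]: "drift (t * real k / 2 ^ j) \<in> borel_measurable M" for k j
    using assms by (intro drift_M) simp
  have "Measurable.pred (M \<Otimes>\<^sub>M borel) (\<lambda>z. fst z \<in> space M \<and> (\<exists>j. \<exists>k. k \<le> (2::nat) ^ j \<and> snd z \<le> drift (t * real k / 2 ^ j) (fst z)))"
    by measurable
  then show ?thesis unfolding crossed_def passed_def by simp
qed

text \<open>With the exponential variable innermost, substitutions in \<open>e\<close> can be
  carried out for fixed Gaussian values.\<close>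

lemma law_at':
  assumes t: "0 < t" and F [measurable]: "F \<in> borel_measurable (borel \<Otimes>\<^sub>M (borel \<Otimes>\<^sub>M borel))"
  shows "(\<integral>\<^sup>+\<omega>. F (E \<omega>, X t \<omega>, drift t \<omega>) \<partial>M)
    = (\<integral>\<^sup>+x. \<integral>\<^sup>+w. \<integral>\<^sup>+e. ennreal (exponential_density c e) * F (e, x, w + c * t - x) \<partial>lborel \<partial>gauss t \<partial>gauss t)"
proof -
  interpret g: prob_space "gauss t" by (rule prob_space_gauss[OF t])
  interpret p: pair_sigma_finite "gauss t" lborel ..
  have [measurable_cong]: "sets (gauss t) = sets borel" by simp
  have "(\<integral>\<^sup>+\<omega>. F (E \<omega>, X t \<omega>, drift t \<omega>) \<partial>M)
    = (\<integral>\<^sup>+e. \<integral>\<^sup>+x. \<integral>\<^sup>+w. ennreal (exponential_density c e) * F (e, x, w + c * t - x) \<partial>gauss t \<partial>gauss t \<partial>lborel)"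
    unfolding law_at[OF t F] by (simp add: nn_integral_cmult)
  also have "\<dots> = (\<integral>\<^sup>+x. \<integral>\<^sup>+e. \<integral>\<^sup>+w. ennreal (exponential_density c e) * F (e, x, w + c * t - x) \<partial>gauss t \<partial>lborel \<partial>gauss t)"
    by (rule p.Fubini') measurable
  also have "\<dots> = (\<integral>\<^sup>+x. \<integral>\<^sup>+w. \<integral>\<^sup>+e. ennreal (exponential_density c e) * F (e, x, w + c * t - x) \<partial>lborel \<partial>gauss t \<partial>gauss t)"
    by (intro nn_integral_cong p.Fubini') measurable
  finally show ?thesis .
qed

section \<open>The queue length at a fixed time, tested against functions\<close>

context
  fixes f g :: "real \<Rightarrow> ennreal" and t :: real
  assumes f [measurable]: "f \<in> borel_measurable borel" and g [measurable]: "g \<in> borel_measurable borel"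
    and t: "0 < t"
begin

text \<open>\<open>J (qlen t \<omega>)\<close> integrates the events v <= qlen t over the level
  \<open>v\<close> with weight \<open>g\<close>. Averaging over levels makes the exceptional level
  of \<open>AE_crossed_iff\<close> harmless and provides a variable to substitute.\<close>

private definition J :: "real \<Rightarrow> ennreal" where
  "J z = (\<integral>\<^sup>+v. (if 0 \<le> v \<and> v \<le> z then g v else 0) \<partial>lborel)"

private lemma J_measurable [measurable]: "J \<in> borel_measurable borel"
  unfolding J_def by measurable

text \<open>The initial content alone does not reach the level here. With m = drift t + v the event
  is a crossing of \<open>m\<close>, which \<open>reflect\<close> removes at the cost of a factor
  exp(-c * v); then z = e + v plays the role of the initial content, because the exponential density
  at z - v times exp(-c * v) is the density at z.\<close>

private lemma empty_queue_part:
  "(\<integral>\<^sup>+\<omega>. \<integral>\<^sup>+v. (if 0 \<le> v \<and> E \<omega> < drift t \<omega> + v \<and> \<omega> \<in> crossed t (drift t \<omega> + v) then f (X t \<omega> + E \<omega>) * g v else 0) \<partial>lborel \<partial>M)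
    = (\<integral>\<^sup>+\<omega>. (if E \<omega> < drift t \<omega> then f (X t \<omega> + E \<omega>) * J (E \<omega>) else 0) \<partial>M)" (is "?L = ?R")
proof -
  let ?int = "\<lambda>\<omega> v. (if 0 \<le> v \<and> E \<omega> < drift t \<omega> + v \<and> \<omega> \<in> crossed t (drift t \<omega> + v) then f (X t \<omega> + E \<omega>) * g v else 0)"
  \<comment> \<open>\<open>?before\<close> is \<open>?int\<close> in terms of m = drift t + v,
    \<open>?after\<close> its reflection at \<open>m\<close>, \<open>?b\<close> the latter with v =
    drift t - m, and \<open>?k\<close> the outcome with z = e + v.\<close>
  let ?before = "\<lambda>\<omega> m. (if drift t \<omega> \<le> m \<and> E \<omega> < m \<and> \<omega> \<in> crossed t m then f (X t \<omega> + E \<omega>) * g (m - drift t \<omega>) else 0)"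
  let ?after = "\<lambda>\<omega> m. (if m \<le> drift t \<omega> \<and> E \<omega> < m then f (X t \<omega> + drift t \<omega> - m + E \<omega>) * g (drift t \<omega> - m) * ennreal (exp (- c * (drift t \<omega> - m))) else 0)"
  let ?b = "\<lambda>e x r v. (if 0 \<le> v \<and> e + v < r then f (x + (e + v)) * g v * ennreal (exp (- c * v)) else 0)"
  let ?k = "\<lambda>x r z v. (if z < r then f (x + z) * (if 0 \<le> v \<and> v \<le> z then g v else 0) else 0)"
  have t0: "0 \<le> t" using t by simp
  note [measurable] = X_M[OF t0] W_M[OF t0] drift_M[OF t0] pred_crossed[OF t0]
  interpret p: pair_sigma_finite M lborel ..
  have mu: "(\<lambda>v. ?int \<omega> v) \<in> borel_measurable borel"
    if "\<omega> \<in> space M" for \<omega>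
  proof -
    have [measurable]: "Measurable.pred borel (\<lambda>m. \<omega> \<in> crossed t m)"
      using measurable_compose[OF measurable_Pair1'[OF that] pred_crossed[OF t0]] by simp
    show ?thesis by measurable
  qed
  have "?L = (\<integral>\<^sup>+\<omega>. \<integral>\<^sup>+m. ?before \<omega> m \<partial>lborel \<partial>M)"
  proof (rule nn_integral_cong)
    fix \<omega> assume w: "\<omega> \<in> space M"
    from nn_integral_lborel_shift[OF mu[OF w], of "- drift t \<omega>"]
    show "(\<integral>\<^sup>+v. ?int \<omega> v \<partial>lborel)
      = (\<integral>\<^sup>+m. ?before \<omega> m \<partial>lborel)"
      by (simp cong: if_cong)
  qed
  also have "\<dots> = (\<integral>\<^sup>+m. \<integral>\<^sup>+\<omega>. ?before \<omega> m \<partial>M \<partial>lborel)"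
    by (rule p.Fubini'[symmetric]) measurable
  also have "\<dots> = (\<integral>\<^sup>+m. \<integral>\<^sup>+\<omega>. ?after \<omega> m \<partial>M \<partial>lborel)"
  proof (rule nn_integral_cong)
    fix m :: real
    show "(\<integral>\<^sup>+\<omega>. ?before \<omega> m \<partial>M)
      = (\<integral>\<^sup>+\<omega>. ?after \<omega> m \<partial>M)"
    \<comment> \<open>\<open>reflect\<close> needs a positive level; at other levels both integrands
      vanish because \<open>E\<close> is nonnegative.\<close>
    proof (cases "0 < m")
      case True
      let ?F = "\<lambda>(e, x, r). if e < m then f (x + e) * g (m - r) else 0"
      have "?F \<in> borel_measurable (borel \<Otimes>\<^sub>M (borel \<Otimes>\<^sub>M borel))" by measurable
      note refl = reflect[OF t True this]
      show ?thesis
      proof (rule trans[OF _ trans[OF refl]])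
        show "(\<integral>\<^sup>+\<omega>. ?before \<omega> m \<partial>M)
          = (\<integral>\<^sup>+\<omega>. indicator (crossed t m \<inter> {\<omega>\<in>space M. drift t \<omega> \<le> m}) \<omega> * ?F (E \<omega>, X t \<omega>, drift t \<omega>) \<partial>M)"
          by (intro nn_integral_cong) (auto simp: indicator_def)
      qed (intro nn_integral_cong, auto simp: indicator_def mult_ac)
    next
      case False
      then have "\<not> E \<omega> < m" if "\<omega> \<in> space M" for \<omega> using E_nonneg[OF that] by simp
      then show ?thesis by (intro nn_integral_cong) auto
    qed
  qed
  also have "\<dots> = (\<integral>\<^sup>+\<omega>. \<integral>\<^sup>+m. ?after \<omega> m \<partial>lborel \<partial>M)"
    by (rule p.Fubini') measurable
  also have "\<dots> = (\<integral>\<^sup>+\<omega>. \<integral>\<^sup>+v. ?b (E \<omega>) (X t \<omega>) (drift t \<omega>) v \<partial>lborel \<partial>M)"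
  proof (rule nn_integral_cong)
    fix \<omega>
    let ?u = "?after \<omega>"
    have "(\<integral>\<^sup>+m. ?u m \<partial>lborel) = (\<integral>\<^sup>+v. ?u (drift t \<omega> - v) \<partial>lborel)"
      by (rule nn_integral_lborel_reflect[symmetric]) measurable
    also have "\<dots> = (\<integral>\<^sup>+v. ?b (E \<omega>) (X t \<omega>) (drift t \<omega>) v \<partial>lborel)"
      by (intro nn_integral_cong if_cong) (auto simp: algebra_simps)
    finally show "(\<integral>\<^sup>+m. ?u m \<partial>lborel) = (\<integral>\<^sup>+v. ?b (E \<omega>) (X t \<omega>) (drift t \<omega>) v \<partial>lborel)" .
  qed
  also have "\<dots> = (\<integral>\<^sup>+x. \<integral>\<^sup>+w. \<integral>\<^sup>+e. ennreal (exponential_density c e) *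
      (\<integral>\<^sup>+v. ?b e x (w + c * t - x) v \<partial>lborel) \<partial>lborel \<partial>gauss t \<partial>gauss t)"
  proof -
    have "(\<lambda>(e, x, r). \<integral>\<^sup>+v. ?b e x r v \<partial>lborel)
      \<in> borel_measurable (borel \<Otimes>\<^sub>M (borel \<Otimes>\<^sub>M borel))" by measurable
    from law_at'[OF t this] show ?thesis by simp
  qed
  also have "\<dots> = (\<integral>\<^sup>+x. \<integral>\<^sup>+w. \<integral>\<^sup>+e. ennreal (exponential_density c e) *
      (if e < w + c * t - x then f (x + e) * J e else 0) \<partial>lborel \<partial>gauss t \<partial>gauss t)"
  proof (rule nn_integral_cong, rule nn_integral_cong)
    fix x w :: real
    define r where "r = w + c * t - x"
    have "(\<integral>\<^sup>+e. ennreal (exponential_density c e) *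
        (\<integral>\<^sup>+v. ?b e x r v \<partial>lborel) \<partial>lborel)
      = (\<integral>\<^sup>+e. \<integral>\<^sup>+v. ennreal (exponential_density c e) *
        ?b e x r v \<partial>lborel \<partial>lborel)"
      by (simp add: nn_integral_cmult)
    also have "\<dots> = (\<integral>\<^sup>+v. \<integral>\<^sup>+e. ennreal (exponential_density c e) *
        ?b e x r v \<partial>lborel \<partial>lborel)"
      by (rule lborel_pair.Fubini') measurable
    also have "\<dots> = (\<integral>\<^sup>+v. \<integral>\<^sup>+z. ennreal (exponential_density c (z - v)) *
        (if 0 \<le> v \<and> z < r then f (x + z) * g v * ennreal (exp (- c * v)) else 0) \<partial>lborel \<partial>lborel)"
    proof (rule nn_integral_cong)
      fix v :: real
      let ?u = "\<lambda>e. ennreal (exponential_density c e) *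
        ?b e x r v"
      have "(\<integral>\<^sup>+e. ?u e \<partial>lborel) = (\<integral>\<^sup>+z. ?u (z + - v) \<partial>lborel)"
        by (rule nn_integral_lborel_shift[symmetric]) measurable
      then show "(\<integral>\<^sup>+e. ?u e \<partial>lborel) = (\<integral>\<^sup>+z. ennreal (exponential_density c (z - v)) *
        (if 0 \<le> v \<and> z < r then f (x + z) * g v * ennreal (exp (- c * v)) else 0) \<partial>lborel)" by (simp cong: if_cong)
    qed
    also have "\<dots> = (\<integral>\<^sup>+v. \<integral>\<^sup>+z. ennreal (exponential_density c z) * ?k x r z v \<partial>lborel \<partial>lborel)"
    proof (intro nn_integral_cong)
      fix v z :: real
      show "ennreal (exponential_density c (z - v)) *
        (if 0 \<le> v \<and> z < r then f (x + z) * g v * ennreal (exp (- c * v)) else 0)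
        = ennreal (exponential_density c z) * ?k x r z v"
      proof (cases "0 \<le> v \<and> v \<le> z \<and> z < r")
        case True
        have "exp (- (z - v) * c) * exp (- c * v) = exp (- z * c)"
          unfolding exp_add[symmetric] by (simp add: algebra_simps)
        then have "exponential_density c (z - v) * exp (- c * v) = exponential_density c z"
          using True by (simp add: exponential_density_def mult.assoc)
        then have "ennreal (exponential_density c z) = ennreal (exponential_density c (z - v)) * ennreal (exp (- c * v))"
          by (metis ennreal_mult'' exp_ge_zero)
        then show ?thesis using True by (simp add: mult_ac)
      next
        case False
        then show ?thesis by (auto simp: exponential_density_def)
      qed
    qed
    also have "\<dots> = (\<integral>\<^sup>+z. \<integral>\<^sup>+v. ennreal (exponential_density c z) * ?k x r z v \<partial>lborel \<partial>lborel)"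
      by (rule lborel_pair.Fubini') measurable
    also have "\<dots> = (\<integral>\<^sup>+z. ennreal (exponential_density c z) * (if z < r then f (x + z) * J z else 0) \<partial>lborel)"
      unfolding J_def by (intro nn_integral_cong) (auto simp: nn_integral_cmult)
    finally show "(\<integral>\<^sup>+e. ennreal (exponential_density c e) *
        (\<integral>\<^sup>+v. ?b e x (w + c * t - x) v \<partial>lborel) \<partial>lborel)
      = (\<integral>\<^sup>+e. ennreal (exponential_density c e) * (if e < w + c * t - x then f (x + e) * J e else 0) \<partial>lborel)"
      unfolding r_def .
  qed
  also have "\<dots> = ?R"
  proof -
    have "(\<lambda>(e, x, r). if e < r then f (x + e) * J e else 0)
      \<in> borel_measurable (borel \<Otimes>\<^sub>M (borel \<Otimes>\<^sub>M borel))" by measurable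
    from law_at'[OF t this] show ?thesis by simp
  qed
  finally show ?thesis .
qed

text \<open>The initial content alone reaches the level here, so no crossing is involved. The shift
  e = z + drift t produces the factor exp(-c * drift t), which \<open>gauss_swap\<close> on all of
  [0, t] removes while changing the sign of drift t.\<close>

private lemma busy_queue_part:
  "(\<integral>\<^sup>+\<omega>. \<integral>\<^sup>+v. (if 0 \<le> v \<and> drift t \<omega> + v \<le> E \<omega> then f (X t \<omega> + E \<omega>) * g v else 0) \<partial>lborel \<partial>M)
    = (\<integral>\<^sup>+\<omega>. (if drift t \<omega> \<le> E \<omega> then f (X t \<omega> + E \<omega>) * J (E \<omega>) else 0) \<partial>M)" (is "?L = ?R")
proof -
  define k where "k x r = (\<integral>\<^sup>+e. ennreal (exponential_density c e) * (if r \<le> e then f (x + e) * J e else 0) \<partial>lborel)" for x r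
  have "?L = (\<integral>\<^sup>+x. \<integral>\<^sup>+w. \<integral>\<^sup>+e. ennreal (exponential_density c e) *
      (\<integral>\<^sup>+v. (if 0 \<le> v \<and> w + c * t - x + v \<le> e then f (x + e) * g v else 0) \<partial>lborel) \<partial>lborel \<partial>gauss t \<partial>gauss t)"
  proof -
    have "(\<lambda>(e, x, r). \<integral>\<^sup>+v. (if 0 \<le> v \<and> r + v \<le> e then f (x + e) * g v else 0) \<partial>lborel)
      \<in> borel_measurable (borel \<Otimes>\<^sub>M (borel \<Otimes>\<^sub>M borel))" by measurable
    from law_at'[OF t this] show ?thesis by simp
  qed
  \<comment> \<open>The unsimplified second argument is \<open>k x (w + c * t - x)\<close> with
    \<open>w + c * t\<close> and \<open>x - c * t\<close> put for \<open>x\<close> and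
    \<open>w\<close>, the form demanded by \<open>gauss_swap\<close>.\<close>
  also have "\<dots> = (\<integral>\<^sup>+x. \<integral>\<^sup>+w. k (w + c * t) (x - c * t + c * t - (w + c * t)) * ennreal (exp (- c * (w - x + c * t))) \<partial>gauss t \<partial>gauss t)"
  proof (rule nn_integral_cong, rule nn_integral_cong)
    fix x w :: real
    define r where "r = w + c * t - x"
    let ?u = "\<lambda>e. ennreal (exponential_density c e) * (\<integral>\<^sup>+v. (if 0 \<le> v \<and> r + v \<le> e then f (x + e) * g v else 0) \<partial>lborel)"
    have "(\<integral>\<^sup>+e. ?u e \<partial>lborel) = (\<integral>\<^sup>+z. ?u (z + r) \<partial>lborel)"
      by (rule nn_integral_lborel_shift[symmetric]) measurable
    also have "\<dots> = (\<integral>\<^sup>+z. (ennreal (exponential_density c z) * (if - r \<le> z then f (x + r + z) * J z else 0)) * ennreal (exp (- c * r)) \<partial>lborel)"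
    proof (rule nn_integral_cong)
      fix z :: real
      have 1: "(\<integral>\<^sup>+v. (if 0 \<le> v \<and> r + v \<le> z + r then f (x + (z + r)) * g v else 0) \<partial>lborel) = f (x + r + z) * J z"
        unfolding J_def by (subst nn_integral_cmult[symmetric]) (auto intro!: nn_integral_cong simp: algebra_simps)
      have 2: "J z = 0" if "z < 0"
      proof -
        have "(\<lambda>v. if 0 \<le> v \<and> v \<le> z then g v else 0) = (\<lambda>v. 0)"
          by (rule ext) (use that in auto)
        then show ?thesis unfolding J_def by simp
      qed
      show "?u (z + r) = (ennreal (exponential_density c z) * (if - r \<le> z then f (x + r + z) * J z else 0)) * ennreal (exp (- c * r))"
      proof (cases "0 \<le> z \<and> - r \<le> z")
        case True
        have "exp (- (z + r) * c) = exp (- z * c) * exp (- c * r)"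
          unfolding exp_add[symmetric] by (simp add: algebra_simps)
        then have "exponential_density c (z + r) = exponential_density c z * exp (- c * r)"
          using True by (simp add: exponential_density_def mult.assoc)
        then have "ennreal (exponential_density c (z + r)) = ennreal (exponential_density c z) * ennreal (exp (- c * r))"
          by (metis ennreal_mult'' exp_ge_zero)
        then show ?thesis unfolding 1 using True by (simp add: mult_ac)
      next
        case False
        then show ?thesis unfolding 1 using 2 by (auto simp: exponential_density_def not_le)
      qed
    qed
    also have "\<dots> = k (x + r) (- r) * ennreal (exp (- c * r))"
      unfolding k_def by (subst nn_integral_multc) auto
    also have "\<dots> = k (w + c * t) (x - c * t + c * t - (w + c * t)) * ennreal (exp (- c * (w - x + c * t)))"
      unfolding r_def by (simp add: algebra_simps)
    finally show "(\<integral>\<^sup>+e. ennreal (exponential_density c e) *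
      (\<integral>\<^sup>+v. (if 0 \<le> v \<and> w + c * t - x + v \<le> e then f (x + e) * g v else 0) \<partial>lborel) \<partial>lborel)
      = k (w + c * t) (x - c * t + c * t - (w + c * t)) * ennreal (exp (- c * (w - x + c * t)))"
      unfolding r_def .
  qed
  also have "\<dots> = (\<integral>\<^sup>+x. \<integral>\<^sup>+w. k x (w + c * t - x) \<partial>gauss t \<partial>gauss t)"
  proof -
    have "case_prod (\<lambda>x w. k x (w + c * t - x)) \<in> borel_measurable (borel \<Otimes>\<^sub>M borel)"
      unfolding k_def by measurable
    from gauss_swap[OF this t, of c] show ?thesis by simp
  qed
  also have "\<dots> = ?R"
  proof -
    have "(\<lambda>(e, x, r). if r \<le> e then f (x + e) * J e else 0)
      \<in> borel_measurable (borel \<Otimes>\<^sub>M (borel \<Otimes>\<^sub>M borel))" by measurable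
    from law_at'[OF t this] show ?thesis unfolding k_def by simp
  qed
  finally show ?thesis .
qed

text \<open>By \<open>qlen_ge_iff\<close> a level is reached either by the initial content or, up to
  a null set of levels, only by a crossing. The two parts become the cases drift t <= E and E <
  drift t of the right-hand side.\<close>

private lemma qlen_weak_aux:
  "(\<integral>\<^sup>+\<omega>. f (X t \<omega> + E \<omega>) * J (qlen t \<omega>) \<partial>M) = (\<integral>\<^sup>+\<omega>. f (X t \<omega> + E \<omega>) * J (E \<omega>) \<partial>M)"
proof -
  let ?empty = "\<lambda>\<omega> v. (if 0 \<le> v \<and> E \<omega> < drift t \<omega> + v \<and> \<omega> \<in> crossed t (drift t \<omega> + v) then f (X t \<omega> + E \<omega>) * g v else 0)"
  let ?busy = "\<lambda>\<omega> v. (if 0 \<le> v \<and> drift t \<omega> + v \<le> E \<omega> then f (X t \<omega> + E \<omega>) * g v else 0)"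
  have t0: "0 \<le> t" using t by simp
  note [measurable] = X_M[OF t0] W_M[OF t0] drift_M[OF t0] pred_crossed[OF t0]
  have "(\<integral>\<^sup>+\<omega>. f (X t \<omega> + E \<omega>) * J (qlen t \<omega>) \<partial>M)
    = (\<integral>\<^sup>+\<omega>. (\<integral>\<^sup>+v. ?busy \<omega> v \<partial>lborel)
      + (\<integral>\<^sup>+v. ?empty \<omega> v \<partial>lborel) \<partial>M)"
  proof (rule nn_integral_cong)
    fix \<omega> assume w: "\<omega> \<in> space M"
    have [measurable]: "Measurable.pred borel (\<lambda>m. \<omega> \<in> crossed t m)"
      using measurable_compose[OF measurable_Pair1'[OF w] pred_crossed[OF t0]] by simp
    \<comment> \<open>\<open>AE_crossed_iff\<close> speaks of the level itself, here drift t + m;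
      Lebesgue measure is invariant under the translation.\<close>
    have "AE m in lborel. (\<exists>s\<in>{0..t}. drift t \<omega> + m \<le> drift s \<omega>) \<longleftrightarrow> \<omega> \<in> crossed t (drift t \<omega> + m)"
    proof -
      have "AE m in distr lborel borel ((+) (drift t \<omega>)). (\<exists>s\<in>{0..t}. m \<le> drift s \<omega>) \<longleftrightarrow> \<omega> \<in> crossed t m"
        unfolding lborel_distr_plus by (rule AE_crossed_iff[OF w t0])
      then show ?thesis by (rule AE_distrD[rotated]) simp
    qed
    then have ae: "AE v in lborel. f (X t \<omega> + E \<omega>) * (if 0 \<le> v \<and> v \<le> qlen t \<omega> then g v else 0)
      = ?busy \<omega> v
        + ?empty \<omega> v"
      by eventually_elim (auto simp: qlen_ge_iff[OF w t0])
    have "f (X t \<omega> + E \<omega>) * J (qlen t \<omega>) = (\<integral>\<^sup>+v. f (X t \<omega> + E \<omega>) * (if 0 \<le> v \<and> v \<le> qlen t \<omega> then g v else 0) \<partial>lborel)"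
      unfolding J_def by (rule nn_integral_cmult[symmetric]) measurable
    also have "\<dots> = (\<integral>\<^sup>+v. ?busy \<omega> v
        + ?empty \<omega> v \<partial>lborel)"
      by (rule nn_integral_cong_AE[OF ae])
    also have "\<dots> = (\<integral>\<^sup>+v. ?busy \<omega> v \<partial>lborel)
        + (\<integral>\<^sup>+v. ?empty \<omega> v \<partial>lborel)"
      by (rule nn_integral_add) measurable
    finally show "f (X t \<omega> + E \<omega>) * J (qlen t \<omega>) = \<dots>" .
  qed
  also have "\<dots> = (\<integral>\<^sup>+\<omega>. (if drift t \<omega> \<le> E \<omega> then f (X t \<omega> + E \<omega>) * J (E \<omega>) else 0) \<partial>M)
    + (\<integral>\<^sup>+\<omega>. (if E \<omega> < drift t \<omega> then f (X t \<omega> + E \<omega>) * J (E \<omega>) else 0) \<partial>M)"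
  proof (rule trans[OF nn_integral_add])
    have cr: "Measurable.pred (M \<Otimes>\<^sub>M lborel) (\<lambda>z. fst z \<in> crossed t (drift t (fst z) + snd z))"
    proof -
      have "(\<lambda>z. (fst z, drift t (fst z) + snd z)) \<in> measurable (M \<Otimes>\<^sub>M lborel) (M \<Otimes>\<^sub>M borel)" by measurable
      from measurable_compose[OF this pred_crossed[OF t0]] show ?thesis by simp
    qed
    show "(\<lambda>\<omega>. \<integral>\<^sup>+v. ?busy \<omega> v \<partial>lborel) \<in> borel_measurable M"
      by measurable
    show "(\<lambda>\<omega>. \<integral>\<^sup>+v. ?empty \<omega> v \<partial>lborel) \<in> borel_measurable M"
    proof (rule lborel.borel_measurable_nn_integral)
      note [measurable del] = pred_crossed[OF t0]
      note [measurable] = cr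
      show "(\<lambda>(\<omega>, v). ?empty \<omega> v) \<in> borel_measurable (M \<Otimes>\<^sub>M lborel)"
        unfolding case_prod_beta by measurable
    qed
  qed (simp only: busy_queue_part empty_queue_part)
  also have "\<dots> = (\<integral>\<^sup>+\<omega>. f (X t \<omega> + E \<omega>) * J (E \<omega>) \<partial>M)"
    by (subst nn_integral_add[symmetric]) (auto intro!: nn_integral_cong)
  finally show ?thesis .
qed

lemma qlen_weak:
  "(\<integral>\<^sup>+\<omega>. f (X t \<omega> + E \<omega>) * (\<integral>\<^sup>+v. (if 0 \<le> v \<and> v \<le> qlen t \<omega> then g v else 0) \<partial>lborel) \<partial>M)
    = (\<integral>\<^sup>+\<omega>. f (X t \<omega> + E \<omega>) * (\<integral>\<^sup>+v. (if 0 \<le> v \<and> v \<le> E \<omega> then g v else 0) \<partial>lborel) \<partial>M)"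
  using qlen_weak_aux unfolding J_def .

end

end

section \<open>The joint law of departures and queue length\<close>

abbreviation expo :: "real \<Rightarrow> real measure" where
  "expo c \<equiv> density lborel (exponential_density c)"

context bm_queue
begin

text \<open>With \<open>g\<close> the indicator of [x, y], the function \<open>J\<close> is 0 below
  \<open>x\<close>, equal to y - x above \<open>y\<close> and never larger, so it lies between
  multiples of the tail indicators at \<open>y\<close> and at \<open>x\<close>.\<close>

lemma qlen_tail_le:
  assumes t: "0 < t" and x: "0 \<le> x" "x < y"
  shows "prob {\<omega>\<in>space M. X t \<omega> + E \<omega> \<le> a \<and> y \<le> qlen t \<omega>} \<le> prob {\<omega>\<in>space M. X t \<omega> + E \<omega> \<le> a \<and> x \<le> E \<omega>}"
    and "prob {\<omega>\<in>space M. X t \<omega> + E \<omega> \<le> a \<and> y \<le> E \<omega>} \<le> prob {\<omega>\<in>space M. X t \<omega> + E \<omega> \<le> a \<and> x \<le> qlen t \<omega>}"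
proof -
  let ?T = "\<lambda>y Z. {\<omega>\<in>space M. X t \<omega> + E \<omega> \<le> a \<and> y \<le> Z \<omega>}"
  have t0: "0 \<le> t" using t by simp
  note [measurable] = X_M[OF t0] qlen_M[OF t0]
  let ?f = "indicator {..a} :: real \<Rightarrow> ennreal" and ?g = "indicator {x..y} :: real \<Rightarrow> ennreal"
  define J where "J z = (\<integral>\<^sup>+v. (if 0 \<le> v \<and> v \<le> z then ?g v else 0) \<partial>lborel)" for z :: real
  have J_ge: "ennreal (y - x) \<le> J z" if "y \<le> z" for z
  proof -
    have "ennreal (y - x) = emeasure lborel {x..y}" using x by simp
    also have "\<dots> = (\<integral>\<^sup>+v. ?g v \<partial>lborel)" by (rule nn_integral_indicator[symmetric]) simp
    also have "\<dots> \<le> J z" unfolding J_def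
      by (rule nn_integral_mono) (use that x in \<open>auto simp: indicator_def\<close>)
    finally show ?thesis .
  qed
  have J_le: "J z \<le> ennreal (y - x)" for z
  proof -
    have "J z \<le> (\<integral>\<^sup>+v. ?g v \<partial>lborel)" unfolding J_def by (rule nn_integral_mono) auto
    then show ?thesis using x by simp
  qed
  have J_0: "J z = 0" if "z < x" for z
  proof -
    have "(\<lambda>v. if 0 \<le> v \<and> v \<le> z then ?g v else 0) = (\<lambda>v. 0)"
      by (rule ext) (use that in \<open>auto simp: indicator_def\<close>)
    then show ?thesis unfolding J_def by simp
  qed
  have lower: "ennreal ((y - x) * prob (?T y Z)) \<le> (\<integral>\<^sup>+\<omega>. ?f (X t \<omega> + E \<omega>) * J (Z \<omega>) \<partial>M)"
    if [measurable]: "Z \<in> borel_measurable M" for Z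
  proof -
    have "ennreal ((y - x) * prob (?T y Z))
      = (\<integral>\<^sup>+\<omega>. ennreal (y - x) * indicator (?T y Z) \<omega> \<partial>M)"
      using x by (subst nn_integral_cmult_indicator) (auto simp: emeasure_eq_measure ennreal_mult)
    also have "\<dots> \<le> (\<integral>\<^sup>+\<omega>. ?f (X t \<omega> + E \<omega>) * J (Z \<omega>) \<partial>M)"
      by (rule nn_integral_mono) (auto simp: indicator_def intro: J_ge)
    finally show ?thesis .
  qed
  have upper: "(\<integral>\<^sup>+\<omega>. ?f (X t \<omega> + E \<omega>) * J (Z \<omega>) \<partial>M) \<le> ennreal ((y - x) * prob (?T x Z))"
    if [measurable]: "Z \<in> borel_measurable M" for Z
  proof -
    have "(\<integral>\<^sup>+\<omega>. ?f (X t \<omega> + E \<omega>) * J (Z \<omega>) \<partial>M)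
      \<le> (\<integral>\<^sup>+\<omega>. ennreal (y - x) * indicator (?T x Z) \<omega> \<partial>M)"
      using J_le J_0 by (intro nn_integral_mono) (auto simp: indicator_def not_le)
    also have "\<dots> = ennreal ((y - x) * prob (?T x Z))"
      using x by (subst nn_integral_cmult_indicator) (auto simp: emeasure_eq_measure ennreal_mult)
    finally show ?thesis .
  qed
  have weak: "(\<integral>\<^sup>+\<omega>. ?f (X t \<omega> + E \<omega>) * J (qlen t \<omega>) \<partial>M) = (\<integral>\<^sup>+\<omega>. ?f (X t \<omega> + E \<omega>) * J (E \<omega>) \<partial>M)"
    unfolding J_def by (rule qlen_weak[OF _ _ t]) auto
  have cancel: "p \<le> q" if "ennreal ((y - x) * p) \<le> ennreal ((y - x) * q)" "0 \<le> q" for p q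
    using that x by (simp add: ennreal_le_iff)
  show "prob (?T y (qlen t)) \<le> prob (?T x E)"
    by (rule cancel[OF order_trans[OF lower[OF qlen_M[OF t0]] order_trans[OF eq_refl[OF weak] upper[OF E_M]]]]) simp
  show "prob (?T y E) \<le> prob (?T x (qlen t))"
    by (rule cancel[OF order_trans[OF lower[OF E_M] order_trans[OF eq_refl[OF weak[symmetric]] upper[OF qlen_M[OF t0]]]]]) simp
qed

text \<open>The left end \<open>x\<close> is moved up to \<open>y\<close>; tail probabilities are
  continuous from the left in the level.\<close>

lemma qlen_tail:
  assumes t: "0 < t"
  shows "prob {\<omega>\<in>space M. X t \<omega> + E \<omega> \<le> a \<and> y \<le> qlen t \<omega>} = prob {\<omega>\<in>space M. X t \<omega> + E \<omega> \<le> a \<and> y \<le> E \<omega>}"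
proof (cases "0 < y")
  case False
  have "y \<le> qlen t \<omega>" "y \<le> E \<omega>" if "\<omega> \<in> space M" for \<omega>
    using False qlen_nonneg[OF that less_imp_le[OF t]] E_nonneg[OF that] by linarith+
  then have "{\<omega>\<in>space M. X t \<omega> + E \<omega> \<le> a \<and> y \<le> qlen t \<omega>} = {\<omega>\<in>space M. X t \<omega> + E \<omega> \<le> a \<and> y \<le> E \<omega>}"
    by blast
  then show ?thesis by simp
next
  case True
  have t0: "0 \<le> t" using t by simp
  note [measurable] = X_M[OF t0] qlen_M[OF t0]
  let ?T = "\<lambda>y Z. {\<omega>\<in>space M. X t \<omega> + E \<omega> \<le> a \<and> y \<le> Z \<omega>}"
  define x where "x n = y - y * inverse (real (Suc n))" for n
  have x: "0 \<le> x n" "x n < y" for n using True unfolding x_def by (auto simp: field_simps)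
  have xl: "x \<longlonglongrightarrow> y"
    using tendsto_diff[OF tendsto_const tendsto_mult[OF tendsto_const LIMSEQ_inverse_real_of_nat], of y y]
    unfolding x_def by simp
  have lim: "(\<lambda>n. prob (?T (x n) Z)) \<longlonglongrightarrow> prob (?T y Z)"
    if [measurable]: "Z \<in> borel_measurable M" for Z
  proof -
    have "(\<lambda>n. prob (?T (x n) Z)) \<longlonglongrightarrow> prob (\<Inter>n. (?T (x n) Z))"
    proof (rule finite_Lim_measure_decseq)
      have "x n \<le> x (Suc n)" for n
      proof -
        have "inverse (real (Suc (Suc n))) \<le> inverse (real (Suc n))" by (rule le_imp_inverse_le) auto
        then show ?thesis unfolding x_def using True by (intro diff_left_mono mult_left_mono) auto
      qed
      then show "decseq (\<lambda>n. (?T (x n) Z))"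
        by (intro decseq_SucI) (auto intro: order_trans)
    qed auto
    also have "(\<Inter>n. (?T (x n) Z)) = (?T y Z)"
    proof (intro equalityI subsetI)
      fix \<omega> assume "\<omega> \<in> (\<Inter>n. (?T (x n) Z))"
      moreover from this have "y \<le> Z \<omega>" by (intro LIMSEQ_le_const2[OF xl]) auto
      ultimately show "\<omega> \<in> (?T y Z)" by auto
    next
      fix \<omega> assume "\<omega> \<in> (?T y Z)"
      then show "\<omega> \<in> (\<Inter>n. (?T (x n) Z))"
        using less_imp_le[OF x(2)] by (auto intro: order_trans)
    qed
    finally show ?thesis .
  qed
  show ?thesis
  proof (rule antisym)
    show "prob (?T y (qlen t)) \<le> prob (?T y E)"
      by (rule LIMSEQ_le_const[OF lim[OF E_M]]) (use qlen_tail_le(1)[OF t x] in blast)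
    show "prob (?T y E) \<le> prob (?T y (qlen t))"
      by (rule LIMSEQ_le_const[OF lim[OF qlen_M[OF t0]]]) (use qlen_tail_le(2)[OF t x] in blast)
  qed
qed

lemma prob_E: "B \<in> sets borel \<Longrightarrow> prob {\<omega>\<in>space M. E \<omega> \<in> B} = measure (expo c) B"
  unfolding E_distr[symmetric] by (subst measure_distr) (auto simp: vimage_def Int_def conj_commute)

text \<open>Departures are X t + E minus the queue length. Replacing the queue length by
  \<open>E\<close> in its pair with X t + E turns the departures into \<open>X t\<close> itself,
  which is independent of \<open>E\<close>.\<close>

lemma departures_qlen_law:
  assumes t: "0 < t" and A: "A \<in> sets borel" and B: "B \<in> sets borel"
  shows "prob {\<omega>\<in>space M. departures t \<omega> \<in> A \<and> qlen t \<omega> \<in> B} = measure (gauss t) A * measure (expo c) B"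
proof -
  have t0: "0 \<le> t" using t by simp
  note [measurable] = X_M[OF t0] qlen_M[OF t0] departures_M[OF t0]
  let ?BB = "borel \<Otimes>\<^sub>M borel :: (real \<times> real) measure"
  \<comment> \<open>The minus sign turns upper tails into lower orthants.\<close>
  have eq: "distr M ?BB (\<lambda>\<omega>. (X t \<omega> + E \<omega>, - qlen t \<omega>)) = distr M ?BB (\<lambda>\<omega>. (X t \<omega> + E \<omega>, - E \<omega>))"
  proof (rule finite_measure_eqI_atMost)
    have "prob_space (distr M ?BB (\<lambda>\<omega>. (X t \<omega> + E \<omega>, - qlen t \<omega>)))" by (rule prob_space_distr) measurable
    then show "finite_measure (distr M ?BB (\<lambda>\<omega>. (X t \<omega> + E \<omega>, - qlen t \<omega>)))"
      by (rule prob_space.finite_measure)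
    fix v :: "real \<times> real"
    obtain a b where v: "v = (a, b)" by (cases v)
    have at: "{..v} = {..a} \<times> {..b}" unfolding v by (auto simp: less_eq_prod_def)
    have S: "{..a} \<times> {..b} \<in> sets ?BB" by measurable
    have "emeasure (distr M ?BB (\<lambda>\<omega>. (X t \<omega> + E \<omega>, - Z \<omega>))) {..v} = ennreal (prob {\<omega>\<in>space M. X t \<omega> + E \<omega> \<le> a \<and> - b \<le> Z \<omega>})"
      if [measurable]: "Z \<in> borel_measurable M" for Z
    proof -
      have "emeasure (distr M ?BB (\<lambda>\<omega>. (X t \<omega> + E \<omega>, - Z \<omega>))) {..v} = emeasure M ((\<lambda>\<omega>. (X t \<omega> + E \<omega>, - Z \<omega>)) -` ({..a} \<times> {..b}) \<inter> space M)"
        unfolding at by (rule emeasure_distr[OF _ S]) measurable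
      also have "(\<lambda>\<omega>. (X t \<omega> + E \<omega>, - Z \<omega>)) -` ({..a} \<times> {..b}) \<inter> space M = {\<omega>\<in>space M. X t \<omega> + E \<omega> \<le> a \<and> - b \<le> Z \<omega>}"
        by auto
      finally show ?thesis by (simp add: emeasure_eq_measure)
    qed
    from this[OF qlen_M[OF t0]] this[OF E_M] show "emeasure (distr M ?BB (\<lambda>\<omega>. (X t \<omega> + E \<omega>, - qlen t \<omega>))) {..v}
      = emeasure (distr M ?BB (\<lambda>\<omega>. (X t \<omega> + E \<omega>, - E \<omega>))) {..v}"
      by (simp add: qlen_tail[OF t])
  qed (simp_all add: borel_prod)
  let ?T = "\<lambda>z. (fst z + snd z, - snd z) :: real \<times> real"
  let ?Q = "{z\<in>space ?BB. fst z + snd z \<in> A \<and> - snd z \<in> B}"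
  have Q: "?Q \<in> sets ?BB" using A B by measurable
  have "prob {\<omega>\<in>space M. departures t \<omega> \<in> A \<and> qlen t \<omega> \<in> B} = measure (distr M ?BB (\<lambda>\<omega>. (X t \<omega> + E \<omega>, - qlen t \<omega>))) ?Q"
    using Q by (subst measure_distr) (auto simp: qlen_eq space_pair_measure intro!: arg_cong[where f=prob])
  also have "\<dots> = prob {\<omega>\<in>space M. X t \<omega> \<in> A \<and> E \<omega> \<in> B}"
    unfolding eq using Q by (subst measure_distr) (auto simp: space_pair_measure intro!: arg_cong[where f=prob])
  also have "\<dots> = prob ({\<omega>\<in>space M. E \<omega> \<in> B} \<inter> {\<omega>\<in>space M. X t \<omega> - X 0 \<omega> \<in> A} \<inter> {\<omega>\<in>space M. W t \<omega> - W 0 \<omega> \<in> UNIV})"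
    by (rule arg_cong[where f=prob]) (auto simp: X_zero)
  also have "\<dots> = prob {\<omega>\<in>space M. E \<omega> \<in> B} * measure (gauss (t - 0)) A * measure (gauss (t - 0)) UNIV"
  proof (rule increments[OF order_refl t _ A])
    show "{\<omega>\<in>space M. E \<omega> \<in> B} \<in> sets (G 0)"
      using measurable_sets[OF E_G B] by (simp add: space_G vimage_def Int_def conj_commute)
  qed simp
  also have "\<dots> = measure (gauss t) A * measure (expo c) B"
    using prob_space.prob_space[OF prob_space_gauss[OF t]] by (simp add: prob_E[OF B])
  finally show ?thesis .
qed

lemma qlen_zero: "\<omega> \<in> space M \<Longrightarrow> qlen 0 \<omega> = E \<omega>"
  unfolding qlen_eq departures_def using X_zero W_zero E_nonneg by (simp add: dep_zero)

lemma prob_qlen: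
  assumes "0 \<le> t" and B: "B \<in> sets borel"
  shows "prob {\<omega>\<in>space M. qlen t \<omega> \<in> B} = measure (expo c) B"
proof (cases "t = 0")
  case True
  have "{\<omega>\<in>space M. qlen t \<omega> \<in> B} = {\<omega>\<in>space M. E \<omega> \<in> B}" using qlen_zero True by auto
  then show ?thesis by (simp add: prob_E[OF B])
next
  case False
  then have "0 < t" using assms(1) by simp
  then show ?thesis
    using departures_qlen_law[OF _ _ B, of t UNIV] prob_space.prob_space[OF prob_space_gauss[of t]] by simp
qed

text \<open>Conditioning on the past restarts the queue with an independent exponential queue length.\<close>

lemma departures_qlen_step:
  assumes s: "0 \<le> s" and h: "0 < h" and C: "C \<in> sets (G s)"
    and ind: "\<And>B. B \<in> sets borel \<Longrightarrow> prob (C \<inter> {\<omega>\<in>space M. qlen s \<omega> \<in> B}) = prob C * measure (expo c) B"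
    and A: "A \<in> sets borel" and B: "B \<in> sets borel"
  shows "prob (C \<inter> {\<omega>\<in>space M. departures (s + h) \<omega> - departures s \<omega> \<in> A} \<inter> {\<omega>\<in>space M. qlen (s + h) \<omega> \<in> B})
    = prob C * measure (gauss h) A * measure (expo c) B"
proof (cases "prob C = 0")
  case True
  have "C \<in> sets M" using sets_G s C by blast
  then have "prob (C \<inter> {\<omega>\<in>space M. departures (s + h) \<omega> - departures s \<omega> \<in> A} \<inter> {\<omega>\<in>space M. qlen (s + h) \<omega> \<in> B}) \<le> prob C"
    by (intro finite_measure_mono) auto
  then show ?thesis using True by (simp add: measure_le_0_iff)
next
  case False
  have CM [measurable]: "C \<in> sets M" using sets_G s C by blast
  \<comment> \<open>\<open>M\<close> conditioned on \<open>C\<close>. Under it \<open>qlen s\<close>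
    is exponential by \<open>ind\<close>, so the queue restarted at \<open>s\<close> is an instance
    of the same locale.\<close>
  let ?U = "uniform_measure M C"
  let ?X = "\<lambda>u \<omega>. X (s + u) \<omega> - X s \<omega>" and ?W = "\<lambda>u \<omega>. W (s + u) \<omega> - W s \<omega>"
  have C0: "emeasure M C \<noteq> 0" "emeasure M C \<noteq> \<infinity>" using False by (auto simp: emeasure_eq_measure)
  have U: "measure ?U Q = prob (C \<inter> Q) / prob C" if "Q \<in> sets M" for Q
    by (rule measure_uniform_measure[OF C0 that])
  interpret U: prob_space ?U by (rule prob_space_uniform_measure[OF C0])
  note [measurable] = qlen_M[OF s]
  interpret q: bm_queue ?U "\<lambda>u. G (s + u)" ?X ?W "qlen s" c
  proof
    show "0 < c" by (rule c)
    show "subalgebra ?U (G (s + u))" if "0 \<le> u" for u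
      using subalg[of "s + u"] s that by (simp add: subalgebra_def)
    show "sets (G (s + u)) \<subseteq> sets (G (s + v))" if "0 \<le> u" "u \<le> v" for u v
      using s that by (intro mono) auto
    show "?X u \<in> borel_measurable (G (s + u))" "?W u \<in> borel_measurable (G (s + u))" if "0 \<le> u" for u
      using s that by (auto intro!: borel_measurable_diff X_G W_G measurable_G_mono[of s "s + u"])
    show "qlen s \<in> borel_measurable (G (s + 0))" using qlen_G[OF s] by simp
    show "continuous_on {0..} (\<lambda>u. ?X u \<omega>)" "continuous_on {0..} (\<lambda>u. ?W u \<omega>)" if "\<omega> \<in> space ?U" for \<omega>
      using that s X_cont[of \<omega>] W_cont[of \<omega>]
      by (auto intro!: continuous_intros continuous_on_compose2[of "{0..}" _ "{0..}" "\<lambda>u. s + u"])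
    show "0 \<le> qlen s \<omega>" if "\<omega> \<in> space ?U" for \<omega> using that qlen_nonneg s by simp
    show "distr ?U borel (qlen s) = expo c"
    proof (rule measure_eqI)
      fix B assume "B \<in> sets (distr ?U borel (qlen s))"
      then have B: "B \<in> sets borel" by simp
      interpret e: prob_space "expo c" by (rule prob_space_exponential_density[OF c])
      have "emeasure (distr ?U borel (qlen s)) B = emeasure ?U {\<omega>\<in>space M. qlen s \<omega> \<in> B}"
        using B by (subst emeasure_distr) (auto simp: vimage_def Int_def conj_commute)
      also have "\<dots> = ennreal (measure (expo c) B)"
        using ind[OF B] U[of "{\<omega>\<in>space M. qlen s \<omega> \<in> B}"] False B by (simp add: U.emeasure_eq_measure)
      finally show "emeasure (distr ?U borel (qlen s)) B = emeasure (expo c) B"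
        by (simp add: e.emeasure_eq_measure)
    qed simp
    fix u v :: real and D and A B :: "real set" assume uv: "0 \<le> u" "u < v" and D: "D \<in> sets (G (s + u))"
      and A: "A \<in> sets borel" and B: "B \<in> sets borel"
    have CD: "C \<inter> D \<in> sets (G (s + u))" using mono[OF s, of "s + u"] uv C D by auto
    have uv': "0 \<le> s + u" "s + u < s + v" using s uv by auto
    have DM [measurable]: "D \<in> sets M" by (rule sets_G[OF uv'(1) D])
    have [measurable]: "X (s + v) \<in> borel_measurable M" "X (s + u) \<in> borel_measurable M" "X s \<in> borel_measurable M"
      "W (s + v) \<in> borel_measurable M" "W (s + u) \<in> borel_measurable M" "W s \<in> borel_measurable M"
      using s uv by auto
    let ?P = "{\<omega>\<in>space M. X (s + v) \<omega> - X (s + u) \<omega> \<in> A}" and ?Q = "{\<omega>\<in>space M. W (s + v) \<omega> - W (s + u) \<omega> \<in> B}"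
    have PQ: "?P \<in> sets M" "?Q \<in> sets M" using A B by measurable
    have "measure ?U (D \<inter> {\<omega>\<in>space ?U. ?X v \<omega> - ?X u \<omega> \<in> A} \<inter> {\<omega>\<in>space ?U. ?W v \<omega> - ?W u \<omega> \<in> B}) = measure ?U (D \<inter> ?P \<inter> ?Q)"
      by (rule arg_cong[where f="measure ?U"]) auto
    also have "\<dots> = prob (C \<inter> D \<inter> ?P \<inter> ?Q) / prob C"
      using PQ by (subst U) (auto simp: Int_assoc)
    also have "\<dots> = prob (C \<inter> D) * measure (gauss (v - u)) A * measure (gauss (v - u)) B / prob C"
      using increments[OF uv' CD A B] by simp
    also have "\<dots> = measure ?U D * measure (gauss (v - u)) A * measure (gauss (v - u)) B"
      by (simp add: U[OF DM])
    finally show "measure ?U (D \<inter> {\<omega>\<in>space ?U. ?X v \<omega> - ?X u \<omega> \<in> A} \<inter> {\<omega>\<in>space ?U. ?W v \<omega> - ?W u \<omega> \<in> B})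
      = measure ?U D * measure (gauss (v - u)) A * measure (gauss (v - u)) B" .
  qed auto
  have h0: "0 \<le> h" "0 \<le> s + h" using h s by auto
  note [measurable] = departures_M[OF h0(2)] departures_M[OF s] qlen_M[OF h0(2)]
  have dep: "q.departures h \<omega> = departures (s + h) \<omega> - departures s \<omega>" "q.qlen h \<omega> = qlen (s + h) \<omega>" if "\<omega> \<in> space M" for \<omega>
    using dep_flow[OF X_cont[OF that] W_cont[OF that] s h0(1)] queue_len_flow[OF X_cont[OF that] W_cont[OF that] s h0(1)]
    unfolding q.departures_def q.qlen_def departures_def qlen_def by simp_all
  let ?P = "{\<omega>\<in>space M. departures (s + h) \<omega> - departures s \<omega> \<in> A}" and ?Q = "{\<omega>\<in>space M. qlen (s + h) \<omega> \<in> B}"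
  have PQ: "?P \<in> sets M" "?Q \<in> sets M" using A B by measurable
  have "measure ?U {\<omega>\<in>space ?U. q.departures h \<omega> \<in> A \<and> q.qlen h \<omega> \<in> B} = measure ?U (?P \<inter> ?Q)"
    by (rule arg_cong[where f="measure ?U"]) (auto simp: dep)
  then have "prob (C \<inter> (?P \<inter> ?Q)) / prob C = measure (gauss h) A * measure (expo c) B"
    using q.departures_qlen_law[OF h A B] U[of "?P \<inter> ?Q"] PQ by simp
  then show ?thesis using False by (simp add: field_simps Int_assoc)
qed

text \<open>The induction has to carry the current queue length: its independence of the earlier
  departures is the hypothesis \<open>ind\<close> of \<open>departures_qlen_step\<close> at the next
  time.\<close>

lemma departures_increments_qlen:
  assumes ts: "0 \<le> ts 0" "\<And>i. i < k \<Longrightarrow> ts i < ts (Suc i)" and A: "\<And>i. i < k \<Longrightarrow> A i \<in> sets borel" and B: "B \<in> sets borel"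
  shows "{\<omega>\<in>space M. \<forall>i<k. departures (ts (Suc i)) \<omega> - departures (ts i) \<omega> \<in> A i} \<in> sets (G (ts k)) \<and> 0 \<le> ts k \<and>
    prob ({\<omega>\<in>space M. \<forall>i<k. departures (ts (Suc i)) \<omega> - departures (ts i) \<omega> \<in> A i} \<inter> {\<omega>\<in>space M. qlen (ts k) \<omega> \<in> B})
    = (\<Prod>i<k. measure (gauss (ts (Suc i) - ts i)) (A i)) * measure (expo c) B"
  using ts(2) A B
proof (induction k arbitrary: B)
  case 0
  have "{\<omega> \<in> space M. True} \<in> sets (G (ts 0))" using space_G[OF ts(1)] sets.top[of "G (ts 0)"] by simp
  moreover have "space M \<inter> {\<omega>\<in>space M. qlen (ts 0) \<omega> \<in> B} = {\<omega>\<in>space M. qlen (ts 0) \<omega> \<in> B}" by auto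
  ultimately show ?case using ts(1) prob_qlen[OF ts(1) 0(3)] by simp
next
  case (Suc k)
  let ?C = "{\<omega>\<in>space M. \<forall>i<k. departures (ts (Suc i)) \<omega> - departures (ts i) \<omega> \<in> A i}"
  let ?P = "{\<omega>\<in>space M. departures (ts (Suc k)) \<omega> - departures (ts k) \<omega> \<in> A k}"
  have IH: "?C \<in> sets (G (ts k))" "0 \<le> ts k"
    "prob (?C \<inter> {\<omega>\<in>space M. qlen (ts k) \<omega> \<in> B}) = (\<Prod>i<k. measure (gauss (ts (Suc i) - ts i)) (A i)) * measure (expo c) B"
    if "B \<in> sets borel" for B
    using Suc.IH[OF Suc.prems(1)[OF less_SucI] Suc.prems(2)[OF less_SucI] that] by blast+
  \<comment> \<open>These two facts do not involve \<open>B\<close>; the empty set discharges its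
    premise.\<close>
  note C = IH(1)[OF sets.empty_sets] and k0 = IH(2)[OF sets.empty_sets]
  have lt: "ts k < ts (Suc k)" by (rule Suc.prems(1)[OF lessI])
  have Ak: "A k \<in> sets borel" by (rule Suc.prems(2)[OF lessI])
  interpret e: prob_space "expo c" by (rule prob_space_exponential_density[OF c])
  have U: "UNIV \<in> sets (borel :: real measure)" by simp
  have e1: "measure (expo c) UNIV = 1" using e.prob_space by simp
  have eqU: "?C \<inter> {\<omega>\<in>space M. qlen (ts k) \<omega> \<in> UNIV} = ?C"
    by (rule Int_absorb2) (rule subsetI, simp)
  have pC: "prob ?C = (\<Prod>i<k. measure (gauss (ts (Suc i) - ts i)) (A i))"
    using IH(3)[OF U] unfolding eqU e1 mult_1_right .
  have eq: "{\<omega>\<in>space M. \<forall>i<Suc k. departures (ts (Suc i)) \<omega> - departures (ts i) \<omega> \<in> A i} = ?C \<inter> ?P"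
    unfolding less_Suc_eq by blast
  have s0: "0 \<le> ts (Suc k)" using k0 lt by simp
  have le: "ts k \<le> ts (Suc k)" using lt by simp
  have "?P \<in> sets (G (ts (Suc k)))"
  proof -
    have m: "(\<lambda>\<omega>. departures (ts (Suc k)) \<omega> - departures (ts k) \<omega>) \<in> borel_measurable (G (ts (Suc k)))"
      using departures_G[OF s0] measurable_G_mono[OF k0 le departures_G[OF k0]] by (rule borel_measurable_diff)
    show ?thesis using measurable_sets[OF m Ak] by (simp add: space_G[OF s0] vimage_def Int_def conj_commute)
  qed
  then have CP: "?C \<inter> ?P \<in> sets (G (ts (Suc k)))" using C mono[OF k0 le] by blast
  have ind: "prob (?C \<inter> {\<omega>\<in>space M. qlen (ts k) \<omega> \<in> B}) = prob ?C * measure (expo c) B" if "B \<in> sets borel" for B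
    unfolding pC by (rule IH(3)[OF that])
  have h: "0 < ts (Suc k) - ts k" "ts k + (ts (Suc k) - ts k) = ts (Suc k)" using lt by simp_all
  have step: "prob (?C \<inter> ?P \<inter> {\<omega>\<in>space M. qlen (ts (Suc k)) \<omega> \<in> B})
    = prob ?C * measure (gauss (ts (Suc k) - ts k)) (A k) * measure (expo c) B"
    using departures_qlen_step[OF k0 h(1) C ind Ak Suc.prems(3)] unfolding h(2) .
  show ?case
    unfolding eq step pC prod.lessThan_Suc using CP s0 by blast
qed

theorem std_BM_departures: "std_BM M departures"
proof -
  interpret e: prob_space "expo c" by (rule prob_space_exponential_density[OF c])
  have m: "departures t \<in> borel_measurable M" if "0 \<le> t" for t using that by (rule departures_M)
  have inc: "prob {\<omega>\<in>space M. \<forall>i<k. departures (ts (Suc i)) \<omega> - departures (ts i) \<omega> \<in> A i}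
    = (\<Prod>i<k. measure (gauss (ts (Suc i) - ts i)) (A i))"
    if ts: "0 \<le> ts 0" "\<And>i. i < k \<Longrightarrow> ts i < ts (Suc i)" and A: "\<And>i. i < k \<Longrightarrow> A i \<in> sets borel" for ts :: "nat \<Rightarrow> real" and k A
  proof -
    let ?C = "{\<omega>\<in>space M. \<forall>i<k. departures (ts (Suc i)) \<omega> - departures (ts i) \<omega> \<in> A i}"
    have U: "UNIV \<in> sets (borel :: real measure)" by simp
    have e1: "measure (expo c) UNIV = 1" using e.prob_space by simp
    have eq: "?C \<inter> {\<omega>\<in>space M. qlen (ts k) \<omega> \<in> UNIV}
      = ?C"
      by (rule Int_absorb2) (rule subsetI, simp)
    show ?thesis
      using departures_increments_qlen[where ts=ts and k=k and A=A, OF ts A U, THEN conjunct2, THEN conjunct2]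
      unfolding eq e1 mult_1_right .
  qed
  have law: "prob {\<omega>\<in>space M. departures t \<omega> - departures s \<omega> \<in> A} = measure (gauss (t - s)) A"
    if "0 \<le> s" "s < t" "A \<in> sets borel" for s t A
  proof -
    \<comment> \<open>A single increment is the case of two times.\<close>
    let ?ts = "\<lambda>i::nat. if i = 0 then s else t"
    have "prob {\<omega>\<in>space M. \<forall>i<1. departures (?ts (Suc i)) \<omega> - departures (?ts i) \<omega> \<in> A}
      = (\<Prod>i<1. measure (gauss (?ts (Suc i) - ?ts i)) A)"
      by (rule inc) (use that in auto)
    then show ?thesis by simp
  qed
  show ?thesis
    unfolding std_BM_def
  proof (intro conjI allI impI)
    show "departures t \<in> borel_measurable M" if "0 \<le> t" for t by (rule m[OF that])
    show "AE \<omega> in M. departures 0 \<omega> = 0"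
      unfolding departures_def using X_zero W_zero E_nonneg by (intro AE_I2) (simp add: dep_zero)
    show "AE \<omega> in M. continuous_on {0..} (\<lambda>t. departures t \<omega>)"
      unfolding departures_def by (intro AE_I2 continuous_on_dep X_cont W_cont)
  next
    fix s t :: real assume st: "0 \<le> s \<and> s < t"
    interpret g: prob_space "gauss (t - s)" using st by (intro prob_space_gauss) simp
    have [measurable]: "departures s \<in> borel_measurable M" "departures t \<in> borel_measurable M" using st by (auto intro: m)
    have "distr M lborel (\<lambda>\<omega>. departures t \<omega> - departures s \<omega>) = gauss (t - s)"
    proof (rule measure_eqI)
      fix A assume "A \<in> sets (distr M lborel (\<lambda>\<omega>. departures t \<omega> - departures s \<omega>))"
      then have A: "A \<in> sets borel" by simp
      have "emeasure (distr M lborel (\<lambda>\<omega>. departures t \<omega> - departures s \<omega>)) A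
        = ennreal (prob {\<omega>\<in>space M. departures t \<omega> - departures s \<omega> \<in> A})"
        using A by (subst emeasure_distr) (auto simp: emeasure_eq_measure vimage_def Int_def conj_commute)
      then show "emeasure (distr M lborel (\<lambda>\<omega>. departures t \<omega> - departures s \<omega>)) A = emeasure (gauss (t - s)) A"
        using st A by (simp add: law g.emeasure_eq_measure)
    qed simp
    then show "distributed M lborel (\<lambda>\<omega>. departures t \<omega> - departures s \<omega>) (normal_density 0 (sqrt (t - s)))"
      unfolding distributed_def by simp
  next
    fix ts :: "nat \<Rightarrow> real" and k :: nat assume "0 \<le> ts 0 \<and> (\<forall>i<k. ts i < ts (Suc i))"
    then have ts0: "0 \<le> ts 0" and ts: "\<And>i. i < k \<Longrightarrow> ts i < ts (Suc i)" by auto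
    have pos: "0 \<le> ts i" if "i \<le> k" for i
      using that
    proof (induction i)
      case (Suc i)
      then show ?case using ts[of i] by simp
    qed (simp add: ts0)
    let ?D = "\<lambda>i \<omega>. departures (ts (Suc i)) \<omega> - departures (ts i) \<omega>"
    have Dm: "?D i \<in> borel_measurable M" if "i < k" for i
      using that by (intro borel_measurable_diff m pos) auto
    show "indep_vars (\<lambda>_. borel) ?D {..<k}"
    \<comment> \<open>\<open>indep_sets_finite\<close> asks for a nonempty index set.\<close>
    proof (cases "k = 0")
      case True
      then show ?thesis unfolding indep_vars_def2 by (auto simp: indep_sets_def)
    next
      case False
      have "indep_sets (\<lambda>i. {?D i -` A \<inter> space M | A. A \<in> sets borel}) {..<k}"
      proof (subst indep_sets_finite)
        show "{..<k} \<noteq> {}" "finite {..<k}" using False by auto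
        show "{?D i -` A \<inter> space M | A. A \<in> sets borel} \<subseteq> events" if "i \<in> {..<k}" for i
          using Dm that by (auto intro: measurable_sets)
        show "space M \<in> {?D i -` A \<inter> space M | A. A \<in> sets borel}" for i
          by (auto intro!: exI[of _ UNIV])
        show "\<forall>Q\<in>Pi {..<k} (\<lambda>i. {?D i -` A \<inter> space M | A. A \<in> sets borel}). prob (\<Inter>j\<in>{..<k}. Q j) = (\<Prod>j\<in>{..<k}. prob (Q j))"
        proof
          fix Q assume "Q \<in> Pi {..<k} (\<lambda>i. {?D i -` A \<inter> space M | A. A \<in> sets borel})"
          then have "\<forall>i\<in>{..<k}. \<exists>A. A \<in> sets borel \<and> Q i = ?D i -` A \<inter> space M" by (auto simp: Pi_def)
          then obtain A where A: "\<And>i. i < k \<Longrightarrow> A i \<in> sets borel" "\<And>i. i < k \<Longrightarrow> Q i = ?D i -` A i \<inter> space M"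
            by (metis lessThan_iff)
          have "(\<Inter>j\<in>{..<k}. Q j) = {\<omega>\<in>space M. \<forall>i<k. ?D i \<omega> \<in> A i}"
            using A(2) False by auto
          moreover have "prob (Q i) = measure (gauss (ts (Suc i) - ts i)) (A i)" if "i < k" for i
          proof -
            have "Q i = {\<omega>\<in>space M. ?D i \<omega> \<in> A i}" using A(2)[OF that] by auto
            then show ?thesis using law[OF pos ts[OF that] A(1)[OF that]] that by simp
          qed
          ultimately show "prob (\<Inter>j\<in>{..<k}. Q j) = (\<Prod>j\<in>{..<k}. prob (Q j))"
            using inc[OF ts0 ts A(1)] by simp
        qed
      qed
      then show ?thesis unfolding indep_vars_def2 using Dm by auto
    qed
  qed
qed

end

section \<open>Independence of Brownian increments from the past\<close>

lemma (in prob_space) prob_Int_sigma_sets: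
  assumes Q: "Int_stable Q" "Q \<subseteq> events" and D: "D \<in> events"
    and eq: "\<And>A. A \<in> Q \<Longrightarrow> prob (A \<inter> D) = prob A * prob D"
    and A: "A \<in> sigma_sets (space M) Q"
  shows "prob (A \<inter> D) = prob A * prob D"
proof -
  have Pow: "Q \<subseteq> Pow (space M)" using Q(2) sets.sets_into_space by auto
  have ev: "sigma_sets (space M) Q \<subseteq> events" using Q(2) by (rule sets.sigma_sets_subset)
  show ?thesis
    using Q(1) Pow A
  proof (induction rule: sigma_sets_induct_disjoint)
    case (basic A)
    then show ?case by (rule eq)
  next
    case empty
    then show ?case by simp
  next
    case (compl A)
    then have A: "A \<in> events" using ev by auto
    have "(space M - A) \<inter> D = D - A \<inter> D" using sets.sets_into_space[OF D] by auto
    then have "prob ((space M - A) \<inter> D) = prob D - prob (A \<inter> D)"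
      using A D by (simp add: finite_measure_Diff)
    then show ?case using compl(2) A by (simp add: prob_compl algebra_simps)
  next
    case (union A)
    then have A: "\<And>i. A i \<in> events" using ev by auto
    have "(\<lambda>i. prob (A i \<inter> D)) sums prob (\<Union>i. A i \<inter> D)"
      using A D union(1) by (intro finite_measure_UNION) (auto simp: disjoint_family_on_def)
    moreover have "(\<lambda>i. prob (A i) * prob D) sums (prob (\<Union>i. A i) * prob D)"
      using A union(1) by (intro sums_mult2 finite_measure_UNION) auto
    ultimately have "prob (\<Union>i. A i \<inter> D) = prob (\<Union>i. A i) * prob D"
      unfolding union(3) by (rule sums_unique2)
    then show ?case by simp
  qed
qed

text \<open>The time set is a parameter: intervals {0..s} give the filtration, finite sets of times
  an intersection-stable generator of it.\<close>

definition past :: "'a measure \<Rightarrow> (real \<Rightarrow> 'a \<Rightarrow> real) \<Rightarrow> real set \<Rightarrow> 'a set set" where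
  "past M X T = sigma_sets (space M) (\<Union>u\<in>T. {X u -` A \<inter> space M | A. A \<in> sets borel})"

lemma past_mono: "S \<subseteq> T \<Longrightarrow> past M X S \<subseteq> past M X T"
  unfolding past_def by (rule sigma_sets_mono') auto

lemma proc_sigma_eq_past: "proc_sigma M X = past M X {0..}"
  unfolding proc_sigma_def past_def ..

lemma in_past: "u \<in> T \<Longrightarrow> A \<in> sets borel \<Longrightarrow> X u -` A \<inter> space M \<in> past M X T"
  unfolding past_def by (rule sigma_sets.Basic) auto

lemma past_subset:
  assumes "\<And>u. u \<in> T \<Longrightarrow> X u \<in> borel_measurable H" "space H = space M"
  shows "past M X T \<subseteq> sets H"
  unfolding past_def assms(2)[symmetric] by (rule sets.sigma_sets_subset) (auto intro: measurable_sets[OF assms(1)])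

lemma past_Int: "A \<in> past M X T \<Longrightarrow> B \<in> past M X T \<Longrightarrow> A \<inter> B \<in> past M X T"
proof -
  have "sigma_algebra (space M) (past M X T)" unfolding past_def by (rule sigma_algebra_sigma_sets) auto
  then interpret sigma_algebra "space M" "past M X T" .
  show "A \<in> past M X T \<Longrightarrow> B \<in> past M X T \<Longrightarrow> A \<inter> B \<in> past M X T" by blast
qed

lemma space_in_past: "space M \<in> past M X T"
  unfolding past_def by (rule sigma_sets_top)

lemma past_finite_times:
  "past M X T \<subseteq> sigma_sets (space M) (\<Union>J\<in>{J. finite J \<and> J \<subseteq> T}. past M X J)"
  unfolding past_def[of M X T]
proof (rule sigma_sets_mono, safe)
  fix u and A :: "real set" assume "u \<in> T" "A \<in> sets borel"
  then have "X u -` A \<inter> space M \<in> past M X {u}" by (intro in_past) auto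
  then show "X u -` A \<inter> space M \<in> sigma_sets (space M) (\<Union>J\<in>{J. finite J \<and> J \<subseteq> T}. past M X J)"
    using \<open>u \<in> T\<close> by (intro sigma_sets.Basic) blast
qed

text \<open>The values of \<open>X\<close> on \<open>J\<close> are partial sums of increments
  between consecutive times, and the increment from \<open>s\<close> to \<open>t\<close> is
  independent of these by \<open>std_BM\<close>.\<close>

lemma std_BM_past_finite:
  assumes M: "prob_space M" and BM: "std_BM M X" and zero: "\<And>\<omega>. \<omega> \<in> space M \<Longrightarrow> X 0 \<omega> = 0"
    and s: "0 \<le> s" "s < t" and J: "finite J" "J \<subseteq> {0..s}" and A: "A \<in> past M X J" and P: "P \<in> sets borel"
  shows "measure M (A \<inter> {\<omega>\<in>space M. X t \<omega> - X s \<omega> \<in> P}) = measure M A * measure M {\<omega>\<in>space M. X t \<omega> - X s \<omega> \<in> P}"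
proof -
  interpret prob_space M by fact
  \<comment> \<open>The time 0 starts the telescoping sums, as X 0 = 0; \<open>s\<close> makes the
    last increment start exactly at \<open>s\<close>.\<close>
  define S where "S = insert 0 (insert s J)"
  define xs where "xs = sorted_list_of_set S"
  define k where "k = length xs - 1"
  define ts where "ts i = (xs @ [t]) ! i" for i
  have fS: "finite S" unfolding S_def using J by simp
  have set: "set xs = S" and srt: "sorted_wrt (<) xs" unfolding xs_def using fS by simp_all
  have len: "length xs = Suc k" using set unfolding k_def S_def by (cases xs) auto
  have bnd: "0 \<le> u \<and> u \<le> s" if "u \<in> S" for u using that J s unfolding S_def by auto
  have tsx: "ts i = xs ! i" if "i \<le> k" for i using that len unfolding ts_def by (simp add: nth_append)
  have tst: "ts (Suc k) = t" using len unfolding ts_def by (simp add: nth_append)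
  have tsS: "ts i \<in> S" if "i \<le> k" for i using tsx[OF that] that len set nth_mem[of i xs] by auto
  have lt: "ts i < ts j" if "i < j" "j \<le> k" for i j
    using sorted_wrt_nth_less[OF srt that(1)] that tsx len by auto
  have mono: "ts i \<le> ts j" if "i \<le> j" "j \<le> k" for i j
    using lt[of i j] that by (cases "i = j") auto
  have idx: "\<exists>i\<le>k. u = ts i" if "u \<in> S" for u
    using that set len tsx by (metis in_set_conv_nth less_Suc_eq_le)
  have ts0: "ts 0 = 0"
  proof -
    obtain i where "i \<le> k" "0 = ts i" using idx[of 0] unfolding S_def by auto
    then show ?thesis using mono[of 0 i] bnd[OF tsS[of 0]] by simp
  qed
  have tsk: "ts k = s"
  proof -
    obtain i where "i \<le> k" "s = ts i" using idx[of s] unfolding S_def by auto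
    then show ?thesis using mono[of i k] bnd[OF tsS[of k]] by simp
  qed
  have step: "ts i < ts (Suc i)" if "i < Suc k" for i
    using that lt[of i "Suc i"] tsk tst s by (cases "i = k") auto
  let ?D = "\<lambda>i \<omega>. X (ts (Suc i)) \<omega> - X (ts i) \<omega>"
  have "\<forall>(ts :: nat \<Rightarrow> real) k. 0 \<le> ts 0 \<and> (\<forall>i<k. ts i < ts (Suc i)) \<longrightarrow>
      indep_vars (\<lambda>_. borel) (\<lambda>i \<omega>. X (ts (Suc i)) \<omega> - X (ts i) \<omega>) {..<k}"
    using BM unfolding std_BM_def by blast
  then have ind: "indep_vars (\<lambda>_. borel) ?D {..<Suc k}" using ts0 step by simp
  let ?Z = "\<lambda>\<omega>. restrict (\<lambda>i. ?D i \<omega>) {..<k}" and ?L = "\<lambda>\<omega>. restrict (\<lambda>i. ?D i \<omega>) {k}"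
  let ?PZ = "PiM {..<k} (\<lambda>_. borel :: real measure)" and ?PL = "PiM {k} (\<lambda>_. borel :: real measure)"
  have iv: "indep_var ?PZ ?Z ?PL ?L"
    by (rule indep_var_restrict[OF ind]) auto
  \<comment> \<open>The sigma-algebra generated by the first \<open>k\<close> increments, that is,
    by those up to \<open>s\<close>.\<close>
  let ?H = "vimage_algebra (space M) ?Z ?PZ"
  have sp: "?Z \<in> space M \<rightarrow> space ?PZ" by (auto simp: space_PiM)
  have Zm: "?Z \<in> measurable ?H ?PZ" by (rule measurable_vimage_algebra1[OF sp])
  have Dm: "?D i \<in> borel_measurable ?H" if "i < k" for i
    using measurable_compose[OF Zm measurable_component_singleton[of i]] that by simp
  have Xts: "X (ts i) \<in> borel_measurable ?H" if "i \<le> k" for i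
  proof -
    have "(\<lambda>\<omega>. \<Sum>j<i. ?D j \<omega>) \<in> borel_measurable ?H"
      using that by (intro borel_measurable_sum Dm) auto
    moreover have "X (ts i) \<omega> = (\<Sum>j<i. ?D j \<omega>)" if "\<omega> \<in> space ?H" for \<omega>
      using zero that ts0 by (subst sum_lessThan_telescope) simp
    ultimately show ?thesis using measurable_cong[of ?H "X (ts i)" "\<lambda>\<omega>. \<Sum>j<i. ?D j \<omega>"] by blast
  qed
  have "past M X J \<subseteq> sets ?H"
  proof (rule past_subset)
    fix u assume "u \<in> J"
    then obtain i where "i \<le> k" "u = ts i" using idx[of u] unfolding S_def by auto
    then show "X u \<in> borel_measurable ?H" using Xts by simp
  qed simp
  then have "A \<in> sets ?H" using A by blast
  then obtain Q where Q: "Q \<in> sets ?PZ" "A = ?Z -` Q \<inter> space M"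
    unfolding sets_vimage_algebra2[OF sp] by blast
  let ?V = "{v\<in>space ?PL. v k \<in> P}"
  have V: "?V \<in> sets ?PL" using P by measurable
  have LV: "?L -` ?V \<inter> space M = {\<omega>\<in>space M. X t \<omega> - X s \<omega> \<in> P}"
    by (auto simp: space_PiM tst tsk)
  have "A \<inter> {\<omega>\<in>space M. X t \<omega> - X s \<omega> \<in> P} = (\<lambda>\<omega>. (?Z \<omega>, ?L \<omega>)) -` (Q \<times> ?V) \<inter> space M"
    unfolding Q(2) LV[symmetric] by auto
  then show ?thesis
    using indep_varD[OF iv Q(1) V] unfolding Q(2)[symmetric] LV by simp
qed

lemma std_BM_past:
  assumes M: "prob_space M" and BM: "std_BM M X" and zero: "\<And>\<omega>. \<omega> \<in> space M \<Longrightarrow> X 0 \<omega> = 0"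
    and s: "0 \<le> s" "s < t" and A: "A \<in> past M X {0..s}" and P: "P \<in> sets borel"
  shows "measure M (A \<inter> {\<omega>\<in>space M. X t \<omega> - X s \<omega> \<in> P}) = measure M A * measure (gauss (t - s)) P"
proof -
  interpret prob_space M by fact
  let ?Q = "\<Union>J\<in>{J. finite J \<and> J \<subseteq> {0..s}}. past M X J"
  have m: "X u \<in> borel_measurable M" if "0 \<le> u" for u by (rule std_BM_measurable[OF BM that])
  have D: "{\<omega>\<in>space M. X t \<omega> - X s \<omega> \<in> P} = (\<lambda>\<omega>. X t \<omega> - X s \<omega>) -` P \<inter> space M" by auto
  have dm: "(\<lambda>\<omega>. X t \<omega> - X s \<omega>) \<in> borel_measurable M" using s by (intro borel_measurable_diff m) auto
  have Dev: "{\<omega>\<in>space M. X t \<omega> - X s \<omega> \<in> P} \<in> events" unfolding D by (rule measurable_sets[OF dm P])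
  have "measure M (A \<inter> {\<omega>\<in>space M. X t \<omega> - X s \<omega> \<in> P}) = measure M A * measure M {\<omega>\<in>space M. X t \<omega> - X s \<omega> \<in> P}"
  proof (rule prob_Int_sigma_sets[of ?Q])
    show "Int_stable ?Q"
    proof (rule Int_stableI)
      fix A B assume "A \<in> ?Q" "B \<in> ?Q"
      then obtain J K where JK: "finite J" "J \<subseteq> {0..s}" "A \<in> past M X J" "finite K" "K \<subseteq> {0..s}" "B \<in> past M X K" by blast
      then have "A \<inter> B \<in> past M X (J \<union> K)"
        using past_mono[of J "J \<union> K" M X] past_mono[of K "J \<union> K" M X] by (intro past_Int) auto
      then show "A \<inter> B \<in> ?Q" using JK by blast
    qed
    show "?Q \<subseteq> events"
    proof (rule UN_least)
      fix J assume "J \<in> {J. finite J \<and> J \<subseteq> {0..s}}"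
      then show "past M X J \<subseteq> events" by (intro past_subset m) auto
    qed
    show "A \<in> sigma_sets (space M) ?Q" using past_finite_times A by blast
    show "prob (A \<inter> {\<omega>\<in>space M. X t \<omega> - X s \<omega> \<in> P}) = prob A * prob {\<omega>\<in>space M. X t \<omega> - X s \<omega> \<in> P}"
      if "A \<in> ?Q" for A
      using that by (auto intro: std_BM_past_finite[OF M BM zero s _ _ _ P])
  qed (rule Dev)
  also have "measure M {\<omega>\<in>space M. X t \<omega> - X s \<omega> \<in> P} = measure (gauss (t - s)) P"
    unfolding std_BM_increment_distr[OF BM s, symmetric] D by (rule measure_distr[OF dm P, symmetric])
  finally show ?thesis .
qed

text \<open>What remains is a filtration. \<open>G s\<close> is generated by the two pasts and by
  \<open>E\<close>, the latter already at time 0; on the intersection-stable generator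
  \<open>Q s\<close> the probability factorises by independence, and a pi-lambda argument does the
  rest.\<close>

theorem burke:
  assumes M: "prob_space M" and X: "std_BM M X" "\<And>\<omega>. \<omega> \<in> space M \<Longrightarrow> X 0 \<omega> = 0"
      "\<And>\<omega>. \<omega> \<in> space M \<Longrightarrow> continuous_on {0..} (\<lambda>s. X s \<omega>)"
    and W: "std_BM M W" "\<And>\<omega>. \<omega> \<in> space M \<Longrightarrow> W 0 \<omega> = 0"
      "\<And>\<omega>. \<omega> \<in> space M \<Longrightarrow> continuous_on {0..} (\<lambda>s. W s \<omega>)"
    and E: "E \<in> borel_measurable M" "\<And>\<omega>. \<omega> \<in> space M \<Longrightarrow> 0 \<le> E \<omega>" "distr M borel E = expo c" and c: "0 < c"
    and indep: "\<And>A B C. A \<in> proc_sigma M X \<Longrightarrow> B \<in> proc_sigma M W \<Longrightarrow> C \<in> rv_sigma M E \<Longrightarrow>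
      measure M (A \<inter> B \<inter> C) = measure M A * measure M B * measure M C"
  shows "std_BM M (\<lambda>t \<omega>. dep c (\<lambda>s. X s \<omega>) (\<lambda>s. W s \<omega>) (E \<omega>) t)"
proof -
  interpret prob_space M by fact
  define Q where "Q s = {A \<inter> B \<inter> C | A B C. A \<in> past M X {0..s} \<and> B \<in> past M W {0..s} \<and> C \<in> rv_sigma M E}" for s
  define G where "G s = sigma (space M) (Q s)" for s
  have Xm: "X u \<in> borel_measurable M" and Wm: "W u \<in> borel_measurable M" if "0 \<le> u" for u
    using that by (auto intro: std_BM_measurable[OF X(1)] std_BM_measurable[OF W(1)])
  have Xp: "past M X {0..s} \<subseteq> events" and Wp: "past M W {0..s} \<subseteq> events" for s
    by (rule past_subset; auto intro: Xm Wm)+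
  have Ep: "rv_sigma M E \<subseteq> events"
    unfolding rv_sigma_def by (rule sets.sigma_sets_subset) (use E(1) in \<open>auto intro: measurable_sets\<close>)
  have Esp: "space M \<in> rv_sigma M E" unfolding rv_sigma_def by (rule sigma_sets_top)
  have Qev: "Q s \<subseteq> events" for s unfolding Q_def using Xp Wp Ep by blast
  then have QPow: "Q s \<subseteq> Pow (space M)" for s using sets.sets_into_space by blast
  have spG: "space (G s) = space M" for s unfolding G_def by (rule space_measure_of[OF QPow])
  have stG: "sets (G s) = sigma_sets (space M) (Q s)" for s unfolding G_def by (rule sets_measure_of[OF QPow])
  have pX: "past M X {0..s} \<subseteq> proc_sigma M X" and pW: "past M W {0..s} \<subseteq> proc_sigma M W" for s
    unfolding proc_sigma_eq_past by (rule past_mono; simp)+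
  have Q_I: "A \<inter> B \<inter> C \<in> Q s" if "A \<in> past M X {0..s}" "B \<in> past M W {0..s}" "C \<in> rv_sigma M E" for A B C s
    unfolding Q_def using that by blast
  have inX: "A \<in> sets (G s)" if "A \<in> past M X {0..s}" for A s
  proof -
    have "A \<inter> space M \<inter> space M = A" using sets.sets_into_space[OF subsetD[OF Xp that]] by blast
    then have "A \<in> Q s" using Q_I[OF that space_in_past Esp] by simp
    then show ?thesis unfolding stG by (rule sigma_sets.Basic)
  qed
  have inW: "B \<in> sets (G s)" if "B \<in> past M W {0..s}" for B s
  proof -
    have "space M \<inter> B \<inter> space M = B" using sets.sets_into_space[OF subsetD[OF Wp that]] by blast
    then have "B \<in> Q s" using Q_I[OF space_in_past that Esp] by simp
    then show ?thesis unfolding stG by (rule sigma_sets.Basic)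
  qed
  have inE: "C \<in> sets (G s)" if "C \<in> rv_sigma M E" for C s
  proof -
    have "space M \<inter> space M \<inter> C = C" using sets.sets_into_space[OF subsetD[OF Ep that]] by blast
    then have "C \<in> Q s" using Q_I[OF space_in_past space_in_past that, of s] by simp
    then show ?thesis unfolding stG by (rule sigma_sets.Basic)
  qed
  interpret q: bm_queue M G X W E c
  proof
    show "subalgebra M (G s)" for s
      unfolding subalgebra_def spG stG using sets.sigma_sets_subset[OF Qev] by blast
    show "sets (G s) \<subseteq> sets (G t)" if "0 \<le> s" "s \<le> t" for s t
    proof -
      have sub: "past M Y {0..s} \<subseteq> past M Y {0..t}" for Y by (rule past_mono) (use that in auto)
      have "Q s \<subseteq> Q t"
      proof
        fix D assume "D \<in> Q s"
        then obtain A B C where D: "D = A \<inter> B \<inter> C" "A \<in> past M X {0..s}" "B \<in> past M W {0..s}" "C \<in> rv_sigma M E"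
          unfolding Q_def by blast
        show "D \<in> Q t" unfolding D(1) by (rule Q_I[OF subsetD[OF sub D(2)] subsetD[OF sub D(3)] D(4)])
      qed
      then show ?thesis unfolding stG by (rule sigma_sets_mono')
    qed
    show "X s \<in> borel_measurable (G s)" if "0 \<le> s" for s
    proof (rule measurableI)
      fix A :: "real set" assume "A \<in> sets borel"
      then have "X s -` A \<inter> space M \<in> past M X {0..s}" using that by (intro in_past) auto
      then show "X s -` A \<inter> space (G s) \<in> sets (G s)" unfolding spG by (rule inX)
    qed simp
    show "W s \<in> borel_measurable (G s)" if "0 \<le> s" for s
    proof (rule measurableI)
      fix A :: "real set" assume "A \<in> sets borel"
      then have "W s -` A \<inter> space M \<in> past M W {0..s}" using that by (intro in_past) auto
      then show "W s -` A \<inter> space (G s) \<in> sets (G s)" unfolding spG by (rule inW)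
    qed simp
    show "E \<in> borel_measurable (G 0)"
    proof (rule measurableI)
      fix C :: "real set" assume "C \<in> sets borel"
      then have "E -` C \<inter> space M \<in> rv_sigma M E" unfolding rv_sigma_def by (intro sigma_sets.Basic) auto
      then show "E -` C \<inter> space (G 0) \<in> sets (G 0)" unfolding spG by (rule inE)
    qed simp
    fix s t :: real and D and P R :: "real set"
    assume s: "0 \<le> s" "s < t" and D: "D \<in> sets (G s)" and P: "P \<in> sets borel" and R: "R \<in> sets borel"
    let ?DX = "{\<omega>\<in>space M. X t \<omega> - X s \<omega> \<in> P}" and ?DW = "{\<omega>\<in>space M. W t \<omega> - W s \<omega> \<in> R}"
    have diffm: "{\<omega>\<in>space M. Y t \<omega> - Y s \<omega> \<in> P} \<in> past M Y {0..t}" if P: "P \<in> sets borel" for Y P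
    proof -
      let ?H = "sigma (space M) (\<Union>u\<in>{0..t}. {Y u -` A \<inter> space M | A. A \<in> sets borel})"
      have Pow: "(\<Union>u\<in>{0..t}. {Y u -` A \<inter> space M | A. A \<in> sets borel}) \<subseteq> Pow (space M)" by auto
      have st: "sets ?H = past M Y {0..t}" unfolding past_def by (rule sets_measure_of[OF Pow])
      have sp: "space ?H = space M" by (rule space_measure_of[OF Pow])
      have "Y u \<in> borel_measurable ?H" if "u \<in> {0..t}" for u
        by (rule measurableI) (use in_past[OF that] in \<open>auto simp: st sp\<close>)
      then have "(\<lambda>\<omega>. Y t \<omega> - Y s \<omega>) \<in> borel_measurable ?H" using s by (intro borel_measurable_diff) auto
      from measurable_sets[OF this P] show ?thesis unfolding st sp by (simp add: vimage_def Int_def conj_commute)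
    qed
    have DX: "?DX \<in> proc_sigma M X" and DW: "?DW \<in> proc_sigma M W"
      by (rule subsetD[OF pX diffm[OF P]], rule subsetD[OF pW diffm[OF R]])
    have Xt: "past M X {0..s} \<subseteq> past M X {0..t}" and Wt: "past M W {0..s} \<subseteq> past M W {0..t}"
      by (rule past_mono; use s in auto)+
    have prodQ: "prob (D \<inter> (?DX \<inter> ?DW)) = prob D * (measure (gauss (t - s)) P * measure (gauss (t - s)) R)"
      if DQ: "D \<in> Q s" for D
    proof -
      obtain A B C where ABC: "D = A \<inter> B \<inter> C" "A \<in> past M X {0..s}" "B \<in> past M W {0..s}" "C \<in> rv_sigma M E"
        using DQ unfolding Q_def by blast
      have "D \<inter> (?DX \<inter> ?DW) = (A \<inter> ?DX) \<inter> (B \<inter> ?DW) \<inter> C" unfolding ABC(1) by (simp only: Int_ac)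
      moreover have "A \<inter> ?DX \<in> proc_sigma M X"
        by (rule subsetD[OF pX past_Int[OF subsetD[OF Xt ABC(2)] diffm[OF P]]])
      moreover have "B \<inter> ?DW \<in> proc_sigma M W"
        by (rule subsetD[OF pW past_Int[OF subsetD[OF Wt ABC(3)] diffm[OF R]]])
      ultimately have "prob (D \<inter> (?DX \<inter> ?DW)) = prob (A \<inter> ?DX) * prob (B \<inter> ?DW) * prob C"
        using indep[OF _ _ ABC(4)] by (simp only:)
      also have "\<dots> = prob A * prob B * prob C * (measure (gauss (t - s)) P * measure (gauss (t - s)) R)"
        by (simp add: std_BM_past[OF M X(1,2) s ABC(2) P] std_BM_past[OF M W(1,2) s ABC(3) R])
      also have "prob A * prob B * prob C = prob D"
        unfolding ABC(1) by (rule indep[OF subsetD[OF pX ABC(2)] subsetD[OF pW ABC(3)] ABC(4), symmetric])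
      finally show ?thesis .
    qed
    \<comment> \<open>The case D = space M identifies the probability of the two increment events,
      which brings \<open>prodQ\<close> into the form of \<open>prob_Int_sigma_sets\<close>.\<close>
    have spQ: "space M \<in> Q s"
      using Q_I[OF space_in_past space_in_past Esp] by simp
    have "space M \<inter> (?DX \<inter> ?DW) = ?DX \<inter> ?DW" by auto
    then have pD: "prob (?DX \<inter> ?DW) = measure (gauss (t - s)) P * measure (gauss (t - s)) R"
      using prodQ[OF spQ] by (simp add: prob_space)
    have "prob (D \<inter> (?DX \<inter> ?DW)) = prob D * prob (?DX \<inter> ?DW)"
    proof (rule prob_Int_sigma_sets[OF _ Qev])
      show "Int_stable (Q s)"
      proof (rule Int_stableI)
        fix D D' assume "D \<in> Q s" "D' \<in> Q s"
        then obtain A B C A' B' C' where *: "D = A \<inter> B \<inter> C" "A \<in> past M X {0..s}" "B \<in> past M W {0..s}" "C \<in> rv_sigma M E"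
          "D' = A' \<inter> B' \<inter> C'" "A' \<in> past M X {0..s}" "B' \<in> past M W {0..s}" "C' \<in> rv_sigma M E"
          unfolding Q_def by blast
        have "sigma_algebra (space M) (rv_sigma M E)" unfolding rv_sigma_def by (rule sigma_algebra_sigma_sets) auto
        then interpret e: sigma_algebra "space M" "rv_sigma M E" .
        have "D \<inter> D' = (A \<inter> A') \<inter> (B \<inter> B') \<inter> (C \<inter> C')" unfolding *(1,5) by (simp only: Int_ac)
        then show "D \<inter> D' \<in> Q s"
          using Q_I[OF past_Int[OF *(2,6)] past_Int[OF *(3,7)] e.Int[OF *(4,8)]] by (simp only:)
      qed
      have "?DX \<in> events" "?DW \<in> events" using subsetD[OF Xp diffm[OF P]] subsetD[OF Wp diffm[OF R]] by auto
      then show "?DX \<inter> ?DW \<in> events" by blast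
      show "D \<in> sigma_sets (space M) (Q s)" using D unfolding stG .
    qed (use prodQ pD in simp)
    then show "prob (D \<inter> ?DX \<inter> ?DW) = prob D * measure (gauss (t - s)) P * measure (gauss (t - s)) R"
      unfolding pD by (simp add: Int_assoc)
  qed (use X W E c in auto)
  show ?thesis using q.std_BM_departures unfolding q.departures_def .
qed

section \<open>Brownian queues in tandem\<close>

text \<open>The tandem with the partial sums of the exponentials added in. With input and sources as
  arguments the same recursion runs for the given network and for the one fed by \<open>W 1\<close>
  with shifted indices.\<close>

primrec net :: "real \<Rightarrow> (real \<Rightarrow> 'a \<Rightarrow> real) \<Rightarrow> (nat \<Rightarrow> real \<Rightarrow> 'a \<Rightarrow> real) \<Rightarrow> (nat \<Rightarrow> 'a \<Rightarrow> real)
    \<Rightarrow> nat \<Rightarrow> real \<Rightarrow> 'a \<Rightarrow> real" where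
  "net c A W E 0 = A"
| "net c A W E (Suc n) = (\<lambda>t \<omega>. dep c (\<lambda>s. net c A W E n s \<omega>) (\<lambda>s. W (Suc n) s \<omega>) (E (Suc n) \<omega>) t)"

lemma tandem_eq_net: "tandem A0 W E c n t \<omega> + (\<Sum>i\<in>{1..n}. E i \<omega>) = net c A0 W E n t \<omega>"
proof (induction n arbitrary: t)
  case 0
  then show ?case by simp
next
  case (Suc n)
  let ?S = "\<Sum>i\<in>{1..n}. E i \<omega>"
  have "(\<lambda>s. tandem A0 W E c n s \<omega>) = (\<lambda>s. net c A0 W E n s \<omega> - ?S)"
    by (rule ext) (simp add: Suc.IH[symmetric])
  then show ?case
    using dep_queue_op[of "\<lambda>s. net c A0 W E n s \<omega>" ?S "\<lambda>s. W (Suc n) s \<omega>" c "E (Suc n) \<omega>" t] by simp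
qed

locale brownian_tandem = prob_space M for M :: "'a measure" +
  fixes A0 :: "real \<Rightarrow> 'a \<Rightarrow> real" and W :: "nat \<Rightarrow> real \<Rightarrow> 'a \<Rightarrow> real" and E :: "nat \<Rightarrow> 'a \<Rightarrow> real" and c :: real
  assumes c: "0 < c"
    and A0_meas: "\<And>t. 0 \<le> t \<Longrightarrow> A0 t \<in> borel_measurable M"
    and A0_zero: "\<And>\<omega>. \<omega> \<in> space M \<Longrightarrow> A0 0 \<omega> = 0"
    and A0_cont: "\<And>\<omega>. \<omega> \<in> space M \<Longrightarrow> continuous_on {0..} (\<lambda>t. A0 t \<omega>)"
    and W_BM: "\<And>n. 1 \<le> n \<Longrightarrow> std_BM M (W n)"
    and W_zero: "\<And>n \<omega>. 1 \<le> n \<Longrightarrow> \<omega> \<in> space M \<Longrightarrow> W n 0 \<omega> = 0"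
    and W_cont: "\<And>n \<omega>. 1 \<le> n \<Longrightarrow> \<omega> \<in> space M \<Longrightarrow> continuous_on {0..} (\<lambda>t. W n t \<omega>)"
    and E_distributed: "\<And>n. 1 \<le> n \<Longrightarrow> distributed M lborel (E n) (exponential_density c)"
    and E_nonneg: "\<And>n \<omega>. 1 \<le> n \<Longrightarrow> \<omega> \<in> space M \<Longrightarrow> 0 \<le> E n \<omega>"
    and sources_indep: "indep_sets (tandem_sigmas M A0 W E) tandem_index"
begin

text \<open>Coupling step \<open>n\<close> starts from the output of station \<open>Suc n\<close> of
  the given network, so the indices used so far go up to \<open>Suc n\<close>.\<close>

definition sources :: "nat \<Rightarrow> src set" where
  "sources n = {Arr} \<union> Srv ` {1..Suc n} \<union> Expo ` {1..Suc n}"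

definition hist :: "nat \<Rightarrow> 'a measure" where
  "hist n = sigma (space M) (\<Union>i\<in>sources n. tandem_sigmas M A0 W E i)"

lemma sigmas_events: "i \<in> tandem_index \<Longrightarrow> tandem_sigmas M A0 W E i \<subseteq> events"
  using sources_indep unfolding indep_sets_def by blast

lemma sources_index: "sources n \<subseteq> tandem_index"
  unfolding sources_def tandem_index_def by auto

lemma hist_events: "(\<Union>i\<in>sources n. tandem_sigmas M A0 W E i) \<subseteq> events"
  using sigmas_events sources_index by blast

lemma hist_Pow: "(\<Union>i\<in>sources n. tandem_sigmas M A0 W E i) \<subseteq> Pow (space M)"
  using hist_events sets.sets_into_space by blast

lemma space_hist [simp]: "space (hist n) = space M"
  unfolding hist_def by (rule space_measure_of[OF hist_Pow])

lemma sets_hist: "sets (hist n) = sigma_sets (space M) (\<Union>i\<in>sources n. tandem_sigmas M A0 W E i)"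
  unfolding hist_def by (rule sets_measure_of[OF hist_Pow])

lemma sigmas_hist: "i \<in> sources n \<Longrightarrow> A \<in> tandem_sigmas M A0 W E i \<Longrightarrow> A \<in> sets (hist n)"
  unfolding sets_hist by (rule sigma_sets.Basic) blast

lemma A0_hist: "0 \<le> t \<Longrightarrow> A0 t \<in> borel_measurable (hist n)"
proof (rule measurableI)
  fix A :: "real set" assume "0 \<le> t" "A \<in> sets borel"
  then have "A0 t -` A \<inter> space M \<in> tandem_sigmas M A0 W E Arr" unfolding tandem_sigmas_def by (simp add: in_proc_sigma)
  then show "A0 t -` A \<inter> space (hist n) \<in> sets (hist n)"
    unfolding space_hist by (rule sigmas_hist[rotated]) (simp add: sources_def)
qed simp

lemma W_hist: "0 \<le> t \<Longrightarrow> 1 \<le> k \<Longrightarrow> k \<le> Suc n \<Longrightarrow> W k t \<in> borel_measurable (hist n)"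
proof (rule measurableI)
  fix A :: "real set" assume k: "0 \<le> t" "1 \<le> k" "k \<le> Suc n" "A \<in> sets borel"
  then have "W k t -` A \<inter> space M \<in> tandem_sigmas M A0 W E (Srv k)" unfolding tandem_sigmas_def by (simp add: in_proc_sigma)
  then show "W k t -` A \<inter> space (hist n) \<in> sets (hist n)"
    unfolding space_hist by (rule sigmas_hist[rotated]) (use k in \<open>simp add: sources_def\<close>)
qed simp

lemma E_hist: "1 \<le> k \<Longrightarrow> k \<le> Suc n \<Longrightarrow> E k \<in> borel_measurable (hist n)"
proof (rule measurableI)
  fix A :: "real set" assume k: "1 \<le> k" "k \<le> Suc n" "A \<in> sets borel"
  then have "E k -` A \<inter> space M \<in> tandem_sigmas M A0 W E (Expo k)"
    unfolding tandem_sigmas_def rv_sigma_def by (auto intro: sigma_sets.Basic)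
  then show "E k -` A \<inter> space (hist n) \<in> sets (hist n)"
    unfolding space_hist by (rule sigmas_hist[rotated]) (use k in \<open>simp add: sources_def\<close>)
qed simp

lemma sigmas_Int_stable: "Int_stable (tandem_sigmas M A0 W E i)"
proof -
  have s: "Int_stable (sigma_sets (space M) Q)" if "Q \<subseteq> Pow (space M)" for Q
  proof (rule Int_stableI)
    interpret sigma_algebra "space M" "sigma_sets (space M) Q" by (rule sigma_algebra_sigma_sets[OF that])
    show "A \<inter> B \<in> sigma_sets (space M) Q" if "A \<in> sigma_sets (space M) Q" "B \<in> sigma_sets (space M) Q" for A B
      using that by blast
  qed
  show ?thesis
    unfolding tandem_sigmas_def proc_sigma_def rv_sigma_def by (cases i) (auto intro!: s)
qed

text \<open>The independent sources are grouped into three disjoint blocks: those behind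
  \<open>hist n\<close> and the two fresh ones of the next station.\<close>

lemma hist_indep:
  assumes A: "A \<in> sets (hist n)" and B: "B \<in> proc_sigma M (W (Suc (Suc n)))" and C: "C \<in> rv_sigma M (E (Suc (Suc n)))"
  shows "prob (A \<inter> B \<inter> C) = prob A * prob B * prob C"
proof -
  define I where "I j = (if j = 0 then sources n else if j = 1 then {Srv (Suc (Suc n))} else {Expo (Suc (Suc n))})" for j :: nat
  let ?S = "\<lambda>j. sigma_sets (space M) (\<Union>i\<in>I j. tandem_sigmas M A0 W E i)"
  have "indep_sets ?S {0, 1, 2}"
  proof (rule indep_sets_collect_sigma)
    show "indep_sets (tandem_sigmas M A0 W E) (\<Union>j\<in>{0, 1, 2}. I j)"
      by (rule indep_sets_mono_index[OF _ sources_indep])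
        (use sources_index in \<open>auto simp: I_def tandem_index_def split: if_splits\<close>)
    show "disjoint_family_on I {0, 1, 2}"
      unfolding disjoint_family_on_def I_def sources_def by auto
  qed (rule sigmas_Int_stable)
  moreover define Q where "Q j = (if j = 0 then A else if j = 1 then B else C)" for j :: nat
  have "\<forall>j\<in>{0, 1, 2}. Q j \<in> ?S j"
    using A B C unfolding Q_def I_def sets_hist by (auto simp: tandem_sigmas_def intro: sigma_sets.Basic)
  ultimately have "prob (\<Inter>j\<in>{0, 1, 2}. Q j) = (\<Prod>j\<in>{0, 1, 2}. prob (Q j))"
    by (intro indep_setsD[where I="{0, 1, 2}"]) auto
  moreover have "(\<Inter>j\<in>{0, 1, 2}. Q j) = A \<inter> B \<inter> C" unfolding Q_def by auto
  moreover have "(\<Prod>j\<in>{0, 1, 2}. prob (Q j)) = prob A * prob B * prob C"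
    unfolding Q_def by (simp add: mult.assoc)
  ultimately show ?thesis by simp
qed

lemma E_distr: "1 \<le> n \<Longrightarrow> distr M borel (E n) = expo c"
proof -
  assume n: "1 \<le> n"
  have "distr M borel (E n) = distr M lborel (E n)" by (rule distr_cong) simp_all
  then show ?thesis using E_distributed[OF n] unfolding distributed_def by simp
qed

text \<open>At the start the given network has used \<open>A0\<close>, \<open>W 1\<close> and
  \<open>E 1\<close>, while the other one is still at its input \<open>W 1\<close>; all of this lies
  in \<open>hist 0\<close>, and from the second station on the services coincide.\<close>

sublocale coupling: tandem_coupling M hist
  "\<lambda>n. net c A0 W E (Suc n)" "net c (W 1) (\<lambda>n. W (Suc n)) (\<lambda>n. E (Suc n))"
  "\<lambda>n. W (Suc (Suc n))" "\<lambda>n. E (Suc (Suc n))" c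
proof
  show "0 < c" by (rule c)
  show "subalgebra M (hist n)" for n
    unfolding subalgebra_def space_hist sets_hist using sets.sigma_sets_subset[OF hist_events] by blast
  have "sources n \<subseteq> sources (Suc n)" for n unfolding sources_def by auto
  then show "sets (hist n) \<subseteq> sets (hist (Suc n))" for n
    unfolding sets_hist by (intro sigma_sets_mono' UN_mono) auto
  show "net c A0 W E (Suc 0) t \<in> borel_measurable (hist 0)" if "0 \<le> t" for t
    unfolding net.simps
    by (rule measurable_dep) (use that in \<open>auto intro!: A0_hist W_hist E_hist A0_cont W_cont\<close>)
  show "net c A0 W E (Suc 0) 0 \<omega> = 0" if "\<omega> \<in> space M" for \<omega>
    unfolding net.simps by (rule dep_zero) (use that A0_zero W_zero E_nonneg in auto)
  show "continuous_on {0..} (\<lambda>t. net c A0 W E (Suc 0) t \<omega>)" if "\<omega> \<in> space M" for \<omega>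
    unfolding net.simps by (rule continuous_on_dep) (use that A0_cont W_cont in auto)
  show "prob {\<omega>\<in>space M. a < E (Suc (Suc n)) \<omega>} = exp (- c * a)" if "0 \<le> a" for n a
    using exponential_distributedD_gt[OF E_distributed[of "Suc (Suc n)"] that c] by (simp add: mult.commute)
qed (auto intro: W_hist E_hist W_zero W_cont E_nonneg W_BM hist_indep)

text \<open>\<open>burke\<close> applies at every station: the current output is measurable for
  \<open>hist n\<close>, hence independent of the next services.\<close>

lemma net_std_BM: "std_BM M (net c (W 1) (\<lambda>n. W (Suc n)) (\<lambda>n. E (Suc n)) n)"
proof (induction n)
  case 0
  then show ?case using W_BM by simp
next
  case (Suc n)
  let ?Y = "net c (W 1) (\<lambda>n. W (Suc n)) (\<lambda>n. E (Suc n)) n"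
  have "std_BM M (\<lambda>t \<omega>. dep c (\<lambda>s. ?Y s \<omega>) (\<lambda>s. W (Suc (Suc n)) s \<omega>) (E (Suc (Suc n)) \<omega>) t)"
  proof (rule burke[OF prob_space_axioms Suc.IH])
    show "prob (A \<inter> B \<inter> C) = prob A * prob B * prob C"
      if "A \<in> proc_sigma M ?Y" "B \<in> proc_sigma M (W (Suc (Suc n)))" "C \<in> rv_sigma M (E (Suc (Suc n)))" for A B C
    proof (rule hist_indep[OF _ that(2,3)])
      have "proc_sigma M ?Y \<subseteq> sets (hist n)"
        unfolding proc_sigma_eq_past by (rule past_subset, rule coupling.Y_paths(1)) auto
      then show "A \<in> sets (hist n)" using that(1) by blast
    qed
    show "E (Suc (Suc n)) \<in> borel_measurable M" by (rule coupling.measurable_M(4))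
  qed (use coupling.Y_paths(2,3) W_BM W_zero W_cont E_nonneg E_distr c in auto)
  then show ?case by simp
qed

lemma net_expectation_LIMSEQ:
  assumes \<Phi>: "lu_test \<Phi>"
    and N: "prob_space N" "std_BM N B" "\<And>\<omega>. \<omega> \<in> space N \<Longrightarrow> continuous_on {0..} (\<lambda>t. B t \<omega>)"
      "\<And>\<omega>. \<omega> \<in> space N \<Longrightarrow> B 0 \<omega> = 0"
  shows "(\<lambda>n. expectation (\<lambda>\<omega>. \<Phi> (\<lambda>t. net c A0 W E n t \<omega>))) \<longlonglongrightarrow> (\<integral>\<omega>. \<Phi> (\<lambda>t. B t \<omega>) \<partial>N)"
  by (rule LIMSEQ_imp_Suc) (rule coupled_paths.expectation_LIMSEQ[OF coupling.coupled_paths[OF net_std_BM] \<Phi> N])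

lemma net_measurable:
  assumes "lu_test \<Phi>"
  shows "(\<lambda>\<omega>. \<Phi> (\<lambda>t. net c A0 W E n t \<omega>)) \<in> borel_measurable M"
proof (cases n)
  case 0
  then show ?thesis using lu_test_measurable(3)[OF assms A0_meas A0_cont A0_zero] by simp
next
  case (Suc m)
  show ?thesis unfolding Suc by (rule lu_test_measurable(3)[OF assms coupling.measurable_M(1) coupling.X_paths(3,2)])
qed

end

section \<open>Discarding a null set\<close>

text \<open>On the trace of an event of probability one, almost sure properties can be made to hold
  at every point.\<close>

locale full_set = prob_space M for M :: "'a measure" +
  fixes S :: "'a set"
  assumes S: "S \<in> events" and AE_S: "AE \<omega> in M. \<omega> \<in> S"
begin

abbreviation "R \<equiv> restrict_space M S"

lemma space_R [simp]: "space R = S"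
  using sets.sets_into_space[OF S] by (auto simp: space_restrict_space)

lemma prob_space_R: "prob_space R"
proof (rule prob_space_restrict_space[OF S])
  show "emeasure M S = 1" using AE_S prob_eq_1[OF S] by (simp add: emeasure_eq_measure)
qed

lemma emeasure_R: "A \<in> events \<Longrightarrow> emeasure R (A \<inter> S) = emeasure M A"
proof -
  assume A: "A \<in> events"
  have "emeasure R (A \<inter> S) = emeasure M (A \<inter> S)" using S by (intro emeasure_restrict_space) auto
  also have "\<dots> = emeasure M A" using A S AE_S by (intro emeasure_eq_AE) auto
  finally show ?thesis .
qed

lemma measure_R: "A \<in> events \<Longrightarrow> measure R (A \<inter> S) = prob A"
  using emeasure_R by (simp add: measure_def)

lemma sets_R: "A \<in> events \<Longrightarrow> A \<inter> S \<in> sets R"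
  unfolding sets_restrict_space by auto

lemma indep_sets_R:
  assumes ind: "indep_sets F I"
  shows "prob_space.indep_sets R (\<lambda>i. (\<lambda>A. A \<inter> S) ` F i) I"
proof -
  interpret R: prob_space R by (rule prob_space_R)
  have ev: "\<And>i. i \<in> I \<Longrightarrow> F i \<subseteq> events" using ind unfolding indep_sets_def by blast
  show ?thesis
  proof (rule R.indep_setsI)
    show "(\<lambda>A. A \<inter> S) ` F i \<subseteq> sets R" if "i \<in> I" for i using ev[OF that] sets_R by blast
    fix A J assume J: "J \<noteq> {}" "J \<subseteq> I" "finite J" and "\<forall>j\<in>J. A j \<in> (\<lambda>A. A \<inter> S) ` F j"
    then obtain B where B: "\<And>j. j \<in> J \<Longrightarrow> B j \<in> F j" "\<And>j. j \<in> J \<Longrightarrow> A j = B j \<inter> S"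
      unfolding image_iff by metis
    have Bev: "B j \<in> events" if "j \<in> J" for j using B(1)[OF that] ev J that by blast
    have "(\<Inter>j\<in>J. A j) = (\<Inter>j\<in>J. B j) \<inter> S" using B(2) J by auto
    moreover have "(\<Inter>j\<in>J. B j) \<in> events" using Bev J by auto
    ultimately have "measure R (\<Inter>j\<in>J. A j) = prob (\<Inter>j\<in>J. B j)" by (simp add: measure_R)
    also have "\<dots> = (\<Prod>j\<in>J. prob (B j))" using B(1) J by (intro indep_setsD[OF ind]) auto
    also have "\<dots> = (\<Prod>j\<in>J. measure R (A j))"
      by (rule prod.cong[OF refl]) (simp add: B(2) measure_R[OF Bev])
    finally show "measure R (\<Inter>j\<in>J. A j) = (\<Prod>j\<in>J. measure R (A j))" .
  qed
qed

text \<open>The trace is the preimage under the inclusion of \<open>S\<close>, and preimages commute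
  with generating a sigma-algebra.\<close>

lemma sigma_sets_R:
  assumes "Q \<subseteq> Pow (space M)"
  shows "sigma_sets S ((\<lambda>A. A \<inter> S) ` Q) = (\<lambda>A. A \<inter> S) ` sigma_sets (space M) Q"
proof -
  have "(\<lambda>x. x) \<in> S \<rightarrow> space M" using sets.sets_into_space[OF S] by auto
  from sigma_sets_vimage_commute[OF this, of Q] show ?thesis by (simp add: image_def conj_commute Bex_def)
qed

lemma vimage_R: "{X -` A \<inter> S | A. A \<in> sets borel} = (\<lambda>A. A \<inter> S) ` {X -` A \<inter> space M | A. A \<in> sets borel}"
proof -
  have "X -` A \<inter> space M \<inter> S = X -` A \<inter> S" for A using sets.sets_into_space[OF S] by auto
  then show ?thesis by (auto simp: image_iff)
qed

lemma proc_sigma_R: "proc_sigma R X = (\<lambda>A. A \<inter> S) ` proc_sigma M X"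
  unfolding proc_sigma_def space_R vimage_R by (subst sigma_sets_R[symmetric]) (auto simp: image_UN)

lemma rv_sigma_R: "rv_sigma R X = (\<lambda>A. A \<inter> S) ` rv_sigma M X"
  unfolding rv_sigma_def space_R vimage_R by (subst sigma_sets_R[symmetric]) auto

lemma tandem_sigmas_R: "tandem_sigmas R A W E i = (\<lambda>A. A \<inter> S) ` tandem_sigmas M A W E i"
  unfolding tandem_sigmas_def by (cases i) (simp_all add: proc_sigma_R rv_sigma_R)

lemma distributed_R:
  assumes "distributed M lborel X f" shows "distributed R lborel X f"
proof -
  have Xm: "X \<in> measurable M lborel" using assms unfolding distributed_def by blast
  have XR: "X \<in> measurable R lborel" by (rule measurable_restrict_space1[OF Xm])
  have "distr R lborel X = distr M lborel X"
  proof (rule measure_eqI)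
    fix A assume "A \<in> sets (distr R lborel X)"
    then have A: "A \<in> sets lborel" by simp
    have "X -` A \<inter> space R = (X -` A \<inter> space M) \<inter> S" using sets.sets_into_space[OF S] by auto
    then show "emeasure (distr R lborel X) A = emeasure (distr M lborel X) A"
      unfolding emeasure_distr[OF XR A] emeasure_distr[OF Xm A] using emeasure_R[OF measurable_sets[OF Xm A]] by simp
  qed simp
  then show ?thesis using assms XR unfolding distributed_def by simp
qed

lemma std_BM_R:
  assumes "std_BM M X" shows "std_BM R X"
proof -
  interpret R: prob_space R by (rule prob_space_R)
  have SR: "S \<inter> space M \<in> events" using S by auto
  show ?thesis
    unfolding std_BM_def
  proof (intro conjI allI impI)
    show "X t \<in> borel_measurable R" if "0 \<le> t" for t
      by (rule measurable_restrict_space1[OF std_BM_measurable[OF assms that]])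
    show "AE \<omega> in R. X 0 \<omega> = 0" "AE \<omega> in R. continuous_on {0..} (\<lambda>t. X t \<omega>)"
      using assms unfolding std_BM_def AE_restrict_space_iff[OF SR] by (auto elim: eventually_mono)
    show "distributed R lborel (\<lambda>\<omega>. X t \<omega> - X s \<omega>) (normal_density 0 (sqrt (t - s)))" if "0 \<le> s \<and> s < t" for s t
      using assms that unfolding std_BM_def by (intro distributed_R) blast
    fix ts :: "nat \<Rightarrow> real" and k assume "0 \<le> ts 0 \<and> (\<forall>i<k. ts i < ts (Suc i))"
    then have "indep_vars (\<lambda>_. borel) (\<lambda>i \<omega>. X (ts (Suc i)) \<omega> - X (ts i) \<omega>) {..<k}"
      using assms unfolding std_BM_def by blast
    then have iv: "\<And>i. i \<in> {..<k} \<Longrightarrow> (\<lambda>\<omega>. X (ts (Suc i)) \<omega> - X (ts i) \<omega>) \<in> borel_measurable M"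
      and ind: "indep_sets (\<lambda>i. {(\<lambda>\<omega>. X (ts (Suc i)) \<omega> - X (ts i) \<omega>) -` A \<inter> space M | A. A \<in> sets borel}) {..<k}"
      unfolding indep_vars_def2 by auto
    show "R.indep_vars (\<lambda>_. borel) (\<lambda>i \<omega>. X (ts (Suc i)) \<omega> - X (ts i) \<omega>) {..<k}"
      unfolding R.indep_vars_def2 space_R vimage_R using indep_sets_R[OF ind] iv
      by (auto intro: measurable_restrict_space1)
  qed
qed

text \<open>Outside \<open>S\<close> the function may fail to be measurable for \<open>M\<close>,
  but that set is null, so it is measurable for the completion and its values there do not count.
  This links the trace space with the integrals of the theorem.\<close>

lemma integral_completion_R:
  assumes f: "f \<in> borel_measurable R"
  shows "integral\<^sup>L (completion M) f = (\<integral>\<omega>. f \<omega> \<partial>R :: real)"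
proof -
  have SR: "S \<inter> space M \<in> events" using S by auto
  let ?h = "\<lambda>\<omega>. indicator S \<omega> *\<^sub>R f \<omega>"
  have h: "?h \<in> borel_measurable M"
    using f borel_measurable_restrict_space_iff[OF SR, of f] by simp
  have null: "space M - S \<in> null_sets M"
  proof (rule null_setsI)
    show "emeasure M (space M - S) = 0"
      using AE_S prob_eq_1[OF S] by (simp add: emeasure_eq_measure prob_compl[OF S])
  qed (use S in auto)
  have fm: "f \<in> borel_measurable (completion M)"
  proof (rule measurableI)
    fix A :: "real set" assume A: "A \<in> sets borel"
    show "f -` A \<inter> space (completion M) \<in> sets (completion M)"
    proof (rule sets_completionI[OF _ _ null])
      show "?h -` A \<inter> space M \<inter> S \<in> events" using measurable_sets[OF h A] S by blast
      show "f -` A \<inter> space (completion M) = (?h -` A \<inter> space M \<inter> S) \<union> (f -` A \<inter> (space M - S))"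
        using sets.sets_into_space[OF S] by (auto simp: indicator_def split: if_splits)
    qed blast
  qed simp
  have "AE \<omega> in completion M. f \<omega> = ?h \<omega>"
    using AE_completion[OF AE_S] by eventually_elim simp
  then have "integral\<^sup>L (completion M) f = integral\<^sup>L (completion M) ?h"
    by (intro integral_cong_AE fm measurable_completion h)
  also have "\<dots> = integral\<^sup>L M ?h" by (rule integral_completion[OF h])
  also have "\<dots> = (\<integral>\<omega>. f \<omega> \<partial>R)" by (rule integral_restrict_space[OF SR, symmetric])
  finally show ?thesis .
qed

end

lemma (in prob_space) full_set_exists:
  assumes "AE \<omega> in M. P \<omega>"
  shows "\<exists>S. full_set M S \<and> (\<forall>\<omega>\<in>S. P \<omega>)"
proof -
  obtain N where N: "{\<omega>\<in>space M. \<not> P \<omega>} \<subseteq> N" "N \<in> null_sets M"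
    using AE_E[OF assms] by (metis null_setsI)
  have "full_set M (space M - N)"
  proof
    show "space M - N \<in> events" using N(2) by auto
    show "AE \<omega> in M. \<omega> \<in> space M - N" using AE_not_in[OF N(2)] AE_space by eventually_elim simp
  qed
  then show ?thesis using N(1) by blast
qed

lemma (in prob_space) exponential_AE_nonneg:
  assumes "distributed M lborel X (exponential_density c)"
  shows "AE \<omega> in M. 0 \<le> X \<omega>"
proof -
  have X: "X \<in> measurable M lborel" and d: "distr M lborel X = expo c"
    using assms unfolding distributed_def by auto
  have "AE x in expo c. 0 \<le> x"
    by (subst AE_density) (auto simp: exponential_density_def)
  then have "AE x in distr M lborel X. 0 \<le> x" unfolding d .
  then show ?thesis by (rule AE_distrD[OF X])
qed

theorem theorem2:
  fixes M :: "'a measure" and A0 :: "real \<Rightarrow> 'a \<Rightarrow> real"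
    and W :: "nat \<Rightarrow> real \<Rightarrow> 'a \<Rightarrow> real" and E :: "nat \<Rightarrow> 'a \<Rightarrow> real" and c :: real
    and N :: "'b measure" and B :: "real \<Rightarrow> 'b \<Rightarrow> real"
  assumes "prob_space M"
    and "\<forall>t\<ge>0. A0 t \<in> borel_measurable M"
    and "AE \<omega> in M. continuous_on {0..} (\<lambda>t. A0 t \<omega>)"
    and "AE \<omega> in M. A0 0 \<omega> = 0"
    and "c > 0"
    and "\<forall>n\<ge>1. std_BM M (W n)"
    and "\<forall>n\<ge>1. distributed M lborel (E n) (exponential_density c)"
    and "prob_space.indep_sets M (tandem_sigmas M A0 W E) tandem_index"
    and "prob_space N" and "std_BM N B"
  shows "\<forall>\<Phi>. lu_test \<Phi> \<longrightarrow>
     (\<lambda>n. integral\<^sup>L (completion M)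
            (\<lambda>\<omega>. \<Phi> (\<lambda>t. tandem A0 W E c n t \<omega> + (\<Sum>i\<in>{1..n}. E i \<omega>))))
     \<longlonglongrightarrow> integral\<^sup>L (completion N) (\<lambda>\<omega>. \<Phi> (\<lambda>t. B t \<omega>))"
proof (intro allI impI)
  fix \<Phi> :: "(real \<Rightarrow> real) \<Rightarrow> real" assume \<Phi>: "lu_test \<Phi>"
  interpret M: prob_space M by fact
  interpret N: prob_space N by fact
  have W_AE: "AE \<omega> in M. W n 0 \<omega> = 0 \<and> continuous_on {0..} (\<lambda>t. W n t \<omega>)" if "1 \<le> n" for n
    using assms(6) that unfolding std_BM_def by (auto elim: eventually_elim2)
  have E_AE: "AE \<omega> in M. 0 \<le> E n \<omega>" if "1 \<le> n" for n
    using assms(7) that by (blast intro: M.exponential_AE_nonneg)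
  \<comment> \<open>There are countably many stations, so all almost sure path properties hold on a
    common event.\<close>
  have "AE \<omega> in M. \<forall>n. 1 \<le> n \<longrightarrow> (W n 0 \<omega> = 0 \<and> continuous_on {0..} (\<lambda>t. W n t \<omega>)) \<and> 0 \<le> E n \<omega>"
    unfolding AE_all_countable using W_AE E_AE by (auto elim: eventually_elim2)
  with assms(3,4) have "AE \<omega> in M. continuous_on {0..} (\<lambda>t. A0 t \<omega>) \<and> A0 0 \<omega> = 0 \<and>
      (\<forall>n. 1 \<le> n \<longrightarrow> (W n 0 \<omega> = 0 \<and> continuous_on {0..} (\<lambda>t. W n t \<omega>)) \<and> 0 \<le> E n \<omega>)"
    by eventually_elim blast
  from M.full_set_exists[OF this] obtain S where S: "full_set M S"
    and good: "\<forall>\<omega>\<in>S. continuous_on {0..} (\<lambda>t. A0 t \<omega>) \<and> A0 0 \<omega> = 0 \<and>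
      (\<forall>n. 1 \<le> n \<longrightarrow> (W n 0 \<omega> = 0 \<and> continuous_on {0..} (\<lambda>t. W n t \<omega>)) \<and> 0 \<le> E n \<omega>)"
    by (elim exE conjE)
  have "AE \<omega> in N. B 0 \<omega> = 0 \<and> continuous_on {0..} (\<lambda>t. B t \<omega>)"
    using assms(10) unfolding std_BM_def by (auto elim: eventually_elim2)
  from N.full_set_exists[OF this] obtain T where T: "full_set N T"
    and goodB: "\<forall>\<omega>\<in>T. B 0 \<omega> = 0 \<and> continuous_on {0..} (\<lambda>t. B t \<omega>)"
    by (elim exE conjE)
  interpret S: full_set M S by (rule S)
  interpret T: full_set N T by (rule T)
  interpret bt: brownian_tandem "restrict_space M S" A0 W E c
  proof (rule brownian_tandem.intro[OF S.prob_space_R], unfold_locales)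
    interpret R: prob_space "restrict_space M S" by (rule S.prob_space_R)
    show "A0 t \<in> borel_measurable (restrict_space M S)" if "0 \<le> t" for t
      using assms(2) that by (blast intro: measurable_restrict_space1)
    show "R.indep_sets (tandem_sigmas (restrict_space M S) A0 W E) tandem_index"
      using S.indep_sets_R[OF assms(8)] unfolding S.tandem_sigmas_R[abs_def] .
    show "std_BM (restrict_space M S) (W n)" if "1 \<le> n" for n
      using assms(6) that by (intro S.std_BM_R) blast
    show "distributed (restrict_space M S) lborel (E n) (exponential_density c)" if "1 \<le> n" for n
      using assms(7) that by (intro S.distributed_R) blast
  qed (use assms(5) good in auto)
  have BT: "(\<lambda>\<omega>. \<Phi> (\<lambda>t. B t \<omega>)) \<in> borel_measurable (restrict_space N T)"
    by (rule lu_test_measurable(3)[OF \<Phi> std_BM_measurable[OF T.std_BM_R[OF assms(10)]]]) (use goodB in auto)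
  have "(\<lambda>n. bt.expectation (\<lambda>\<omega>. \<Phi> (\<lambda>t. net c A0 W E n t \<omega>))) \<longlonglongrightarrow> (\<integral>\<omega>. \<Phi> (\<lambda>t. B t \<omega>) \<partial>restrict_space N T)"
    by (rule bt.net_expectation_LIMSEQ[OF \<Phi> T.prob_space_R T.std_BM_R[OF assms(10)]]) (use goodB in auto)
  then show "(\<lambda>n. integral\<^sup>L (completion M)
            (\<lambda>\<omega>. \<Phi> (\<lambda>t. tandem A0 W E c n t \<omega> + (\<Sum>i\<in>{1..n}. E i \<omega>))))
     \<longlonglongrightarrow> integral\<^sup>L (completion N) (\<lambda>\<omega>. \<Phi> (\<lambda>t. B t \<omega>))"
    unfolding tandem_eq_net S.integral_completion_R[OF bt.net_measurable[OF \<Phi>]] T.integral_completion_R[OF BT] .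
qed

end
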